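(* Let $0\le p<1$, $q>0$, and $\mu=\sum_{i=1}^N\alpha_i\delta_{v_i}$ with $\alpha_i>0$ and unit vectors $v_1,\dots,v_N\in S^{n-1}$ not contained in any closed hemisphere. If $v_1,\dots,v_N$ are in general position in dimension $n$, then there exists a polytope $P\in\mathcal P(v_1,\dots,v_N)$ containing the origin in its interior such that $F_{p,q}(P,\cdot)=\mu$.
   Context: Work in $\mathbb R^n$, $n\ge2$; $\omega_n$ is the volume of the unit ball. Unit vectors are in general position in dimension $n$ if any $n$ of them are linearly independent. $\mathcal P(v_1,\dots,v_N)$ is the set of polytopes with nonempty interior whose facet outer unit normals lie in $\{v_1,\dots,v_N\}$. $h_K(v)=\max_{x\in K}x\cdot v$. For a compact convex $K$ and $z\in K$: $\rho_{K,z}(u)=\max\{t\ge0:z+tu\in K\}$, $\widetilde V_s(K,z)=\frac1n\int_{S_z^+}\rho_{K,z}(u)^s\,du$ with $S_z^+=\{u\in S^{n-1}:\rho_{K,z}(u)>0\}$. For a convex body $K$, $F_q(K,\eta)=\frac{2q}{\omega_n}\int_{\nu_K^{-1}(\eta)}\widetilde V_{q-1}(K,z)\,d\mathcal H^{n-1}(z)$ for Borel $\eta\subset S^{n-1}$ ($\nu_K$ the outer unit normal map of $\partial K$), and for $o\in K$, $dF_{p,q}(K,\cdot)=h_K^{1-p}dF_q(K,\cdot)$. *)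

theory Defs
  imports "HOL-Analysis.Analysis"
begin

definition hausdorff_outer :: "real \<Rightarrow> 'a::euclidean_space set \<Rightarrow> ennreal" where
  "hausdorff_outer s A =
     (SUP \<delta>\<in>{0<..}. INF C\<in>{C :: nat \<Rightarrow> 'a set. A \<subseteq> (\<Union>i. C i) \<and>
                              (\<forall>i. bounded (C i) \<and> diameter (C i) \<le> \<delta>)}.
        (\<Sum>i. ennreal (unit_ball_vol s * (diameter (C i) / 2) powr s)))"

definition hausdorff_measure :: "real \<Rightarrow> 'a::euclidean_space measure" where
  "hausdorff_measure s = measure_of UNIV (sets borel) (hausdorff_outer s)"

definition support_fun :: "'a::euclidean_space set \<Rightarrow> 'a \<Rightarrow> real" where
  "support_fun K v = Sup ((\<lambda>x. x \<bullet> v) ` K)"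

definition radial_fun :: "'a::euclidean_space set \<Rightarrow> 'a \<Rightarrow> 'a \<Rightarrow> real" where
  "radial_fun K z u = Sup {t. t \<ge> 0 \<and> z + t *\<^sub>R u \<in> K}"

text \<open>Dual quermassintegral-type quantity: (1/n) times the integral over
  S_z^+ = {u in the unit sphere. rho_{K,z}(u) > 0} of rho^s w.r.t. spherical
  Lebesgue measure (= H^{n-1} on the unit sphere).\<close>
definition Vtilde :: "real \<Rightarrow> 'a::euclidean_space set \<Rightarrow> 'a \<Rightarrow> ennreal" where
  "Vtilde s K z =
     ennreal (1 / real DIM('a)) *
     (\<integral>\<^sup>+ u \<in> {u \<in> sphere 0 1. radial_fun K z u > 0}.
         ennreal (radial_fun K z u powr s) \<partial>hausdorff_measure (real DIM('a) - 1))"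

definition outer_normal :: "'a::euclidean_space set \<Rightarrow> 'a \<Rightarrow> 'a \<Rightarrow> bool" where
  "outer_normal K z v \<longleftrightarrow> norm v = 1 \<and> (\<forall>x\<in>K. (x - z) \<bullet> v \<le> 0)"

definition normal_preimage :: "'a::euclidean_space set \<Rightarrow> 'a set \<Rightarrow> 'a set" where
  "normal_preimage K \<eta> = {z \<in> frontier K. \<exists>v\<in>\<eta>. outer_normal K z v}"

definition Fq :: "real \<Rightarrow> 'a::euclidean_space set \<Rightarrow> 'a set \<Rightarrow> ennreal" where
  "Fq q K \<eta> =
     ennreal (2 * q / unit_ball_vol (real DIM('a))) *
     (\<integral>\<^sup>+ z \<in> normal_preimage K \<eta>. Vtilde (q - 1) K z
        \<partial>hausdorff_measure (real DIM('a) - 1))"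

definition Fq_measure :: "real \<Rightarrow> 'a::euclidean_space set \<Rightarrow> 'a measure" where
  "Fq_measure q K =
     measure_of (sphere 0 1) (sets (restrict_space borel (sphere 0 1))) (Fq q K)"

definition Fpq_measure :: "real \<Rightarrow> real \<Rightarrow> 'a::euclidean_space set \<Rightarrow> 'a measure" where
  "Fpq_measure p q K =
     density (Fq_measure q K) (\<lambda>v. ennreal (support_fun K v powr (1 - p)))"

definition facet_normal :: "'a::euclidean_space set \<Rightarrow> 'a set \<Rightarrow> 'a \<Rightarrow> bool" where
  "facet_normal P F v \<longleftrightarrow> norm v = 1 \<and> F \<subseteq> {x \<in> P. x \<bullet> v = support_fun P v}"

definition polytopes_with_normals :: "nat \<Rightarrow> (nat \<Rightarrow> 'a::euclidean_space) \<Rightarrow> 'a set set" where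
  "polytopes_with_normals N v =
     {P. polytope P \<and> interior P \<noteq> {} \<and>
         (\<forall>F. F facet_of P \<longrightarrow> (\<exists>i<N. facet_normal P F (v i)))}"

definition general_position :: "nat \<Rightarrow> (nat \<Rightarrow> 'a::euclidean_space) \<Rightarrow> bool" where
  "general_position N v \<longleftrightarrow>
     (\<forall>I \<subseteq> {..<N}. card I = DIM('a) \<longrightarrow> inj_on v I \<and> independent (v ` I))"

definition in_closed_hemisphere :: "nat \<Rightarrow> (nat \<Rightarrow> 'a::euclidean_space) \<Rightarrow> bool" where
  "in_closed_hemisphere N v \<longleftrightarrow> (\<exists>w\<in>sphere 0 1. \<forall>i<N. v i \<bullet> w \<ge> 0)"

end

(*
  Let Q be the polytope of weights w >= 0 with sum 1 and sum w_i v_i = 0, and let P(w) be the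
  polytope with support numbers h_i = (alpha_i / w_i)^(1 / (1 - p)).  If F_i(w) denotes the F_q-measure
  of the i-th facet of P(w), then an interior w with F(w) proportional to w solves the problem up to a
  dilation, since then h_i^(1 - p) F_i is proportional to alpha_i.

  The vector F(w), normalised to sum 1, lies in Q again: the facet measures satisfy sum F_i v_i = 0
  because F_q is invariant under translations.  By general position the positive support of every w in
  Q positively spans the space, so all P(w) lie in one ball; hence for small w_i the i-th hyperplane
  misses P(w) and F_i(w) = 0.  Therefore w |-> w + t (w - F(w)/|F(w)|) maps {w in Q. w_i >= epsilon}
  into itself for small t, and Brouwer's theorem yields a fixed point.

  Continuity of F and sum F_i v_i = 0 are proved for each chord direction u separately: the facet
  integrals project along u to Lebesgue integrals over one period of u, and the e-component of
  sum F_i v_i is the derivative of the translation invariant integral of G(chord length) along e,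
  where G is a primitive of the weight s^(q-1).  For q < 1 this weight is replaced by (s + delta)^(q-1),
  with an error that is uniform in u and h.
*)
theory Submission
  imports Defs
begin

section \<open>Hausdorff measure as a metric outer measure\<close>

text \<open>\<open>hausdorff_measure\<close> and \<open>Fq_measure\<close> are built with
  \<open>measure_of\<close>, which yields the intended values only once countable additivity on the
  Borel sets is known; hence the start from Caratheodory's criterion. Beyond that only coarse facts
  about (n-1)-dimensional Hausdorff measure enter: scaling under similarities, finiteness and
  positivity. Uniqueness of translation invariant measures then gives slicing with some constant
  \<kappa> common to all directions. Its value, which would require the isodiametric inequality,
  cancels in the balance. The exponent 1 / (1 - p) is forced by h_i^(1 - p) = alpha_i / w_i, which
  turns the equation into proportionality of F(w) and w. For q < 1 the weight s^(q-1) blows up near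
  ridges, where chords can be short. A nondegenerate chord from a facet point is at least as long as
  the distance to some other facet hyperplane, so the blow-up is dominated by one-dimensional
  integrals of a power with exponent above -1, whatever the direction of the chord.\<close>

definition hausdorff_weight :: "real \<Rightarrow> 'a::euclidean_space set \<Rightarrow> ennreal" where
  "hausdorff_weight s C = ennreal (unit_ball_vol s * (diameter C / 2) powr s)"

definition hausdorff_content :: "real \<Rightarrow> real \<Rightarrow> 'a::euclidean_space set \<Rightarrow> ennreal" where
  "hausdorff_content s \<delta> A =
     (INF C\<in>{C :: nat \<Rightarrow> 'a set. A \<subseteq> (\<Union>i. C i) \<and> (\<forall>i. bounded (C i) \<and> diameter (C i) \<le> \<delta>)}.
        \<Sum>i. hausdorff_weight s (C i))"

lemma hausdorff_weight_empty [simp]: "hausdorff_weight s {} = 0"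
  by (simp add: hausdorff_weight_def)

lemma hausdorff_outer_eq_SUP: "hausdorff_outer s A = (SUP \<delta>\<in>{0<..}. hausdorff_content s \<delta> A)"
  by (simp add: hausdorff_outer_def hausdorff_content_def hausdorff_weight_def)

lemma hausdorff_content_le:
  assumes "A \<subseteq> (\<Union>i. C i)" "\<And>i. bounded (C i)" "\<And>i. diameter (C i) \<le> \<delta>"
  shows "hausdorff_content s \<delta> A \<le> (\<Sum>i. hausdorff_weight s (C i))"
  unfolding hausdorff_content_def by (rule INF_lower) (use assms in auto)

lemma hausdorff_content_lessE:
  assumes "hausdorff_content s \<delta> A < e"
  obtains C where "A \<subseteq> (\<Union>i. C i)" "\<And>i. bounded (C i)" "\<And>i. diameter (C i) \<le> \<delta>"
    "(\<Sum>i. hausdorff_weight s (C i)) < e"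
  using assms unfolding hausdorff_content_def INF_less_iff by auto

lemma hausdorff_content_greatest:
  assumes "\<And>C. A \<subseteq> (\<Union>i. C i) \<Longrightarrow> (\<And>i. bounded (C i)) \<Longrightarrow> (\<And>i. diameter (C i) \<le> \<delta>)
      \<Longrightarrow> e \<le> (\<Sum>i. hausdorff_weight s (C i))"
  shows "e \<le> hausdorff_content s \<delta> A"
  unfolding hausdorff_content_def by (rule INF_greatest) (use assms in auto)

lemma hausdorff_content_mono: "A \<subseteq> B \<Longrightarrow> hausdorff_content s \<delta> A \<le> hausdorff_content s \<delta> B"
  unfolding hausdorff_content_def by (rule INF_superset_mono) auto

lemma hausdorff_content_antimono: "\<delta> \<le> \<delta>' \<Longrightarrow> hausdorff_content s \<delta>' A \<le> hausdorff_content s \<delta> A"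
  unfolding hausdorff_content_def by (rule INF_superset_mono) (auto intro: order_trans)

lemma hausdorff_content_le_outer: "\<delta> > 0 \<Longrightarrow> hausdorff_content s \<delta> A \<le> hausdorff_outer s A"
  unfolding hausdorff_outer_eq_SUP by (rule SUP_upper) auto

lemma hausdorff_outer_least:
  "(\<And>\<delta>. \<delta> > 0 \<Longrightarrow> hausdorff_content s \<delta> A \<le> e) \<Longrightarrow> hausdorff_outer s A \<le> e"
  unfolding hausdorff_outer_eq_SUP by (rule SUP_least) auto

lemma hausdorff_outer_empty: "hausdorff_outer s {} = 0"
proof -
  have "hausdorff_outer s ({}::'a set) \<le> 0"
  proof (rule hausdorff_outer_least)
    fix \<delta> :: real assume "\<delta> > 0"
    then show "hausdorff_content s \<delta> ({}::'a set) \<le> 0"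
      using hausdorff_content_le[of "{}::'a set" "\<lambda>_. {}" \<delta> s] by simp
  qed
  then show ?thesis by simp
qed

lemma hausdorff_outer_mono: "A \<subseteq> B \<Longrightarrow> hausdorff_outer s A \<le> hausdorff_outer s B"
  by (rule hausdorff_outer_least)
     (rule order_trans[OF hausdorff_content_mono hausdorff_content_le_outer])

lemma hausdorff_content_UN:
  "hausdorff_content s \<delta> (\<Union>n. A n) \<le> (\<Sum>n. hausdorff_content s \<delta> (A n))"
proof (rule ennreal_le_epsilon)
  fix e :: real assume "0 < e" "(\<Sum>n. hausdorff_content s \<delta> (A n)) < top"
  then have *: "\<And>n. hausdorff_content s \<delta> (A n) < hausdorff_content s \<delta> (A n) + e * (1/2)^Suc n"
    by (auto simp add: less_top dest!: ennreal_suminf_lessD)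
  have "\<exists>C. A n \<subseteq> (\<Union>i. C i) \<and> (\<forall>i. bounded (C i) \<and> diameter (C i) \<le> \<delta>)
     \<and> (\<Sum>i. hausdorff_weight s (C i)) \<le> hausdorff_content s \<delta> (A n) + e * (1/2)^Suc n" for n
    by (rule hausdorff_content_lessE[OF *[of n]]) (metis less_imp_le)
  then obtain B where B: "\<And>n. A n \<subseteq> (\<Union>i. B n i)"
      "\<And>n i. bounded (B n i) \<and> diameter (B n i) \<le> \<delta>"
      "\<And>n. (\<Sum>i. hausdorff_weight s (B n i)) \<le> hausdorff_content s \<delta> (A n) + e * (1/2)^Suc n"
    by metis
  define C where "C = (\<lambda>k. case_prod B (prod_decode k))"
  have A_C: "(\<Union>i. A i) \<subseteq> (\<Union>i. C i)"
    using B(1) by (auto simp add: C_def subset_eq) (metis prod.case prod_encode_inverse)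
  have "hausdorff_content s \<delta> (\<Union>i. A i) \<le> (\<Sum>i. hausdorff_weight s (C i))"
    using A_C B(2) by (intro hausdorff_content_le) (auto simp: C_def split: prod.split)
  also have "\<dots> = (\<Sum>i. (\<lambda>(n,i). hausdorff_weight s (B n i)) (prod_decode i))"
    unfolding C_def by (intro suminf_cong) (auto split: prod.split)
  also have "\<dots> = (\<Sum>n. \<Sum>i. hausdorff_weight s (B n i))"
    by (intro suminf_ennreal_2dimen) auto
  also have "\<dots> \<le> (\<Sum>n. hausdorff_content s \<delta> (A n) + e * (1/2) ^ Suc n)"
    by (intro suminf_le B(3)) auto
  also have "... = (\<Sum>n. hausdorff_content s \<delta> (A n)) + (\<Sum>n. ennreal e * ennreal ((1/2) ^ Suc n))"
    using \<open>0 < e\<close> by (subst suminf_add[symmetric])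
                     (auto simp del: ennreal_suminf_cmult simp add: ennreal_mult[symmetric])
  also have "\<dots> = (\<Sum>n. hausdorff_content s \<delta> (A n)) + e"
    unfolding ennreal_suminf_cmult
    by (subst suminf_ennreal_eq[OF zero_le_power power_half_series]) auto
  finally show "hausdorff_content s \<delta> (\<Union>n. A n) \<le> (\<Sum>n. hausdorff_content s \<delta> (A n)) + e" .
qed

lemma hausdorff_outer_UN: "hausdorff_outer s (\<Union>n. A n) \<le> (\<Sum>n. hausdorff_outer s (A n))"
proof (rule hausdorff_outer_least)
  fix \<delta> :: real assume "\<delta> > 0"
  show "hausdorff_content s \<delta> (\<Union>n. A n) \<le> (\<Sum>n. hausdorff_outer s (A n))"
    by (rule order_trans[OF hausdorff_content_UN])
       (intro suminf_le hausdorff_content_le_outer \<open>\<delta> > 0\<close> summableI)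
qed

lemma outer_measure_space_hausdorff: "outer_measure_space (Pow UNIV) (hausdorff_outer s)"
  by (auto simp: outer_measure_space_def positive_def increasing_def countably_subadditive_def
      hausdorff_outer_empty hausdorff_outer_mono intro: hausdorff_outer_UN)

lemma hausdorff_outer_Un: "hausdorff_outer s (A \<union> B) \<le> hausdorff_outer s A + hausdorff_outer s B"
proof -
  have "hausdorff_outer s (\<Union>n. binaryset A B n) \<le> (\<Sum>n. hausdorff_outer s (binaryset A B n))"
    by (rule hausdorff_outer_UN)
  then show ?thesis
    by (simp add: UN_binaryset_eq suminf_binaryset_eq hausdorff_outer_empty)
qed

text \<open>A covering set of diameter at most \<delta> cannot meet both sets, so every cover of the
  union splits into a cover of \<open>A\<close> and a cover of \<open>B\<close> that share no
  piece.\<close>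

lemma hausdorff_content_separated:
  assumes sep: "\<And>x y. x \<in> A \<Longrightarrow> y \<in> B \<Longrightarrow> \<delta> < dist x y" and "\<delta> > 0"
  shows "hausdorff_content s \<delta> A + hausdorff_content s \<delta> B \<le> hausdorff_content s \<delta> (A \<union> B)"
proof (rule hausdorff_content_greatest)
  fix C :: "nat \<Rightarrow> 'a set"
  assume C: "A \<union> B \<subseteq> (\<Union>i. C i)" "\<And>i. bounded (C i)" "\<And>i. diameter (C i) \<le> \<delta>"
  \<comment> \<open>Pieces that miss the set are emptied instead of dropped, which keeps the
    indexing by all naturals; empty pieces have weight 0.\<close>
  define CA where "CA = (\<lambda>i. if C i \<inter> A = {} then {} else C i)"
  define CB where "CB = (\<lambda>i. if C i \<inter> B = {} then {} else C i)"
  have "A \<subseteq> (\<Union>i. CA i)" "B \<subseteq> (\<Union>i. CB i)"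
    using C(1) by (auto simp: CA_def CB_def split: if_splits) blast+
  then have "hausdorff_content s \<delta> A \<le> (\<Sum>i. hausdorff_weight s (CA i))"
      "hausdorff_content s \<delta> B \<le> (\<Sum>i. hausdorff_weight s (CB i))"
    using C \<open>\<delta> > 0\<close> by (intro hausdorff_content_le; auto simp: CA_def CB_def)+
  then have "hausdorff_content s \<delta> A + hausdorff_content s \<delta> B
      \<le> (\<Sum>i. hausdorff_weight s (CA i)) + (\<Sum>i. hausdorff_weight s (CB i))"
    by (rule add_mono)
  also have "\<dots> = (\<Sum>i. hausdorff_weight s (CA i) + hausdorff_weight s (CB i))"
    by (rule suminf_add) auto
  also have "\<dots> \<le> (\<Sum>i. hausdorff_weight s (C i))"
  proof (intro suminf_le)
    fix i
    have "C i \<inter> A = {} \<or> C i \<inter> B = {}"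
    proof (rule ccontr)
      assume "\<not> ?thesis"
      then obtain x y where "x \<in> C i" "x \<in> A" "y \<in> C i" "y \<in> B" by auto
      then show False
        using sep[of x y] diameter_bounded_bound[OF C(2)[of i]] C(3)[of i] by force
    qed
    then show "hausdorff_weight s (CA i) + hausdorff_weight s (CB i) \<le> hausdorff_weight s (C i)"
      by (auto simp: CA_def CB_def)
  qed auto
  finally show "hausdorff_content s \<delta> A + hausdorff_content s \<delta> B \<le> (\<Sum>i. hausdorff_weight s (C i))" .
qed

text \<open>Passing to the supremum in each summand separately requires two independent scales. Both
  are lowered to a common scale below the separation, where the contents add up.\<close>

lemma hausdorff_outer_separated:
  assumes sep: "\<And>x y. x \<in> A \<Longrightarrow> y \<in> B \<Longrightarrow> \<eta> \<le> dist x y" and "\<eta> > 0"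
  shows "hausdorff_outer s A + hausdorff_outer s B \<le> hausdorff_outer s (A \<union> B)"
proof -
  have le: "hausdorff_content s \<delta> A + hausdorff_content s \<delta>' B \<le> hausdorff_outer s (A \<union> B)"
    if "\<delta> > 0" "\<delta>' > 0" for \<delta> \<delta>'
  proof -
    define d where "d = min (min \<delta> \<delta>') (\<eta> / 2)"
    have d: "d > 0" "d \<le> \<delta>" "d \<le> \<delta>'" "d < \<eta>" using that \<open>\<eta> > 0\<close> by (auto simp: d_def)
    have "hausdorff_content s \<delta> A + hausdorff_content s \<delta>' B
        \<le> hausdorff_content s d A + hausdorff_content s d B"
      by (intro add_mono hausdorff_content_antimono d)
    also have "\<dots> \<le> hausdorff_content s d (A \<union> B)"
      by (rule hausdorff_content_separated) (use sep d in force)+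
    also have "\<dots> \<le> hausdorff_outer s (A \<union> B)"
      by (rule hausdorff_content_le_outer) fact
    finally show ?thesis .
  qed
  have "hausdorff_outer s A + hausdorff_content s \<delta>' B \<le> hausdorff_outer s (A \<union> B)"
    if "\<delta>' > 0" for \<delta>'
    unfolding hausdorff_outer_eq_SUP[of s A]
    by (subst ennreal_SUP_add_left[symmetric]) (auto intro!: SUP_least le that)
  moreover have "hausdorff_outer s A + (SUP \<delta>\<in>{0<..}. hausdorff_content s \<delta> B)
      = (SUP \<delta>\<in>{0<..}. hausdorff_outer s A + hausdorff_content s \<delta> B)"
    by (rule ennreal_SUP_add_right) auto
  ultimately show ?thesis
    unfolding hausdorff_outer_eq_SUP[of s B] by (auto intro: SUP_least)
qed

text \<open>The differences of the layers \<open>A n\<close> with indices of equal parity have positive mutual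
  distance, which makes their measures summable.\<close>
lemma hausdorff_outer_layers:
  fixes E X :: "'a::euclidean_space set"
  assumes "E \<noteq> {}" "closed E" and fin: "hausdorff_outer s X < \<infinity>"
  defines "A \<equiv> (\<lambda>n::nat. {x \<in> X. 1 / real (Suc n) \<le> infdist x E})"
  shows "hausdorff_outer s (X \<inter> E) + hausdorff_outer s (X - E) \<le> hausdorff_outer s X"
proof -
  define R where "R = (\<lambda>n. A (Suc n) - A n)"
  have A_mono: "A m \<subseteq> A n" if "m \<le> n" for m n
  proof -
    have "1 / real (Suc n) \<le> 1 / real (Suc m)" using that by (intro frac_le) auto
    then show ?thesis by (auto simp: A_def simp del: of_nat_Suc)
  qed
  have infdist_le: "infdist x E \<le> infdist y E + dist x y" for x y
    by (metis infdist_triangle)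
  \<comment> \<open>A point of \<open>A (Suc m)\<close> has distance at least 1/(m+2) from
    \<open>E\<close>, a point of \<open>R n\<close> less than 1/(n+1); for n > m+1 the difference is
    a positive gap.\<close>
  have sepR: "\<exists>\<eta>>0. \<forall>x\<in>A (Suc m). \<forall>y\<in>R n. \<eta> \<le> dist x y" if "m + 1 < n" for m n
  proof (intro exI conjI ballI)
    show "0 < 1 / real (Suc (Suc m)) - 1 / real (Suc n)"
      using that by (simp add: divide_strict_left_mono)
    fix x y assume "x \<in> A (Suc m)" "y \<in> R n"
    then show "1 / real (Suc (Suc m)) - 1 / real (Suc n) \<le> dist x y"
      using infdist_le[of x y] by (auto simp: A_def R_def)
  qed
  \<comment> \<open>\<open>c\<close> is meant to be 0 or 1 and selects the parity. All earlier
    layers lie in one set \<open>A (Suc (2 * m + c))\<close>, from which the next layer of equal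
    parity is separated.\<close>
  have sum_le: "(\<Sum>k<n. hausdorff_outer s (R (2 * k + c))) \<le> hausdorff_outer s X" for n c
  proof -
    have "(\<Sum>k<n. hausdorff_outer s (R (2 * k + c))) \<le> hausdorff_outer s (\<Union>k<n. R (2 * k + c))"
    proof (induction n)
      case (Suc n)
      show ?case
      proof (cases n)
        case 0
        then show ?thesis by (simp add: lessThan_Suc)
      next
        case (Suc m)
        obtain \<eta> where \<eta>: "\<eta> > 0" "\<And>x y. x \<in> A (Suc (2 * m + c)) \<Longrightarrow> y \<in> R (2 * n + c) \<Longrightarrow> \<eta> \<le> dist x y"
          using sepR[of "2 * m + c" "2 * n + c"] Suc by auto
        have sub: "(\<Union>k<n. R (2 * k + c)) \<subseteq> A (Suc (2 * m + c))"
        proof (rule UN_least)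
          fix k assume "k \<in> {..<n}"
          then have "A (Suc (2 * k + c)) \<subseteq> A (Suc (2 * m + c))"
            using Suc by (intro A_mono) auto
          then show "R (2 * k + c) \<subseteq> A (Suc (2 * m + c))"
            by (auto simp: R_def)
        qed
        have "(\<Sum>k<Suc n. hausdorff_outer s (R (2 * k + c)))
            \<le> hausdorff_outer s (\<Union>k<n. R (2 * k + c)) + hausdorff_outer s (R (2 * n + c))"
          using Suc.IH by (simp add: add_right_mono)
        also have "\<dots> \<le> hausdorff_outer s ((\<Union>k<n. R (2 * k + c)) \<union> R (2 * n + c))"
          by (rule hausdorff_outer_separated[of _ _ \<eta>]) (use \<eta> sub in blast)+
        also have "(\<Union>k<n. R (2 * k + c)) \<union> R (2 * n + c) = (\<Union>k<Suc n. R (2 * k + c))"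
          by (auto simp: lessThan_Suc)
        finally show ?thesis .
      qed
    qed (simp add: hausdorff_outer_empty)
    also have "\<dots> \<le> hausdorff_outer s X"
      by (rule hausdorff_outer_mono) (auto simp: R_def A_def)
    finally show ?thesis .
  qed
  have fin_par: "(\<Sum>k. hausdorff_outer s (R (2 * k + c))) < \<infinity>" for c
    using suminf_le_const[OF summableI sum_le] fin by (rule order_le_less_trans)
  have fin_R: "(\<Sum>k. hausdorff_outer s (R k)) < \<infinity>"
  proof -
    have "(\<Sum>k<n. hausdorff_outer s (R k)) \<le> hausdorff_outer s X + hausdorff_outer s X" for n
    proof -
      have "(\<Sum>k<n. hausdorff_outer s (R k)) \<le> (\<Sum>k<2*n. hausdorff_outer s (R k))"
        by (rule sum_mono2) auto
      also have "\<dots> = (\<Sum>k<n. hausdorff_outer s (R (2*k+0))) + (\<Sum>k<n. hausdorff_outer s (R (2*k+1)))"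
        by (induction n) (auto simp: algebra_simps)
      also have "\<dots> \<le> hausdorff_outer s X + hausdorff_outer s X"
        by (intro add_mono sum_le)
      finally show ?thesis .
    qed
    from suminf_le_const[OF summableI this] fin show ?thesis
      by (simp add: order_le_less_trans)
  qed
  \<comment> \<open>What \<open>A n\<close> misses of \<open>X - E\<close> consists of the layers
    from \<open>n\<close> on, whose measures form the tail of a convergent series.\<close>
  have le: "hausdorff_outer s (X \<inter> E) + hausdorff_outer s (X - E)
      \<le> hausdorff_outer s X + (\<Sum>k. hausdorff_outer s (R (k + n)))" for n
  proof -
    have cover: "X - E \<subseteq> A n \<union> (\<Union>k. R (k + n))"
    proof
      fix x assume x: "x \<in> X - E"
      then have "infdist x E > 0"
        using assms(1,2) by (simp add: in_closed_iff_infdist_zero infdist_nonneg less_le)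
      then obtain m where "inverse (real (Suc m)) < infdist x E"
        using reals_Archimedean by blast
      then have xm: "x \<in> A m" using x by (simp add: A_def inverse_eq_divide)
      show "x \<in> A n \<union> (\<Union>k. R (k + n))"
      proof (cases "x \<in> A n")
        case False
        \<comment> \<open>The first index at which \<open>x\<close> appears identifies its
          layer.\<close>
        define j where "j = (LEAST j. x \<in> A j)"
        have j: "x \<in> A j" unfolding j_def by (rule LeastI[of "\<lambda>j. x \<in> A j", OF xm])
        have "n < j" using False j A_mono[of j n] by (cases "n < j") auto
        then obtain i where i: "j = Suc i" "n \<le> i" by (cases j) auto
        have "x \<notin> A i" using not_less_Least[of i "\<lambda>j. x \<in> A j"] i by (simp add: j_def)
        then have "x \<in> R (i - n + n)" using i j by (simp add: R_def)
        then show ?thesis by blast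
      qed auto
    qed
    have "hausdorff_outer s (X - E) \<le> hausdorff_outer s (A n) + hausdorff_outer s (\<Union>k. R (k + n))"
      by (rule order_trans[OF hausdorff_outer_mono[OF cover] hausdorff_outer_Un])
    also have "\<dots> \<le> hausdorff_outer s (A n) + (\<Sum>k. hausdorff_outer s (R (k + n)))"
      by (intro add_left_mono hausdorff_outer_UN)
    finally have "hausdorff_outer s (X \<inter> E) + hausdorff_outer s (X - E)
       \<le> (hausdorff_outer s (X \<inter> E) + hausdorff_outer s (A n)) + (\<Sum>k. hausdorff_outer s (R (k + n)))"
      by (simp add: add_left_mono add.assoc)
    also have "hausdorff_outer s (X \<inter> E) + hausdorff_outer s (A n) \<le> hausdorff_outer s ((X \<inter> E) \<union> A n)"
    proof (rule hausdorff_outer_separated)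
      fix x y assume "x \<in> X \<inter> E" "y \<in> A n"
      then show "1 / real (Suc n) \<le> dist x y"
        using infdist_le[of y x] by (auto simp: A_def dist_commute)
    qed simp
    also have "\<dots> \<le> hausdorff_outer s X"
      by (rule hausdorff_outer_mono) (auto simp: A_def)
    finally show ?thesis by (simp add: add_right_mono)
  qed
  have "(\<lambda>n. \<Sum>k. hausdorff_outer s (R (k + n))) \<longlonglongrightarrow> 0"
  proof -
    have e: "hausdorff_outer s (R k) = ennreal (enn2real (hausdorff_outer s (R k)))" for k
      using ennreal_suminf_lessD[OF fin_R, of k] by (simp add: ennreal_enn2real_if less_top)
    have "summable (\<lambda>k. enn2real (hausdorff_outer s (R k)))"
      using fin_R by (intro summable_suminf_not_top) (auto simp flip: e)
    have "(\<lambda>n. ennreal (\<Sum>k. enn2real (hausdorff_outer s (R (k + n))))) \<longlonglongrightarrow> ennreal 0"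
      by (intro tendsto_ennrealI suminf_exist_split2) fact
    moreover have "(\<Sum>k. hausdorff_outer s (R (k + n))) = ennreal (\<Sum>k. enn2real (hausdorff_outer s (R (k + n))))" for n
    proof -
      have "summable (\<lambda>k. enn2real (hausdorff_outer s (R (k + n))))"
        by (rule summable_ignore_initial_segment) fact
      then show ?thesis
        by (subst e) (intro suminf_ennreal2, auto)
    qed
    ultimately show ?thesis by simp
  qed
  then have "(\<lambda>n. hausdorff_outer s X + (\<Sum>k. hausdorff_outer s (R (k + n)))) \<longlonglongrightarrow> hausdorff_outer s X + 0"
    by (intro tendsto_add tendsto_const)
  then show ?thesis
    by (intro LIMSEQ_le_const[where X="\<lambda>n. hausdorff_outer s X + (\<Sum>k. hausdorff_outer s (R (k + n)))"])
       (auto intro: le)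
qed

text \<open>Caratheodory's criterion for metric outer measures. For sets of infinite outer measure
  the inequality that remains after subadditivity holds at once.\<close>

lemma closed_in_lambda_system_hausdorff:
  assumes "closed E"
  shows "E \<in> lambda_system UNIV (Pow UNIV) (hausdorff_outer s)"
proof (cases "E = {}")
  case False
  have "hausdorff_outer s (X \<inter> E) + hausdorff_outer s (X - E) = hausdorff_outer s X" for X
  proof (rule antisym)
    show "hausdorff_outer s (X \<inter> E) + hausdorff_outer s (X - E) \<le> hausdorff_outer s X"
    proof (cases "hausdorff_outer s X < \<infinity>")
      case True
      from hausdorff_outer_layers[OF False assms this] show ?thesis .
    next
      case False
      then show ?thesis by (simp add: less_top[symmetric])
    qed
    have "hausdorff_outer s ((X \<inter> E) \<union> (X - E)) \<le> hausdorff_outer s (X \<inter> E) + hausdorff_outer s (X - E)"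
      by (rule hausdorff_outer_Un)
    then show "hausdorff_outer s X \<le> hausdorff_outer s (X \<inter> E) + hausdorff_outer s (X - E)"
      by (simp add: Int_Diff_Un)
  qed
  then show ?thesis
    by (simp only: algebra.lambda_system_eq[OF algebra_Pow]) auto
qed (auto simp only: algebra.lambda_system_eq[OF algebra_Pow] hausdorff_outer_empty
     intro!: CollectI; simp add: hausdorff_outer_empty)

section \<open>From the outer measure to the Borel measure\<close>

lemma sets_hausdorff_measure [measurable_cong, simp]: "sets (hausdorff_measure s) = sets borel"
  unfolding hausdorff_measure_def using sets.sigma_sets_eq[of "borel::'a measure"]
  by (subst sets_measure_of) auto

lemma space_hausdorff_measure [simp]: "space (hausdorff_measure s) = UNIV"
  unfolding hausdorff_measure_def by (simp add: space_measure_of)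

text \<open>\<open>measure_of\<close> returns 0 throughout for a set function that is not countably
  additive. Additivity comes from the Caratheodory sigma-algebra, which contains the closed sets and
  hence all Borel sets.\<close>

lemma emeasure_hausdorff_measure:
  fixes A :: "'a::euclidean_space set"
  assumes "A \<in> sets borel"
  shows "emeasure (hausdorff_measure s) A = hausdorff_outer s A"
proof -
  interpret P: sigma_algebra UNIV "Pow UNIV :: 'a set set" by (rule sigma_algebra_Pow)
  let ?L = "lambda_system UNIV (Pow UNIV) (hausdorff_outer s) :: 'a set set"
  have ms: "measure_space UNIV ?L (hausdorff_outer s)"
    by (rule P.caratheodory_lemma[OF outer_measure_space_hausdorff])
  then have sa: "sigma_algebra UNIV ?L" and ca: "countably_additive ?L (hausdorff_outer s)"
    by (auto simp: measure_space_def)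
  have sub: "sets borel \<subseteq> ?L"
    unfolding borel_eq_closed
    by (subst sets_measure_of, simp, intro sigma_algebra.sigma_sets_subset[OF sa])
       (auto intro!: closed_in_lambda_system_hausdorff simp del: Pow_UNIV)
  have "countably_additive (sets (borel::'a measure)) (hausdorff_outer s)"
    unfolding countably_additive_def
  proof safe
    fix B :: "nat \<Rightarrow> 'a set" assume "range B \<subseteq> sets borel" "disjoint_family B" "\<Union> (range B) \<in> sets borel"
    then have "range B \<subseteq> ?L" "disjoint_family B" "\<Union> (range B) \<in> ?L" using sub by blast+
    then show "(\<Sum>i. hausdorff_outer s (B i)) = hausdorff_outer s (\<Union> (range B))"
      using ca unfolding countably_additive_def by blast
  qed
  then show ?thesis
    unfolding hausdorff_measure_def using sets.sigma_algebra_axioms[of "borel::'a measure"] assms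
    by (intro emeasure_measure_of_sigma) (auto simp: positive_def hausdorff_outer_empty)
qed

section \<open>Hausdorff measure under Lipschitz maps and similarities\<close>

lemma hausdorff_outer_lipschitz:
  assumes lip: "\<And>x y. x \<in> A \<Longrightarrow> y \<in> A \<Longrightarrow> dist (f x) (f y) \<le> L * dist x y"
    and "L > 0" "s \<ge> 0"
  shows "hausdorff_outer s (f ` A) \<le> ennreal (L powr s) * hausdorff_outer s A"
proof (rule hausdorff_outer_least)
  fix \<delta> :: real assume \<delta>: "\<delta> > 0"
  \<comment> \<open>The constant is moved to the left, so that the infimum over covers stands on the
    right. A cover at scale \<delta> / L is mapped to one at scale \<delta>.\<close>
  have "ennreal ((1 / L) powr s) * hausdorff_content s \<delta> (f ` A) \<le> hausdorff_content s (\<delta> / L) A"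
  proof (rule hausdorff_content_greatest)
    fix C :: "nat \<Rightarrow> 'a set"
    assume C: "A \<subseteq> (\<Union>i. C i)" "\<And>i. bounded (C i)" "\<And>i. diameter (C i) \<le> \<delta> / L"
    \<comment> \<open>Pieces are cut down to \<open>A\<close>, as \<open>f\<close> is Lipschitz only
      there.\<close>
    define D where "D = (\<lambda>i. f ` (C i \<inter> A))"
    have dist_D: "dist x y \<le> L * diameter (C i)" if xy: "x \<in> D i" "y \<in> D i" for i x y
    proof -
      obtain x' y' where *: "x' \<in> C i" "x' \<in> A" "y' \<in> C i" "y' \<in> A" "x = f x'" "y = f y'"
        using xy by (auto simp: D_def)
      have "dist x y \<le> L * dist x' y'" using * lip by auto
      also have "\<dots> \<le> L * diameter (C i)"
        using * \<open>L > 0\<close> diameter_bounded_bound[OF C(2)[of i]] by (intro mult_left_mono) auto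
      finally show ?thesis .
    qed
    have bd: "bounded (D i)" for i
      unfolding bounded_two_points using dist_D by blast
    have diam: "diameter (D i) \<le> L * diameter (C i)" for i
      using \<open>L > 0\<close> diameter_ge_0[OF C(2)[of i]]
      by (intro diameter_le) (use dist_D in \<open>auto simp: dist_norm\<close>)
    have "hausdorff_content s \<delta> (f ` A) \<le> (\<Sum>i. hausdorff_weight s (D i))"
    proof (rule hausdorff_content_le)
      show "f ` A \<subseteq> (\<Union>i. D i)"
      proof (rule image_subsetI)
        fix x assume "x \<in> A"
        moreover from this obtain i where "x \<in> C i" using C(1) by blast
        ultimately show "f x \<in> (\<Union>i. D i)" unfolding D_def by (intro UN_I[of i]) auto
      qed
      show "diameter (D i) \<le> \<delta>" for i
        using diam[of i] mult_left_mono[OF C(3)[of i], of L] \<open>L > 0\<close> by auto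
    qed (rule bd)
    then have "ennreal ((1 / L) powr s) * hausdorff_content s \<delta> (f ` A)
        \<le> ennreal ((1 / L) powr s) * (\<Sum>i. hausdorff_weight s (D i))"
      by (rule mult_left_mono) auto
    also have "\<dots> = (\<Sum>i. ennreal ((1 / L) powr s) * hausdorff_weight s (D i))"
      by (rule ennreal_suminf_cmult[symmetric])
    also have "\<dots> \<le> (\<Sum>i. hausdorff_weight s (C i))"
    proof (intro suminf_le)
      fix i
      have "(1 / L) powr s * (unit_ball_vol s * (diameter (D i) / 2) powr s)
          = unit_ball_vol s * ((1 / L) * (diameter (D i) / 2)) powr s"
        using \<open>L > 0\<close> diameter_ge_0[OF bd[of i]] by (subst powr_mult) auto
      also have "\<dots> \<le> unit_ball_vol s * (diameter (C i) / 2) powr s"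
        using \<open>L > 0\<close> \<open>s \<ge> 0\<close> diam[of i] diameter_ge_0[OF bd[of i]]
        by (intro mult_left_mono powr_mono2) (auto simp: field_simps)
      finally show "ennreal ((1 / L) powr s) * hausdorff_weight s (D i) \<le> hausdorff_weight s (C i)"
        by (simp add: hausdorff_weight_def ennreal_mult'[symmetric] ennreal_leI)
    qed auto
    finally show "ennreal ((1 / L) powr s) * hausdorff_content s \<delta> (f ` A) \<le> (\<Sum>i. hausdorff_weight s (C i))" .
  qed
  also have "\<dots> \<le> hausdorff_outer s A"
    using \<delta> \<open>L > 0\<close> by (intro hausdorff_content_le_outer) auto
  finally have "ennreal (L powr s) * (ennreal ((1 / L) powr s) * hausdorff_content s \<delta> (f ` A))
      \<le> ennreal (L powr s) * hausdorff_outer s A"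
    by (rule mult_left_mono) auto
  moreover have "ennreal (L powr s) * ennreal ((1 / L) powr s) = 1"
    using \<open>L > 0\<close> by (simp add: ennreal_mult'[symmetric] powr_mult[symmetric])
  ultimately show "hausdorff_content s \<delta> (f ` A) \<le> ennreal (L powr s) * hausdorff_outer s A"
    by (simp add: mult.assoc[symmetric])
qed

text \<open>The Lipschitz bound is applied to \<open>f\<close> with constant r and to its inverse
  with constant 1/r.\<close>

lemma hausdorff_outer_similarity:
  assumes sim: "\<And>x y. dist (f x) (f y) = r * dist x y" and "r > 0" "s \<ge> 0"
  shows "hausdorff_outer s (f ` A) = ennreal (r powr s) * hausdorff_outer s A"
proof (rule antisym)
  show "hausdorff_outer s (f ` A) \<le> ennreal (r powr s) * hausdorff_outer s A"
    using assms by (intro hausdorff_outer_lipschitz) auto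
  have inj: "inj f"
  proof (rule injI)
    fix x y assume "f x = f y"
    then show "x = y" using sim[of x y] \<open>r > 0\<close> by simp
  qed
  have "hausdorff_outer s (inv f ` f ` A) \<le> ennreal ((1/r) powr s) * hausdorff_outer s (f ` A)"
  proof (rule hausdorff_outer_lipschitz)
    fix x y assume "x \<in> f ` A" "y \<in> f ` A"
    then show "dist (inv f x) (inv f y) \<le> 1 / r * dist x y"
      using inj sim \<open>r > 0\<close> by auto
  qed (use assms in auto)
  then have "ennreal (r powr s) * hausdorff_outer s A
      \<le> ennreal (r powr s) * (ennreal ((1/r) powr s) * hausdorff_outer s (f ` A))"
    using inj by (intro mult_left_mono) (auto simp: image_image)
  moreover have "ennreal (r powr s) * ennreal ((1 / r) powr s) = 1"
    using \<open>r > 0\<close> by (simp add: ennreal_mult'[symmetric] powr_mult[symmetric])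
  ultimately show "ennreal (r powr s) * hausdorff_outer s A \<le> hausdorff_outer s (f ` A)"
    by (simp add: mult.assoc[symmetric])
qed

lemma borel_measurable_similarity:
  fixes f :: "'a::euclidean_space \<Rightarrow> 'a"
  assumes sim: "\<And>x y. dist (f x) (f y) = r * dist x y" and "r > 0"
  shows "f \<in> borel_measurable borel"
proof (intro borel_measurable_continuous_onI)
  have "r-lipschitz_on UNIV f" using assms by (intro lipschitz_onI) auto
  then show "continuous_on UNIV f" by (rule lipschitz_on_continuous_on)
qed

lemma nn_integral_hausdorff_similarity:
  fixes f :: "'a::euclidean_space \<Rightarrow> 'a"
  assumes sim: "\<And>x y. dist (f x) (f y) = r * dist x y" and "r > 0" "s \<ge> 0" and "surj f"
    and [measurable]: "g \<in> borel_measurable borel"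
  shows "(\<integral>\<^sup>+ x. g x \<partial>hausdorff_measure s) = ennreal (r powr s) * (\<integral>\<^sup>+ x. g (f x) \<partial>hausdorff_measure s)"
proof -
  have [measurable]: "f \<in> borel_measurable borel" by (rule borel_measurable_similarity[OF sim \<open>r > 0\<close>])
  have eq: "hausdorff_measure s = scale_measure (ennreal (r powr s)) (distr (hausdorff_measure s) borel f)"
  proof (rule measure_eqI)
    fix A :: "'a set" assume "A \<in> sets (hausdorff_measure s)"
    then have A [measurable]: "A \<in> sets borel" by simp
    have pre: "f -` A \<in> sets borel" using measurable_sets[of f borel borel A] by simp
    have "emeasure (hausdorff_measure s) A = hausdorff_outer s (f ` (f -` A))"
      using \<open>surj f\<close> by (simp add: emeasure_hausdorff_measure)
    also have "\<dots> = ennreal (r powr s) * hausdorff_outer s (f -` A)"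
      by (rule hausdorff_outer_similarity) (use assms in auto)
    finally show "emeasure (hausdorff_measure s) A
        = emeasure (scale_measure (ennreal (r powr s)) (distr (hausdorff_measure s) borel f)) A"
      using pre by (simp add: emeasure_distr emeasure_hausdorff_measure)
  qed simp
  show ?thesis
    by (subst (1) eq) (simp add: nn_integral_scale_measure nn_integral_distr)
qed

text \<open>An (n-1)-cube of side 2a is cut into m^(n-1) cubes of diameter at most 2an/m. Their
  number times (na/m)^(n-1) does not depend on m, so the bound is uniform in the scale.\<close>

lemma hausdorff_outer_coordinate_hyperplane_finite:
  fixes b :: "'a::euclidean_space"
  assumes b: "b \<in> Basis" and "a > 0" "DIM('a) \<ge> 2"
  shows "hausdorff_outer (real DIM('a) - 1) {x::'a. x \<bullet> b = 0 \<and> (\<forall>j\<in>Basis-{b}. -a \<le> x \<bullet> j \<and> x \<bullet> j < a)} < \<infinity>"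
    (is "hausdorff_outer ?s ?A < _")
proof -
  let ?n = "DIM('a)"
  have "hausdorff_outer ?s ?A \<le> ennreal (unit_ball_vol ?s * (real ?n * a) powr ?s)"
  proof (rule hausdorff_outer_least)
    fix \<delta> :: real assume "\<delta> > 0"
    define m where "m = Suc (nat \<lceil>2 * a * ?n / \<delta>\<rceil>)"
    have m: "m > 0" "2 * a * ?n / m \<le> \<delta>"
    proof -
      have "2 * a * ?n / \<delta> \<le> m" unfolding m_def by linarith
      then show "2 * a * ?n / m \<le> \<delta>" using \<open>\<delta> > 0\<close> by (simp add: m_def field_simps)
    qed (simp add: m_def)
    define K where "K = PiE (Basis - {b}) (\<lambda>_. {..<m})"
    define Q where "Q = (\<lambda>k::'a \<Rightarrow> nat. {x::'a. x \<bullet> b = 0 \<and>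
        (\<forall>j\<in>Basis-{b}. - a + 2*a*k j/m \<le> x \<bullet> j \<and> x \<bullet> j \<le> -a + 2*a*(real (k j) + 1)/m)})"
    have finK: "finite K" and cardK: "card K = m ^ (?n - 1)"
      unfolding K_def using b by (auto simp: finite_PiE card_PiE)
    obtain h where h: "bij_betw h {0..<card K} K"
      using ex_bij_betw_nat_finite[OF finK] by blast
    define C where "C = (\<lambda>i. if i < card K then Q (h i) else {})"
    have diam: "norm (x - y) \<le> 2 * a * ?n / m" if "x \<in> Q k" "y \<in> Q k" for x y k
    proof -
      have "norm (x - y) \<le> (\<Sum>j\<in>Basis. \<bar>(x - y) \<bullet> j\<bar>)" by (rule norm_le_l1)
      also have "\<dots> \<le> (\<Sum>j\<in>(Basis::'a set). 2 * a / m)"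
      proof (rule sum_mono)
        fix j :: 'a assume "j \<in> Basis"
        show "\<bar>(x - y) \<bullet> j\<bar> \<le> 2 * a / m"
        proof (cases "j = b")
          case True
          then show ?thesis using that \<open>a > 0\<close> by (simp add: Q_def inner_diff_left)
        next
          case False
          with \<open>j \<in> Basis\<close> that
          have "- a + 2*a*k j/m \<le> x \<bullet> j" "x \<bullet> j \<le> -a + 2*a*(real (k j) + 1)/m"
             "- a + 2*a*k j/m \<le> y \<bullet> j" "y \<bullet> j \<le> -a + 2*a*(real (k j) + 1)/m"
            unfolding Q_def by blast+
          moreover have "2*a*(real (k j) + 1)/m = 2*a*k j/m + 2*a/m"
            by (simp add: distrib_left add_divide_distrib)
          ultimately show ?thesis by (simp add: inner_diff_left abs_le_iff)
        qed
      qed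
      finally show ?thesis by (simp add: mult.commute)
    qed
    have nn: "0 \<le> 2 * a * ?n / m" using \<open>a > 0\<close> by auto
    have bd: "bounded (C i)" and dC: "diameter (C i) \<le> 2 * a * ?n / m" for i
    proof -
      show "bounded (C i)"
        unfolding bounded_two_points C_def using diam by (auto simp: dist_norm split: if_splits)
      show "diameter (C i) \<le> 2 * a * ?n / m"
        by (rule diameter_le) (use nn diam in \<open>auto simp: C_def split: if_splits\<close>)
    qed
    have cover: "?A \<subseteq> (\<Union>i. C i)"
    proof
      fix x assume x: "x \<in> ?A"
      \<comment> \<open>The half-open coordinate ranges in \<open>?A\<close> keep this index below
        \<open>m\<close>.\<close>
      define k where "k = restrict (\<lambda>j. nat \<lfloor>(x \<bullet> j + a) * m / (2 * a)\<rfloor>) (Basis - {b})"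
      have kj: "k j < m" "- a + 2*a*k j/m \<le> x \<bullet> j" "x \<bullet> j \<le> -a + 2*a*(real (k j) + 1)/m" if j: "j \<in> Basis - {b}" for j
      proof -
        define t where "t = (x \<bullet> j + a) * m / (2 * a)"
        have xj: "-a \<le> x \<bullet> j" "x \<bullet> j < a" using x j by auto
        have "0 \<le> t" using xj \<open>a > 0\<close> by (auto simp: t_def)
        have "t < m" using xj \<open>a > 0\<close> m(1) by (simp add: t_def field_simps)
        have k: "real (k j) = \<lfloor>t\<rfloor>" using \<open>0 \<le> t\<close> j by (simp add: k_def t_def)
        have kt: "real (k j) \<le> t" "t \<le> real (k j) + 1" unfolding k by linarith+
        then show "k j < m" using \<open>t < m\<close> by linarith
        have xt: "x \<bullet> j = - a + 2 * a * t / m" using \<open>a > 0\<close> m(1) by (simp add: t_def)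
        show "- a + 2*a*k j/m \<le> x \<bullet> j"
          unfolding xt using kt(1) \<open>a > 0\<close> by (simp add: divide_right_mono)
        show "x \<bullet> j \<le> -a + 2*a*(real (k j) + 1)/m"
          unfolding xt using kt(2) \<open>a > 0\<close> by (simp add: divide_right_mono)
      qed
      have "k \<in> K" unfolding K_def using kj(1) by (auto simp: k_def)
      then obtain i where "i < card K" "h i = k" using h by (auto simp: bij_betw_def image_iff set_eq_iff) (metis atLeastLessThan_iff imageE)
      moreover have "x \<in> Q k" using x kj by (auto simp: Q_def)
      ultimately show "x \<in> (\<Union>i. C i)" by (auto simp: C_def)
    qed
    have s0: "?s \<ge> 0" using \<open>DIM('a) \<ge> 2\<close> by simp
    have "hausdorff_content ?s \<delta> ?A \<le> (\<Sum>i. hausdorff_weight ?s (C i))"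
      using cover bd dC m(2) order_trans by (intro hausdorff_content_le) blast+
    also have "\<dots> = (\<Sum>i<card K. hausdorff_weight ?s (C i))"
      by (rule suminf_finite) (auto simp: C_def)
    also have "\<dots> \<le> (\<Sum>i<card K. ennreal (unit_ball_vol ?s * (?n * a / m) powr ?s))"
    proof (rule sum_mono)
      fix i
      show "hausdorff_weight ?s (C i) \<le> ennreal (unit_ball_vol ?s * (?n * a / m) powr ?s)"
        unfolding hausdorff_weight_def using s0 dC[of i] diameter_ge_0[OF bd[of i]]
        by (intro ennreal_leI mult_left_mono powr_mono2) (auto simp: mult_ac)
    qed
    also have "\<dots> = ennreal (real (m ^ (?n - 1)) * (unit_ball_vol ?s * (?n * a / m) powr ?s))"
      by (simp add: cardK ennreal_of_nat_eq_real_of_nat ennreal_mult' del: of_nat_power)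
    also have "real (m ^ (?n - 1)) = real m powr ?s"
      using \<open>DIM('a) \<ge> 2\<close> m(1) by (simp add: powr_realpow[symmetric] of_nat_diff)
    also have "real m powr ?s * (unit_ball_vol ?s * (?n * a / m) powr ?s) = unit_ball_vol ?s * (?n * a) powr ?s"
      using m(1) \<open>a > 0\<close> by (simp add: powr_divide)
    finally show "hausdorff_content ?s \<delta> ?A \<le> ennreal (unit_ball_vol ?s * (real ?n * a) powr ?s)" .
  qed
  then show ?thesis by (rule order_le_less_trans) simp
qed

text \<open>Comparison with volume: thickened by a unit interval in direction \<open>b\<close>, a
  cover of the (n-1)-cube becomes a cover of a box of known volume, and a piece of diameter d is
  contained in a box of volume (2d)^(n-1).\<close>

lemma hausdorff_outer_coordinate_hyperplane_pos:
  fixes b :: "'a::euclidean_space"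
  assumes b: "b \<in> Basis" and "a > 0" and dim: "DIM('a) \<ge> 2"
  shows "hausdorff_outer (real DIM('a) - 1) {x::'a. x \<bullet> b = 0 \<and> (\<forall>j\<in>Basis-{b}. \<bar>x \<bullet> j\<bar> \<le> a)} > 0"
    (is "hausdorff_outer ?s ?A > 0")
proof -
  let ?n = "DIM('a)"
  define box where "box = (\<lambda>(c::'a) d. cbox (\<Sum>j\<in>Basis. (if j = b then 0 else c \<bullet> j - d) *\<^sub>R j)
     (\<Sum>j\<in>Basis. (if j = b then 1 else c \<bullet> j + d) *\<^sub>R j))"
  have mem_box: "x \<in> box c d \<longleftrightarrow> 0 \<le> x \<bullet> b \<and> x \<bullet> b \<le> 1 \<and> (\<forall>j\<in>Basis-{b}. \<bar>x \<bullet> j - c \<bullet> j\<bar> \<le> d)" for x c d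
    using b by (auto simp: box_def cbox_def abs_le_iff algebra_simps split: if_splits)
  have vol: "emeasure lborel (box c d) = ennreal ((2 * d) ^ (?n - 1))" if "d \<ge> 0" for c d
  proof -
    have "emeasure lborel (box c d) = ennreal (\<Prod>j\<in>Basis. if j = b then 1 else 2 * d)"
      unfolding box_def using that
      by (subst emeasure_lborel_cbox) (auto simp: inner_diff_left intro!: arg_cong[where f=ennreal] prod.cong)
    also have "(\<Prod>j\<in>Basis. if j = b then 1 else 2 * d) = (\<Prod>j\<in>Basis-{b}. 2 * d)"
      using b by (subst prod.remove[of _ b]) (auto intro!: prod.cong)
    finally show ?thesis using b by simp
  qed
  \<comment> \<open>The ratio of (2d)^(n-1) to the weight of a piece of diameter d, from 2d = 4
    (d/2).\<close>
  define \<kappa> where "\<kappa> = 4 powr ?s / unit_ball_vol ?s"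
  have s0: "?s \<ge> 0" using dim by simp
  have w: "unit_ball_vol ?s \<noteq> 0" using unit_ball_vol_pos[OF s0] by (metis less_irrefl)
  have \<kappa>: "\<kappa> > 0" unfolding \<kappa>_def using s0 by auto
  have "ennreal ((2 * a) ^ (?n - 1)) \<le> ennreal \<kappa> * hausdorff_outer ?s ?A"
  proof -
    have "ennreal (1/\<kappa>) * ennreal ((2 * a) ^ (?n - 1)) \<le> hausdorff_content ?s 1 ?A"
    proof (rule hausdorff_content_greatest)
      fix C :: "nat \<Rightarrow> 'a set"
      assume C: "?A \<subseteq> (\<Union>i. C i)" "\<And>i. bounded (C i)" "\<And>i. diameter (C i) \<le> 1"
      \<comment> \<open>Any point of the piece. An empty piece has diameter 0 and its box has volume
        0, as n - 1 is positive.\<close>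
      define c where "c = (\<lambda>i. SOME x. x \<in> C i)"
      define D where "D = (\<lambda>i. box (c i) (diameter (C i)))"
      have D0: "diameter (C i) \<ge> 0" for i using C(2) by (rule diameter_ge_0)
      have "box 0 a \<subseteq> (\<Union>i. D i)"
      proof
        fix x assume x: "x \<in> box 0 a"
        let ?y = "x - (x \<bullet> b) *\<^sub>R b"
        have yj: "?y \<bullet> j = (if j = b then 0 else x \<bullet> j)" if "j \<in> Basis" for j
          using b that by (auto simp: inner_diff_left inner_not_same_Basis)
        have "?y \<in> ?A" using x b yj by (auto simp: mem_box)
        then obtain i where i: "?y \<in> C i" using C(1) by blast
        then have ci: "c i \<in> C i" unfolding c_def by (rule someI)
        have "\<bar>x \<bullet> j - c i \<bullet> j\<bar> \<le> diameter (C i)" if "j \<in> Basis - {b}" for j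
        proof -
          have "?y \<bullet> j = x \<bullet> j" using yj[of j] that by (metis DiffD1 DiffD2 singletonI)
          then have "\<bar>x \<bullet> j - c i \<bullet> j\<bar> = \<bar>(?y - c i) \<bullet> j\<bar>"
            by (simp only: inner_diff_left[of ?y "c i"])
          also have "\<dots> \<le> norm (?y - c i)" using that by (intro Basis_le_norm) auto
          also have "\<dots> \<le> diameter (C i)"
            using diameter_bounded_bound[OF C(2) i ci] by (simp add: dist_norm)
          finally show ?thesis .
        qed
        then have "x \<in> D i" using x by (auto simp: D_def mem_box)
        then show "x \<in> (\<Union>i. D i)" by blast
      qed
      then have "emeasure lborel (box 0 a) \<le> emeasure lborel (\<Union>i. D i)"
        by (intro emeasure_mono) (auto simp: D_def box_def)
      also have "\<dots> \<le> (\<Sum>i. emeasure lborel (D i))"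
        by (rule emeasure_subadditive_countably) (auto simp: D_def box_def)
      also have "\<dots> = (\<Sum>i. ennreal \<kappa> * hausdorff_weight ?s (C i))"
      proof (rule suminf_cong)
        fix i
        have "(2 * diameter (C i)) ^ (?n - 1) = \<kappa> * (unit_ball_vol ?s * (diameter (C i) / 2) powr ?s)"
        proof (cases "diameter (C i) = 0")
          case True
          then show ?thesis using dim by (simp add: power_0_left)
        next
          case False
          then have d: "diameter (C i) > 0" using D0[of i] by linarith
          have "(2 * diameter (C i)) ^ (?n - 1) = (4 * (diameter (C i) / 2)) powr ?s"
            using d dim by (simp add: powr_realpow[symmetric] of_nat_diff powr_mult)
          also have "\<dots> = 4 powr ?s * (diameter (C i) / 2) powr ?s"
            using d by (subst powr_mult) auto
          also have "\<dots> = \<kappa> * (unit_ball_vol ?s * (diameter (C i) / 2) powr ?s)"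
            using w unfolding \<kappa>_def by simp
          finally show ?thesis .
        qed
        then show "emeasure lborel (D i) = ennreal \<kappa> * hausdorff_weight ?s (C i)"
          unfolding D_def vol[OF D0] hausdorff_weight_def using \<kappa> by (simp add: ennreal_mult'[symmetric])
      qed
      also have "\<dots> = ennreal \<kappa> * (\<Sum>i. hausdorff_weight ?s (C i))"
        by (rule ennreal_suminf_cmult)
      finally have "ennreal (1/\<kappa>) * ennreal ((2 * a) ^ (?n - 1)) \<le> ennreal (1/\<kappa>) * (ennreal \<kappa> * (\<Sum>i. hausdorff_weight ?s (C i)))"
        using \<open>a > 0\<close> by (intro mult_left_mono) (auto simp: vol)
      also have "\<dots> = (\<Sum>i. hausdorff_weight ?s (C i))"
        using \<kappa> by (simp add: mult.assoc[symmetric] ennreal_mult'[symmetric])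
      finally show "ennreal (1/\<kappa>) * ennreal ((2 * a) ^ (?n - 1)) \<le> (\<Sum>i. hausdorff_weight ?s (C i))" .
    qed
    also have "\<dots> \<le> hausdorff_outer ?s ?A" by (rule hausdorff_content_le_outer) simp
    finally have "ennreal \<kappa> * (ennreal (1/\<kappa>) * ennreal ((2 * a) ^ (?n - 1))) \<le> ennreal \<kappa> * hausdorff_outer ?s ?A"
      by (intro mult_left_mono) auto
    then show ?thesis
      using \<kappa> by (simp add: mult.assoc[symmetric] ennreal_mult'[symmetric])
  qed
  moreover have "0 < ennreal ((2 * a) ^ (?n - 1))" using \<open>a > 0\<close> by simp
  ultimately show ?thesis
    by (cases "hausdorff_outer ?s ?A = 0") (auto simp: zero_less_iff_neq_zero)
qed

text \<open>The reflection in the hyperplane orthogonal to \<open>b - v\<close>. For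
  \<open>b = v\<close> division by zero turns the formula into the identity.\<close>

lemma unit_vector_reflection:
  fixes b v :: "'a::euclidean_space"
  assumes "norm b = 1" "norm v = 1"
  obtains f where "linear f" "f b = v" "\<And>x y. f x \<bullet> f y = x \<bullet> y" "\<And>x. f (f x) = x"
    "\<And>x y. dist (f x) (f y) = dist x y"
proof -
  define w where "w = b - v"
  define f where "f = (\<lambda>x. x - (2 * (x \<bullet> w) / (w \<bullet> w)) *\<^sub>R w)"
  have bb: "b \<bullet> b = 1" "v \<bullet> v = 1" using assms by (simp_all add: dot_square_norm)
  have lin: "linear f"
    by (rule linearI) (auto simp: f_def algebra_simps inner_add_left add_divide_distrib)
  have bw: "2 * (b \<bullet> w) = w \<bullet> w" using bb by (simp add: w_def algebra_simps inner_commute)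
  have fb: "f b = v"
  proof (cases "w = 0")
    case True
    then show ?thesis by (simp add: f_def w_def)
  next
    case False
    then show ?thesis by (simp add: f_def bw) (simp add: w_def)
  qed
  have inn: "f x \<bullet> f y = x \<bullet> y" for x y
    by (cases "w = 0") (auto simp: f_def inner_diff_left inner_diff_right inner_commute field_simps)
  have inv: "f (f x) = x" for x
    by (cases "w = 0") (auto simp: f_def inner_diff_left scaleR_diff_left[symmetric] field_simps)
  have iso: "dist (f x) (f y) = dist x y" for x y
  proof -
    have "f x - f y = f (x - y)" using lin by (simp add: linear_diff)
    then show ?thesis by (simp add: dist_norm norm_eq_sqrt_inner inn)
  qed
  show thesis by (rule that[OF lin fb inn inv iso])
qed

lemma hausdorff_outer_hyperplane_finite:
  fixes v :: "'a::euclidean_space"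
  assumes dim: "DIM('a) \<ge> 2" and v: "norm v = 1" and "bounded A"
  shows "hausdorff_outer (real DIM('a) - 1) (A \<inter> {x. x \<bullet> v = c}) < \<infinity>" (is "hausdorff_outer ?s ?B < _")
proof -
  obtain b :: 'a where b: "b \<in> Basis" by fastforce
  obtain f where f: "linear f" "f b = v" "\<And>x y. f x \<bullet> f y = x \<bullet> y" "\<And>x. f (f x) = x"
    "\<And>x y. dist (f x) (f y) = dist x y"
    using unit_vector_reflection[of b v] b v by auto
  obtain R where R: "R > 0" "\<And>x. x \<in> A \<Longrightarrow> norm x \<le> R" using \<open>bounded A\<close> bounded_pos by blast
  \<comment> \<open>Subtracting \<open>c *\<^sub>R v\<close> leaves points of norm at most R + |c|;
    the extra 1 makes the coordinate bounds strict.\<close>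
  define a where "a = R + \<bar>c\<bar> + 1"
  let ?A = "{x::'a. x \<bullet> b = 0 \<and> (\<forall>j\<in>Basis-{b}. -a \<le> x \<bullet> j \<and> x \<bullet> j < a)}"
  define g where "g = (\<lambda>x. f x + c *\<^sub>R v)"
  have g: "dist (g x) (g y) = 1 * dist x y" for x y using f(5) by (simp add: g_def)
  have "?B \<subseteq> g ` ?A"
  proof
    fix x assume x: "x \<in> ?B"
    define y where "y = f (x - c *\<^sub>R v)"
    have gy: "g y = x" by (simp add: g_def y_def f)
    have "y \<bullet> b = (x - c *\<^sub>R v) \<bullet> v" unfolding y_def using f(2,3,4) by metis
    also have "\<dots> = 0" using x v by (simp add: inner_diff_left dot_square_norm)
    finally have "y \<bullet> b = 0" .
    moreover have "\<bar>y \<bullet> j\<bar> < a" if "j \<in> Basis" for j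
    proof -
      have "\<bar>y \<bullet> j\<bar> \<le> norm y" by (rule Basis_le_norm[OF that])
      also have "norm y = norm (x - c *\<^sub>R v)" by (simp add: y_def norm_eq_sqrt_inner f)
      also have "\<dots> \<le> norm x + \<bar>c\<bar>" using norm_triangle_ineq4[of x "c *\<^sub>R v"] v by simp
      also have "\<dots> < a" using R(2)[of x] x by (simp add: a_def)
      finally show ?thesis .
    qed
    ultimately have "y \<in> ?A" by (auto simp: abs_less_iff) (metis abs_less_iff less_imp_le minus_less_iff)
    then show "x \<in> g ` ?A" using gy by blast
  qed
  then have "hausdorff_outer ?s ?B \<le> hausdorff_outer ?s (g ` ?A)" by (rule hausdorff_outer_mono)
  also have "\<dots> = hausdorff_outer ?s ?A"
    using hausdorff_outer_similarity[OF g, of ?s ?A] dim by simp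
  also have "\<dots> < \<infinity>"
    by (rule hausdorff_outer_coordinate_hyperplane_finite[OF b _ dim]) (use R in \<open>auto simp: a_def\<close>)
  finally show ?thesis .
qed

lemma hausdorff_outer_disc_pos:
  fixes v :: "'a::euclidean_space"
  assumes dim: "DIM('a) \<ge> 2" and v: "norm v = 1" and "r > 0"
  shows "hausdorff_outer (real DIM('a) - 1) (cball 0 r \<inter> {x. x \<bullet> v = 0}) > 0" (is "hausdorff_outer ?s ?B > 0")
proof -
  obtain b :: 'a where b: "b \<in> Basis" by fastforce
  obtain f where f: "linear f" "f b = v" "\<And>x y. f x \<bullet> f y = x \<bullet> y" "\<And>x. f (f x) = x"
    "\<And>x y. dist (f x) (f y) = dist x y"
    using unit_vector_reflection[of b v] b v by auto
  \<comment> \<open>By the l1 bound a point whose coordinates have modulus at most r/n has norm at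
    most r.\<close>
  define a where "a = r / DIM('a)"
  have "a > 0" using \<open>r > 0\<close> by (simp add: a_def)
  let ?A = "{x::'a. x \<bullet> b = 0 \<and> (\<forall>j\<in>Basis-{b}. \<bar>x \<bullet> j\<bar> \<le> a)}"
  have g: "dist (f x) (f y) = 1 * dist x y" for x y using f(5) by simp
  have "f ` ?A \<subseteq> ?B"
  proof safe
    fix x assume x: "x \<bullet> b = 0" "\<forall>j\<in>Basis-{b}. \<bar>x \<bullet> j\<bar> \<le> a"
    show "f x \<bullet> v = 0" using f(2,3) x(1) by metis
    have "norm (f x) = norm x" by (simp add: norm_eq_sqrt_inner f)
    also have "\<dots> \<le> (\<Sum>j\<in>Basis. \<bar>x \<bullet> j\<bar>)" by (rule norm_le_l1)
    also have "\<dots> \<le> (\<Sum>j\<in>(Basis::'a set). a)"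
      using x \<open>a > 0\<close> by (intro sum_mono) (metis Diff_iff abs_zero less_imp_le singletonD)
    also have "\<dots> = r" by (simp add: a_def)
    finally show "f x \<in> cball 0 r" by simp
  qed
  have "0 < hausdorff_outer ?s ?A"
    by (rule hausdorff_outer_coordinate_hyperplane_pos[OF b \<open>a > 0\<close> dim])
  also have "\<dots> = hausdorff_outer ?s (f ` ?A)"
    using hausdorff_outer_similarity[OF g, of ?s ?A] dim by simp
  also have "\<dots> \<le> hausdorff_outer ?s ?B" by (rule hausdorff_outer_mono) fact
  finally show ?thesis .
qed

section \<open>Slices by parallel hyperplanes\<close>

definition hmeas :: "'a::euclidean_space measure" where
  "hmeas = hausdorff_measure (real DIM('a) - 1)"

lemma sets_hmeas [measurable_cong, simp]: "sets hmeas = sets borel"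
  by (simp add: hmeas_def)

lemma space_hmeas [simp]: "space hmeas = UNIV"
  by (simp add: hmeas_def)

lemma borel_measurable_hmeas [simp]: "borel_measurable hmeas = borel_measurable borel"
  by (rule measurable_cong_sets) auto

lemma nn_integral_hmeas_isometry:
  fixes f :: "'a::euclidean_space \<Rightarrow> 'a"
  assumes "\<And>x y. dist (f x) (f y) = dist x y" "surj f" "g \<in> borel_measurable borel"
  shows "(\<integral>\<^sup>+ x. g (f x) \<partial>hmeas) = (\<integral>\<^sup>+ x. g x \<partial>hmeas)"
  using nn_integral_hausdorff_similarity[of f 1 "real DIM('a) - 1" g] assms DIM_positive[where 'a='a]
  by (simp add: hmeas_def)

lemma nn_integral_hmeas_translate:
  fixes a :: "'a::euclidean_space"
  assumes "g \<in> borel_measurable borel"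
  shows "(\<integral>\<^sup>+ x. g (x + a) \<partial>hmeas) = (\<integral>\<^sup>+ x. g x \<partial>hmeas)"
  using nn_integral_hmeas_isometry[of "\<lambda>x. x + a" g] assms by (simp add: surj_plus_right)

text \<open>A measure on the whole space concentrated on one hyperplane. Measurability thus remains
  Borel measurability, and unlike \<open>hmeas\<close> it is sigma-finite for unit \<open>v\<close>,
  as Fubini requires.\<close>

definition hyp :: "'a::euclidean_space \<Rightarrow> real \<Rightarrow> 'a measure" where
  "hyp v c = density hmeas (indicator {x. x \<bullet> v = c})"

lemma sets_hyp [measurable_cong, simp]: "sets (hyp v c) = sets borel"
  by (simp add: hyp_def)

lemma space_hyp [simp]: "space (hyp v c) = UNIV"
  by (simp add: hyp_def)

lemma borel_measurable_hyp [simp]: "borel_measurable (hyp v c) = borel_measurable borel"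
  by (rule measurable_cong_sets) auto

lemma nn_integral_hyp:
  assumes [measurable]: "g \<in> borel_measurable borel"
  shows "(\<integral>\<^sup>+ x. g x \<partial>hyp v c) = (\<integral>\<^sup>+ x. g x * indicator {x. x \<bullet> v = c} x \<partial>hmeas)"
  unfolding hyp_def by (subst nn_integral_density) (auto simp: mult.commute)

lemma emeasure_hyp:
  assumes [measurable]: "A \<in> sets borel"
  shows "emeasure (hyp v c) A = hausdorff_outer (real DIM('a) - 1) (A \<inter> {x::'a::euclidean_space. x \<bullet> v = c})"
proof -
  have "emeasure (hyp v c) A = emeasure hmeas (A \<inter> {x. x \<bullet> v = c})"
    unfolding hyp_def by (subst emeasure_density) (auto simp: indicator_inter_arith[symmetric] Int_commute)
  then show ?thesis by (simp add: hmeas_def emeasure_hausdorff_measure)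
qed

lemma nn_integral_hyp_translate:
  fixes a :: "'a::euclidean_space"
  assumes [measurable]: "g \<in> borel_measurable borel"
  shows "(\<integral>\<^sup>+ x. g (x + a) \<partial>hyp v c) = (\<integral>\<^sup>+ x. g x \<partial>hyp v (c + a \<bullet> v))"
proof -
  have "(\<integral>\<^sup>+ x. g (x + a) \<partial>hyp v c) = (\<integral>\<^sup>+ x. g (x + a) * indicator {x. x \<bullet> v = c + a \<bullet> v} (x + a) \<partial>hmeas)"
    by (subst nn_integral_hyp) (auto simp: inner_add_left indicator_def intro!: nn_integral_cong)
  also have "\<dots> = (\<integral>\<^sup>+ x. g x * indicator {x. x \<bullet> v = c + a \<bullet> v} x \<partial>hmeas)"
    by (rule nn_integral_hmeas_translate[where g="\<lambda>x. g x * indicator {x. x \<bullet> v = c + a \<bullet> v} x"]) measurable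
  also have "\<dots> = (\<integral>\<^sup>+ x. g x \<partial>hyp v (c + a \<bullet> v))"
    by (subst nn_integral_hyp) auto
  finally show ?thesis .
qed

lemma sigma_finite_measureI_cball:
  fixes M :: "'a::euclidean_space measure"
  assumes "sets M = sets borel" "\<And>R. emeasure M (cball 0 R) < \<infinity>"
  shows "sigma_finite_measure M"
proof
  have "space M = UNIV" using sets_eq_imp_space_eq[OF assms(1)] by simp
  moreover have "(\<Union>n. cball (0::'a) (real n)) = UNIV"
    by (auto simp: real_arch_simple)
  ultimately show "\<exists>A. countable A \<and> A \<subseteq> sets M \<and> \<Union>A = space M \<and> (\<forall>a\<in>A. emeasure M a \<noteq> \<infinity>)"
    using assms by (intro exI[of _ "range (\<lambda>n::nat. cball 0 (real n))"]) (auto simp: less_top)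
qed

lemma sigma_finite_hyp:
  fixes v :: "'a::euclidean_space"
  assumes "DIM('a) \<ge> 2" "norm v = 1"
  shows "sigma_finite_measure (hyp v c)"
  using hausdorff_outer_hyperplane_finite[OF assms, of "cball 0 _" c] assms
  by (intro sigma_finite_measureI_cball) (auto simp: emeasure_hyp)

lemma nn_integral_lborel_translate:
  fixes a :: "'a::euclidean_space"
  assumes "g \<in> borel_measurable borel"
  shows "(\<integral>\<^sup>+ x. g (x + a) \<partial>lborel) = (\<integral>\<^sup>+ x. g x \<partial>lborel)"
  using assms by (subst (2) lborel_distr_plus[symmetric, of a]) (simp add: nn_integral_distr add.commute)

lemma nn_integral_lborel_uminus:
  fixes g :: "'a::euclidean_space \<Rightarrow> ennreal"
  assumes [measurable]: "g \<in> borel_measurable borel"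
  shows "(\<integral>\<^sup>+ x. g (- x) \<partial>lborel) = (\<integral>\<^sup>+ x. g x \<partial>lborel)"
proof -
  have "(lborel :: 'a measure) = density (distr lborel borel (\<lambda>x. 0 + (-1::real) *\<^sub>R x)) (\<lambda>_. \<bar>-1::real\<bar> ^ DIM('a))"
    by (rule lborel_affine) simp
  then have "(lborel :: 'a measure) = distr lborel borel uminus"
    by (simp add: density_1 one_ennreal_def[symmetric])
  moreover have "(\<integral>\<^sup>+ x. g x \<partial>distr lborel borel uminus) = (\<integral>\<^sup>+ x. g (- x) \<partial>lborel)"
    by (simp add: nn_integral_distr)
  ultimately show ?thesis by metis
qed

text \<open>Evaluate the integral of \<open>f x * g (x + y)\<close> in both orders, with \<open>f\<close> the indicator of the
  unit ball.\<close>
lemma translation_invariant_eq_lborel: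
  fixes M :: "'a::euclidean_space measure"
  assumes "sigma_finite_measure M" and sets_M [measurable_cong]: "sets M = sets borel"
    and inv: "\<And>a g. g \<in> borel_measurable borel \<Longrightarrow> (\<integral>\<^sup>+ x. g (x + a) \<partial>M) = (\<integral>\<^sup>+ x. g x \<partial>M)"
    and [measurable]: "g \<in> borel_measurable borel"
  shows "emeasure M (cball 0 1) * (\<integral>\<^sup>+ x. g x \<partial>lborel) = emeasure lborel (cball (0::'a) 1) * (\<integral>\<^sup>+ x. g x \<partial>M)"
proof -
  interpret M: sigma_finite_measure M by fact
  interpret P: pair_sigma_finite M lborel ..
  define f :: "'a \<Rightarrow> ennreal" where "f = indicator (cball 0 1)"
  have [measurable]: "f \<in> borel_measurable borel"
    unfolding f_def by (intro borel_measurable_indicator borel_closed closed_cball)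
  have f_uminus: "f (- x) = f x" for x by (simp add: f_def indicator_def)
  have fM: "(\<integral>\<^sup>+ x. f x \<partial>M) = emeasure M (cball 0 1)"
    unfolding f_def by (rule nn_integral_indicator) (simp add: sets_M)
  have fL: "(\<integral>\<^sup>+ x. f x \<partial>lborel) = emeasure lborel (cball (0::'a) 1)"
    unfolding f_def by (rule nn_integral_indicator) simp
  have "emeasure M (cball 0 1) * (\<integral>\<^sup>+ y. g y \<partial>lborel) = (\<integral>\<^sup>+ x. f x * (\<integral>\<^sup>+ y. g y \<partial>lborel) \<partial>M)"
    by (subst nn_integral_multc) (measurable, simp add: fM)
  also have "\<dots> = (\<integral>\<^sup>+ x. f x * (\<integral>\<^sup>+ y. g (y + x) \<partial>lborel) \<partial>M)"
    by (simp add: nn_integral_lborel_translate)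
  also have "\<dots> = (\<integral>\<^sup>+ x. (\<integral>\<^sup>+ y. f x * g (y + x) \<partial>lborel) \<partial>M)"
    by (intro nn_integral_cong nn_integral_cmult[symmetric]) measurable
  also have "\<dots> = (\<integral>\<^sup>+ y. (\<integral>\<^sup>+ x. f x * g (y + x) \<partial>M) \<partial>lborel)"
    by (rule P.Fubini'[symmetric]) measurable
  also have "\<dots> = (\<integral>\<^sup>+ y. (\<integral>\<^sup>+ x. f (x - y) * g x \<partial>M) \<partial>lborel)"
  proof (rule nn_integral_cong)
    fix y
    show "(\<integral>\<^sup>+ x. f x * g (y + x) \<partial>M) = (\<integral>\<^sup>+ x. f (x - y) * g x \<partial>M)"
      using inv[of "\<lambda>x. f (x - y) * g x" y] by (simp add: add.commute)
  qed
  also have "\<dots> = (\<integral>\<^sup>+ x. (\<integral>\<^sup>+ y. f (x - y) * g x \<partial>lborel) \<partial>M)"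
    by (rule P.Fubini') measurable
  also have "\<dots> = (\<integral>\<^sup>+ x. (\<integral>\<^sup>+ y. f (y + (- x)) \<partial>lborel) * g x \<partial>M)"
  proof (intro nn_integral_cong)
    fix x
    have "f (x - y) = f (y + (- x))" for y using f_uminus[of "x - y"] by simp
    then show "(\<integral>\<^sup>+ y. f (x - y) * g x \<partial>lborel) = (\<integral>\<^sup>+ y. f (y + (- x)) \<partial>lborel) * g x"
      by (simp add: nn_integral_multc)
  qed
  also have "\<dots> = (\<integral>\<^sup>+ x. emeasure lborel (cball (0::'a) 1) * g x \<partial>M)"
    by (subst nn_integral_lborel_translate) (simp_all add: fL)
  also have "\<dots> = emeasure lborel (cball (0::'a) 1) * (\<integral>\<^sup>+ x. g x \<partial>M)"
    by (rule nn_integral_cmult) measurable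
  finally show ?thesis .
qed

text \<open>Integration over the slices defines a translation invariant measure, finite on balls and
  positive on the unit ball, hence proportional to Lebesgue measure. The exact relation between
  Hausdorff and Lebesgue measure on a hyperplane is thereby avoided.\<close>

lemma nn_integral_lborel_slices_aux:
  fixes v :: "'a::euclidean_space"
  assumes dim: "DIM('a) \<ge> 2" and v: "norm v = 1"
  defines "I \<equiv> (\<lambda>g. \<integral>\<^sup>+ t. (\<integral>\<^sup>+ y. g (y + t *\<^sub>R v) \<partial>hyp v 0) \<partial>lborel)"
  shows "\<And>g. g \<in> borel_measurable borel \<Longrightarrow>
      I (indicator (cball 0 1)) * (\<integral>\<^sup>+ x. g x \<partial>lborel) = emeasure lborel (cball (0::'a) 1) * I g"
    and "I (indicator (cball 0 1)) < \<infinity>" "I (indicator (cball 0 1)) > 0"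
proof -
  interpret H: sigma_finite_measure "hyp v 0" by (rule sigma_finite_hyp[OF dim v])
  interpret P: pair_sigma_finite "hyp v 0" lborel ..
  have vv: "v \<bullet> v = 1" using v by (simp add: dot_square_norm)
  define M where "M = distr (hyp v 0 \<Otimes>\<^sub>M lborel) borel (\<lambda>(y, t). y + t *\<^sub>R v)"
  have sets_M [measurable_cong]: "sets M = sets borel" by (simp add: M_def)
  have M: "(\<integral>\<^sup>+ x. g x \<partial>M) = I g" if [measurable]: "g \<in> borel_measurable borel" for g :: "'a \<Rightarrow> ennreal"
  proof -
    have "(\<integral>\<^sup>+ x. g x \<partial>M) = (\<integral>\<^sup>+ p. g (fst p + snd p *\<^sub>R v) \<partial>(hyp v 0 \<Otimes>\<^sub>M lborel))"
      unfolding M_def by (subst nn_integral_distr) (auto simp: case_prod_unfold)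
    also have "\<dots> = I g"
      unfolding I_def by (subst P.nn_integral_snd[symmetric]) auto
    finally show ?thesis .
  qed
  have emM: "emeasure M A = I (indicator A)" if "A \<in> sets borel" for A
    using M[of "indicator A"] that by (simp add: sets_M)
  have norm_eq: "norm (y + t *\<^sub>R v) ^ 2 = norm y ^ 2 + t ^ 2" if "y \<bullet> v = 0" for y t
    unfolding power2_norm_eq_inner using that by (simp add: inner_add_left inner_add_right inner_commute vv power2_eq_square)
  \<comment> \<open>By Pythagoras both the height and the projection of a point of the ball are
    bounded by \<open>R\<close>.\<close>
  have fin: "I (indicator (cball 0 R)) < \<infinity>" for R
  proof -
    have "I (indicator (cball 0 R)) \<le> (\<integral>\<^sup>+ t. indicator {-R..R} t * emeasure (hyp v 0) (cball 0 R) \<partial>lborel)"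
      unfolding I_def
    proof (rule nn_integral_mono)
      fix t
      have "(\<integral>\<^sup>+ y. indicator (cball 0 R) (y + t *\<^sub>R v) \<partial>hyp v 0)
          \<le> (\<integral>\<^sup>+ y. indicator {-R..R} t * indicator (cball 0 R) y \<partial>hyp v 0)"
      proof (rule nn_integral_mono_AE)
        have "AE y in hyp v 0. y \<bullet> v = 0"
          unfolding hyp_def by (subst AE_density) (auto simp: indicator_def)
        then show "AE y in hyp v 0. indicator (cball 0 R) (y + t *\<^sub>R v)
            \<le> (indicator {-R..R} t * indicator (cball 0 R) y :: ennreal)"
        proof eventually_elim
          fix y assume "y \<bullet> v = 0"
          from norm_eq[OF this, of t]
          have sq: "(norm y)\<^sup>2 \<le> (norm (y + t *\<^sub>R v))\<^sup>2" "\<bar>t\<bar>\<^sup>2 \<le> (norm (y + t *\<^sub>R v))\<^sup>2" by simp_all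
          have "norm y \<le> norm (y + t *\<^sub>R v)" "\<bar>t\<bar> \<le> norm (y + t *\<^sub>R v)"
            using sq[THEN power2_le_imp_le] by simp_all
          then show "indicator (cball 0 R) (y + t *\<^sub>R v)
            \<le> (indicator {-R..R} t * indicator (cball 0 R) y :: ennreal)"
            by (auto simp: indicator_def)
        qed
      qed
      then show "(\<integral>\<^sup>+ y. indicator (cball 0 R) (y + t *\<^sub>R v) \<partial>hyp v 0)
          \<le> indicator {-R..R} t * emeasure (hyp v 0) (cball 0 R)"
        by (simp add: nn_integral_cmult_indicator)
    qed
    also have "\<dots> = emeasure lborel {-R..R} * emeasure (hyp v 0) (cball 0 R)"
      by (simp add: nn_integral_multc)
    also have "\<dots> < \<infinity>"
      using hausdorff_outer_hyperplane_finite[OF dim v, of "cball 0 R" 0]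
      by (cases "-R \<le> R") (auto simp: emeasure_hyp ennreal_mult_less_top)
    finally show ?thesis .
  qed
  then show "I (indicator (cball 0 1)) < \<infinity>" .
  show "I (indicator (cball 0 1)) > 0"
  proof -
    have "(\<integral>\<^sup>+ t. indicator {-1/2..1/2::real} t * emeasure (hyp v 0) (cball 0 (1/2)) \<partial>lborel) \<le> I (indicator (cball 0 1))"
      unfolding I_def
    proof (rule nn_integral_mono)
      fix t :: real
      have "(\<integral>\<^sup>+ y. indicator {-1/2..1/2} t * indicator (cball 0 (1/2)) y \<partial>hyp v 0)
          \<le> (\<integral>\<^sup>+ y. indicator (cball 0 1) (y + t *\<^sub>R v) \<partial>hyp v 0)"
      proof (rule nn_integral_mono)
        fix y
        have "norm (y + t *\<^sub>R v) \<le> 1" if "norm y \<le> 1/2" "\<bar>t\<bar> \<le> 1/2"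
          using norm_triangle_ineq[of y "t *\<^sub>R v"] that v by simp
        then show "indicator {-1/2..1/2} t * indicator (cball 0 (1/2)) y
            \<le> (indicator (cball 0 1) (y + t *\<^sub>R v) :: ennreal)"
          by (auto simp: indicator_def)
      qed
      then show "indicator {-1/2..1/2} t * emeasure (hyp v 0) (cball 0 (1/2))
          \<le> (\<integral>\<^sup>+ y. indicator (cball 0 1) (y + t *\<^sub>R v) \<partial>hyp v 0)"
        by (simp add: nn_integral_cmult_indicator)
    qed
    also have "(\<integral>\<^sup>+ t. indicator {-1/2..1/2::real} t * emeasure (hyp v 0) (cball 0 (1/2)) \<partial>lborel)
        = emeasure (hyp v 0) (cball 0 (1/2))"
      by (simp add: nn_integral_multc)
    finally show ?thesis
      using hausdorff_outer_disc_pos[OF dim v, of "1/2"] by (simp add: emeasure_hyp)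
  qed
  have "sigma_finite_measure M"
    by (rule sigma_finite_measureI_cball[OF sets_M]) (use fin in \<open>simp add: emM\<close>)
  moreover have "(\<integral>\<^sup>+ x. g (x + a) \<partial>M) = (\<integral>\<^sup>+ x. g x \<partial>M)"
    if g [measurable]: "g \<in> borel_measurable borel" for a and g :: "'a \<Rightarrow> ennreal"
  proof -
    \<comment> \<open>The component of \<open>a\<close> along \<open>v\<close> is absorbed by the
      integral over \<open>t\<close>, the rest by the invariance of \<open>hyp v 0\<close> within
      its hyperplane.\<close>
    define s where "s = a \<bullet> v"
    define a' where "a' = a - s *\<^sub>R v"
    have a': "a' \<bullet> v = 0" by (simp add: a'_def s_def inner_diff_left vv)
    have [measurable]: "case_prod (\<lambda>y t. g (y + t *\<^sub>R v)) \<in> borel_measurable (hyp v 0 \<Otimes>\<^sub>M lborel)"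
      by measurable
    have "(\<integral>\<^sup>+ x. g (x + a) \<partial>M) = I (\<lambda>x. g (x + a))" by (rule M) measurable
    also have "\<dots> = (\<integral>\<^sup>+ t. (\<integral>\<^sup>+ y. g ((y + a') + (t + s) *\<^sub>R v) \<partial>hyp v 0) \<partial>lborel)"
      unfolding I_def by (simp add: a'_def algebra_simps)
    also have "\<dots> = (\<integral>\<^sup>+ t. (\<integral>\<^sup>+ y. g (y + (t + s) *\<^sub>R v) \<partial>hyp v 0) \<partial>lborel)"
    proof (rule nn_integral_cong)
      fix t
      show "(\<integral>\<^sup>+ y. g ((y + a') + (t + s) *\<^sub>R v) \<partial>hyp v 0) = (\<integral>\<^sup>+ y. g (y + (t + s) *\<^sub>R v) \<partial>hyp v 0)"
        using nn_integral_hyp_translate[where g="\<lambda>y. g (y + (t + s) *\<^sub>R v)" and a=a' and v=v and c=0] a' by simp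
    qed
    also have "\<dots> = I g"
      unfolding I_def
      by (rule nn_integral_lborel_translate[where g="\<lambda>t. (\<integral>\<^sup>+ y. g (y + t *\<^sub>R v) \<partial>hyp v 0)"])
         (measurable)
    finally show ?thesis by (simp add: M)
  qed
  ultimately show "I (indicator (cball 0 1)) * (\<integral>\<^sup>+ x. g x \<partial>lborel) = emeasure lborel (cball (0::'a) 1) * I g"
    if "g \<in> borel_measurable borel" for g :: "'a \<Rightarrow> ennreal"
    using translation_invariant_eq_lborel[OF _ sets_M _ that] that by (simp add: emM M)
qed

text \<open>Makes the constant of the slice formula the same for all unit vectors: a reflection
  carries one family of slices of the ball to the other.\<close>

lemma nn_integral_hyp_reflection:
  fixes v w :: "'a::euclidean_space"
  assumes "norm v = 1" "norm w = 1"
  shows "(\<integral>\<^sup>+ y. indicator (cball 0 1) (y + t *\<^sub>R v) \<partial>hyp v 0) = (\<integral>\<^sup>+ y. indicator (cball 0 1) (y + t *\<^sub>R w) \<partial>hyp w 0)"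
proof -
  obtain f where f: "linear f" "f v = w" "\<And>x y. f x \<bullet> f y = x \<bullet> y" "\<And>x. f (f x) = x"
    "\<And>x y. dist (f x) (f y) = dist x y"
    using unit_vector_reflection[OF assms] by auto
  have surj: "surj f" by (rule surjI[of f f]) (rule f)
  have 1: "f y \<bullet> w = y \<bullet> v" for y using f(2,3) by metis
  have 2: "norm (f y + t *\<^sub>R w) = norm (y + t *\<^sub>R v)" for y
  proof -
    have "f y + t *\<^sub>R w = f (y + t *\<^sub>R v)" using f(1,2) by (simp add: linear_add linear_scale)
    then show ?thesis by (simp add: norm_eq_sqrt_inner f)
  qed
  have [measurable]: "(\<lambda>y. indicator (cball 0 1) (y + t *\<^sub>R u) :: ennreal) \<in> borel_measurable borel" for u :: 'a
    by (rule measurable_compose[OF _ borel_measurable_indicator[of "cball 0 1" borel]]) auto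
  have "(\<integral>\<^sup>+ y. indicator (cball 0 1) (y + t *\<^sub>R w) \<partial>hyp w 0)
      = (\<integral>\<^sup>+ y. indicator (cball 0 1) (y + t *\<^sub>R w) * indicator {x. x \<bullet> w = 0} y \<partial>hmeas)"
    by (subst nn_integral_hyp) auto
  also have "\<dots> = (\<integral>\<^sup>+ y. indicator (cball 0 1) (f y + t *\<^sub>R w) * indicator {x. x \<bullet> w = 0} (f y) \<partial>hmeas)"
    by (rule nn_integral_hmeas_isometry[OF f(5) surj, symmetric]) measurable
  also have "\<dots> = (\<integral>\<^sup>+ y. indicator (cball 0 1) (y + t *\<^sub>R v) * indicator {x. x \<bullet> v = 0} y \<partial>hmeas)"
    by (intro nn_integral_cong) (auto simp: indicator_def 1 2)
  also have "\<dots> = (\<integral>\<^sup>+ y. indicator (cball 0 1) (y + t *\<^sub>R v) \<partial>hyp v 0)"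
    by (subst nn_integral_hyp) auto
  finally show ?thesis ..
qed

text \<open>That one \<kappa> serves all directions is the point: facets with different normals will
  be compared through the same Lebesgue integral.\<close>

theorem nn_integral_lborel_slices:
  assumes dim: "DIM('a::euclidean_space) \<ge> 2"
  obtains \<kappa> where "\<kappa> > 0" and "\<And>(v::'a) (g::'a \<Rightarrow> ennreal). norm v = 1 \<Longrightarrow> g \<in> borel_measurable borel \<Longrightarrow>
     (\<integral>\<^sup>+ x. g x \<partial>lborel) = ennreal \<kappa> * (\<integral>\<^sup>+ t. (\<integral>\<^sup>+ y. g (y + t *\<^sub>R v) \<partial>hyp v 0) \<partial>lborel)"
proof -
  obtain b :: 'a where "b \<in> Basis" by fastforce
  then have b: "norm b = 1" by simp
  define J where "J = (\<lambda>v::'a. \<integral>\<^sup>+ t. (\<integral>\<^sup>+ y. indicator (cball 0 1) (y + t *\<^sub>R v) \<partial>hyp v 0) \<partial>lborel)"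
  have J: "J v = J b" if "norm v = 1" for v
    unfolding J_def by (simp add: nn_integral_hyp_reflection[OF that b])
  have Jb: "J b < \<infinity>" "J b > 0"
    using nn_integral_lborel_slices_aux(2,3)[OF dim b] unfolding J_def by auto
  define \<beta> where "\<beta> = measure lborel (cball (0::'a) 1)"
  have \<beta>: "emeasure lborel (cball (0::'a) 1) = ennreal \<beta>"
    unfolding \<beta>_def by (rule emeasure_eq_ennreal_measure) (use emeasure_lborel_cball_finite[of "0::'a" 1] in \<open>simp add: less_top\<close>)
  have \<beta>0: "\<beta> > 0" by (simp add: \<beta>_def content_cball_pos)
  define j where "j = enn2real (J b)"
  have j: "J b = ennreal j" "j > 0"
    using Jb by (auto simp: j_def less_top enn2real_positive_iff)
  show thesis
  proof (rule that[of "\<beta> / j"])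
    fix v :: 'a and g :: "'a \<Rightarrow> ennreal" assume v: "norm v = 1" and g: "g \<in> borel_measurable borel"
    have "ennreal j * (\<integral>\<^sup>+ x. g x \<partial>lborel) = ennreal \<beta> * (\<integral>\<^sup>+ t. (\<integral>\<^sup>+ y. g (y + t *\<^sub>R v) \<partial>hyp v 0) \<partial>lborel)"
      using nn_integral_lborel_slices_aux(1)[OF dim v g] J[OF v] j \<beta> unfolding J_def by simp
    then have "ennreal (1/j) * (ennreal j * (\<integral>\<^sup>+ x. g x \<partial>lborel))
        = ennreal (1/j) * (ennreal \<beta> * (\<integral>\<^sup>+ t. (\<integral>\<^sup>+ y. g (y + t *\<^sub>R v) \<partial>hyp v 0) \<partial>lborel))" by simp
    then show "(\<integral>\<^sup>+ x. g x \<partial>lborel) = ennreal (\<beta> / j) * (\<integral>\<^sup>+ t. (\<integral>\<^sup>+ y. g (y + t *\<^sub>R v) \<partial>hyp v 0) \<partial>lborel)"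
      using \<open>j > 0\<close> \<beta>0 by (simp add: mult.assoc[symmetric] ennreal_mult'[symmetric])
  qed (use j \<beta>0 in auto)
qed

text \<open>A line of direction \<open>u\<close> stays in the slab for the time 1 / |u . v|, so the
  factor |u . v| makes the slab a weight of integral 1 along each such line.\<close>

lemma nn_integral_weighted_slab_line:
  fixes u v x :: "'a::euclidean_space"
  assumes "u \<bullet> v \<noteq> 0"
  shows "(\<integral>\<^sup>+ s. ennreal \<bar>u \<bullet> v\<bar> * indicator {x. c \<le> x \<bullet> v \<and> x \<bullet> v < c + 1} (x + s *\<^sub>R u) \<partial>lborel) = 1"
proof -
  define a where "a = u \<bullet> v"
  define p where "p = x \<bullet> v"
  have a: "a \<noteq> 0" using assms by (simp add: a_def)
  have eq: "indicator {x. c \<le> x \<bullet> v \<and> x \<bullet> v < c + 1} (x + s *\<^sub>R u)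
      = (indicator {s. c \<le> p + s * a \<and> p + s * a < c + 1} s :: ennreal)" for s
    by (simp add: indicator_def inner_add_left p_def a_def)
  have "emeasure lborel {s. c \<le> p + s * a \<and> p + s * a < c + 1} = ennreal (1 / \<bar>a\<bar>)"
  proof (cases "a > 0")
    case True
    then have "{s. c \<le> p + s * a \<and> p + s * a < c + 1} = {(c - p) / a ..< (c + 1 - p) / a}"
      by (auto simp: field_simps)
    moreover have "(c + 1 - p) / a - (c - p) / a = 1 / a" by (simp add: diff_divide_distrib[symmetric])
    moreover have "(c - p) / a \<le> (c + 1 - p) / a" using True by (simp add: divide_right_mono)
    ultimately show ?thesis using True by (simp only: emeasure_lborel_Ico) simp
  next
    case False
    with a have "a < 0" by simp
    then have "{s. c \<le> p + s * a \<and> p + s * a < c + 1} = {(c + 1 - p) / a <.. (c - p) / a}"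
      by (auto simp: field_simps)
    moreover have "(c - p) / a - (c + 1 - p) / a = 1 / \<bar>a\<bar>"
      using \<open>a < 0\<close> by (simp add: diff_divide_distrib[symmetric])
    moreover have "(c + 1 - p) / a \<le> (c - p) / a" using \<open>a < 0\<close> by (simp add: divide_right_mono_neg)
    ultimately show ?thesis by (simp only: emeasure_lborel_Ioc)
  qed
  moreover have "{s. c \<le> p + s * a \<and> p + s * a < c + 1} \<in> sets lborel" by measurable
  ultimately have "(\<integral>\<^sup>+ s. ennreal \<bar>a\<bar> * indicator {s. c \<le> p + s * a \<and> p + s * a < c + 1} s \<partial>lborel) = ennreal \<bar>a\<bar> * ennreal (1 / \<bar>a\<bar>)"
    by (subst nn_integral_cmult_indicator) auto
  also have "\<dots> = 1" using a by (simp add: ennreal_mult'[symmetric])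
  finally show ?thesis unfolding eq a_def .
qed

text \<open>Each side is an integral of \<open>f\<close> over the space of lines of direction
  \<open>u\<close>; a weight only distributes unit mass along each line. Insert the second weight,
  integrated along the line, then exchange the integrals and translate.\<close>

lemma nn_integral_invariant_weights:
  fixes u :: "'a::euclidean_space" and f :: "'a \<Rightarrow> ennreal"
  assumes [measurable]: "f \<in> borel_measurable borel" "\<theta> \<in> borel_measurable borel" "\<theta>' \<in> borel_measurable borel"
    and inv: "\<And>x s. f (x + s *\<^sub>R u) = f x"
    and one: "\<And>x. (\<integral>\<^sup>+ s. \<theta> (x + s *\<^sub>R u) \<partial>lborel) = 1" "\<And>x. (\<integral>\<^sup>+ s. \<theta>' (x + s *\<^sub>R u) \<partial>lborel) = 1"
  shows "(\<integral>\<^sup>+ x. f x * \<theta> x \<partial>lborel) = (\<integral>\<^sup>+ x. f x * \<theta>' x \<partial>lborel)"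
proof -
  have "(\<integral>\<^sup>+ x. f x * \<theta> x \<partial>lborel) = (\<integral>\<^sup>+ x. (\<integral>\<^sup>+ s. f x * \<theta> x * \<theta>' (x + s *\<^sub>R u) \<partial>lborel) \<partial>lborel)"
    by (simp add: nn_integral_cmult one)
  also have "\<dots> = (\<integral>\<^sup>+ s. (\<integral>\<^sup>+ x. f x * \<theta> x * \<theta>' (x + s *\<^sub>R u) \<partial>lborel) \<partial>lborel)"
    by (rule lborel_pair.Fubini'[symmetric]) measurable
  also have "\<dots> = (\<integral>\<^sup>+ s. (\<integral>\<^sup>+ x. f x * \<theta> (x - s *\<^sub>R u) * \<theta>' x \<partial>lborel) \<partial>lborel)"
  proof (rule nn_integral_cong)
    fix s
    have "f (x - s *\<^sub>R u) = f x" for x using inv[of "x - s *\<^sub>R u" s] by simp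
    then show "(\<integral>\<^sup>+ x. f x * \<theta> x * \<theta>' (x + s *\<^sub>R u) \<partial>lborel) = (\<integral>\<^sup>+ x. f x * \<theta> (x - s *\<^sub>R u) * \<theta>' x \<partial>lborel)"
      using nn_integral_lborel_translate[where g="\<lambda>x. f x * \<theta> (x - s *\<^sub>R u) * \<theta>' x" and a="s *\<^sub>R u"]
      by (simp add: inv)
  qed
  also have "\<dots> = (\<integral>\<^sup>+ x. (\<integral>\<^sup>+ s. f x * \<theta> (x - s *\<^sub>R u) * \<theta>' x \<partial>lborel) \<partial>lborel)"
    by (rule lborel_pair.Fubini') measurable
  also have "\<dots> = (\<integral>\<^sup>+ x. f x * \<theta>' x \<partial>lborel)"
  proof (rule nn_integral_cong)
    fix x
    have "(\<integral>\<^sup>+ s. \<theta> (x - s *\<^sub>R u) \<partial>lborel) = (\<integral>\<^sup>+ s. \<theta> (x + s *\<^sub>R u) \<partial>lborel)"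
      using nn_integral_lborel_uminus[where g="\<lambda>s. \<theta> (x + s *\<^sub>R u)"] by simp
    then show "(\<integral>\<^sup>+ s. f x * \<theta> (x - s *\<^sub>R u) * \<theta>' x \<partial>lborel) = f x * \<theta>' x"
      by (simp add: nn_integral_cmult nn_integral_multc one)
  qed
  finally show ?thesis .
qed

lemma nn_integral_invariant_slabs:
  fixes u :: "'a::euclidean_space" and f :: "'a \<Rightarrow> ennreal"
  assumes [measurable]: "f \<in> borel_measurable borel"
    and inv: "\<And>x s. f (x + s *\<^sub>R u) = f x" and "u \<bullet> v \<noteq> 0" "u \<bullet> w \<noteq> 0"
  shows "ennreal \<bar>u \<bullet> v\<bar> * (\<integral>\<^sup>+ x. f x * indicator {x. c \<le> x \<bullet> v \<and> x \<bullet> v < c + 1} x \<partial>lborel)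
     = ennreal \<bar>u \<bullet> w\<bar> * (\<integral>\<^sup>+ x. f x * indicator {x. d \<le> x \<bullet> w \<and> x \<bullet> w < d + 1} x \<partial>lborel)"
proof -
  let ?t = "\<lambda>v c x. ennreal \<bar>u \<bullet> v\<bar> * indicator {x. c \<le> x \<bullet> v \<and> x \<bullet> v < c + 1} x"
  have "(\<integral>\<^sup>+ x. f x * ?t v c x \<partial>lborel) = (\<integral>\<^sup>+ x. f x * ?t w d x \<partial>lborel)"
    by (rule nn_integral_invariant_weights[OF _ _ _ inv])
       (use assms nn_integral_weighted_slab_line in \<open>auto\<close>)
  moreover have "(\<integral>\<^sup>+ x. f x * ?t v c x \<partial>lborel)
     = ennreal \<bar>u \<bullet> v\<bar> * (\<integral>\<^sup>+ x. f x * indicator {x. c \<le> x \<bullet> v \<and> x \<bullet> v < c + 1} x \<partial>lborel)" for v c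
    by (subst nn_integral_cmult[symmetric]) (auto simp: mult_ac)
  ultimately show ?thesis by simp
qed

lemma emeasure_lborel_hyperplane:
  fixes w :: "'a::euclidean_space"
  assumes "w \<noteq> 0"
  shows "emeasure lborel {x. x \<bullet> w = c} = 0"
proof -
  have "negligible {x. w \<bullet> x = c}" using assms by (intro negligible_hyperplane) auto
  then have "{x. x \<bullet> w = c} \<in> null_sets lborel"
    by (simp add: negligible_iff_null_sets null_sets_completion_iff inner_commute)
  then show ?thesis by auto
qed

lemma AE_lborel_inner_neq:
  fixes w :: "'a::euclidean_space"
  assumes "w \<noteq> 0"
  shows "AE x in lborel. x \<bullet> w \<noteq> c"
  using emeasure_lborel_hyperplane[OF assms, of c]
  by (intro AE_I[of _ _ "{x. x \<bullet> w = c}"]) auto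

text \<open>The surface lies in the frontier of the solid cylinder, a convex set, and such frontiers
  are negligible.\<close>

lemma emeasure_lborel_cylinder:
  fixes v :: "'a::euclidean_space"
  assumes vv: "v \<bullet> v = 1"
  shows "emeasure lborel {x. norm (x - (x \<bullet> v) *\<^sub>R v) = 1} = 0"
proof -
  let ?p = "\<lambda>x::'a. x - (x \<bullet> v) *\<^sub>R v"
  let ?C = "{x. norm (?p x) \<le> 1}"
  have lin: "linear ?p" by (rule linearI) (auto simp: algebra_simps inner_add_left)
  have pp: "?p (?p x) = ?p x" for x using vv by (simp add: inner_diff_left)
  have "?C = ?p -` cball 0 1" by auto
  then have "convex ?C" using lin by (simp only: convex_linear_vimage convex_cball)
  then have "negligible (frontier ?C)" by (rule negligible_convex_frontier)
  moreover have "{x. norm (?p x) = 1} \<subseteq> frontier ?C"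
  proof
    fix x assume "x \<in> {x. norm (?p x) = 1}"
    then have x: "norm (?p x) = 1" by simp
    have "x \<notin> interior ?C"
    proof
      assume "x \<in> interior ?C"
      then obtain e where e: "e > 0" "cball x e \<subseteq> ?C" by (auto simp: mem_interior_cball)
      define y where "y = x + e *\<^sub>R ?p x"
      have "y \<in> cball x e" using e x by (simp add: y_def dist_norm)
      then have "norm (?p y) \<le> 1" using e by auto
      moreover have "?p y = (1 + e) *\<^sub>R ?p x"
        using pp[of x] by (simp add: y_def linear_add[OF lin] linear_scale[OF lin] scaleR_add_left)
      ultimately show False using e x by simp
    qed
    moreover have "x \<in> closure ?C" using x closure_subset[of ?C] by auto
    ultimately show "x \<in> frontier ?C" by (simp add: frontier_def)
  qed
  ultimately have "negligible {x. norm (?p x) = 1}" by (rule negligible_subset)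
  moreover have "{x. norm (?p x) = 1} \<in> sets borel" by measurable
  ultimately have "{x. norm (?p x) = 1} \<in> null_sets lborel"
    by (simp add: negligible_iff_null_sets null_sets_completion_iff)
  then show ?thesis by auto
qed

text \<open>The parameter \<open>T\<close> only fixes the ambient space.\<close>
locale hausdorff_slices =
  fixes \<kappa> :: real and T :: "'a::euclidean_space itself"
  assumes dim: "DIM('a) \<ge> 2" and \<kappa>_pos: "\<kappa> > 0"
    and slices: "\<And>(v::'a) (g::'a \<Rightarrow> ennreal). norm v = 1 \<Longrightarrow> g \<in> borel_measurable borel \<Longrightarrow>
     (\<integral>\<^sup>+ x. g x \<partial>lborel) = ennreal \<kappa> * (\<integral>\<^sup>+ t. (\<integral>\<^sup>+ y. g (y + t *\<^sub>R v) \<partial>hyp v 0) \<partial>lborel)"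
begin

text \<open>As \<open>u\<close> is transversal to the hyperplane, all parallel slices carry the same
  integral of \<open>f\<close>, and a slab of thickness 1 has \<kappa> times that value.\<close>

lemma nn_integral_hyp_eq_slab:
  fixes u v :: 'a and f :: "'a \<Rightarrow> ennreal"
  assumes [measurable]: "f \<in> borel_measurable borel"
    and inv: "\<And>x s. f (x + s *\<^sub>R u) = f x" and uv: "u \<bullet> v \<noteq> 0" and v: "norm v = 1"
  shows "ennreal \<kappa> * (\<integral>\<^sup>+ x. f x \<partial>hyp v c) = (\<integral>\<^sup>+ x. f x * indicator {x. 0 \<le> x \<bullet> v \<and> x \<bullet> v < 1} x \<partial>lborel)"
proof -
  have vv: "v \<bullet> v = 1" using v by (simp add: dot_square_norm)
  have shift: "(\<integral>\<^sup>+ x. f x \<partial>hyp v c) = (\<integral>\<^sup>+ x. f x \<partial>hyp v d)" for c d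
    using nn_integral_hyp_translate[where g=f and v=v and c=c and a="((d - c) / (u \<bullet> v)) *\<^sub>R u"] uv
    by (simp add: inv)
  have AEv: "AE y in hyp v c. y \<bullet> v = c" for c
    unfolding hyp_def by (subst AE_density) (auto simp: indicator_def)
  have "(\<integral>\<^sup>+ x. f x * indicator {x. 0 \<le> x \<bullet> v \<and> x \<bullet> v < 1} x \<partial>lborel)
    = ennreal \<kappa> * (\<integral>\<^sup>+ t. (\<integral>\<^sup>+ y. f (y + t *\<^sub>R v) * indicator {x. 0 \<le> x \<bullet> v \<and> x \<bullet> v < 1} (y + t *\<^sub>R v) \<partial>hyp v 0) \<partial>lborel)"
    by (rule slices[OF v]) measurable
  also have "(\<integral>\<^sup>+ t. (\<integral>\<^sup>+ y. f (y + t *\<^sub>R v) * indicator {x. 0 \<le> x \<bullet> v \<and> x \<bullet> v < 1} (y + t *\<^sub>R v) \<partial>hyp v 0) \<partial>lborel)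
     = (\<integral>\<^sup>+ t. indicator {0..<1::real} t * (\<integral>\<^sup>+ x. f x \<partial>hyp v c) \<partial>lborel)"
  proof (rule nn_integral_cong)
    fix t :: real
    have "(\<integral>\<^sup>+ y. f (y + t *\<^sub>R v) * indicator {x. 0 \<le> x \<bullet> v \<and> x \<bullet> v < 1} (y + t *\<^sub>R v) \<partial>hyp v 0)
       = (\<integral>\<^sup>+ y. indicator {0..<1} t * f (y + t *\<^sub>R v) \<partial>hyp v 0)"
      using AEv[of 0] by (intro nn_integral_cong_AE) (auto simp: indicator_def inner_add_left vv)
    also have "\<dots> = indicator {0..<1} t * (\<integral>\<^sup>+ y. f (y + t *\<^sub>R v) \<partial>hyp v 0)"
      by (rule nn_integral_cmult) simp
    also have "(\<integral>\<^sup>+ y. f (y + t *\<^sub>R v) \<partial>hyp v 0) = (\<integral>\<^sup>+ x. f x \<partial>hyp v c)"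
      by (subst nn_integral_hyp_translate) (auto intro: shift)
    finally show "(\<integral>\<^sup>+ y. f (y + t *\<^sub>R v) * indicator {x. 0 \<le> x \<bullet> v \<and> x \<bullet> v < 1} (y + t *\<^sub>R v) \<partial>hyp v 0)
      = indicator {0..<1} t * (\<integral>\<^sup>+ x. f x \<partial>hyp v c)" .
  qed
  also have "\<dots> = (\<integral>\<^sup>+ x. f x \<partial>hyp v c)"
    by (simp add: nn_integral_multc)
  finally show ?thesis ..
qed

text \<open>|u . v| is the Jacobian of the projection along \<open>u\<close>. The right-hand side
  involves neither \<open>v\<close> nor \<open>c\<close>, so integrals over different facets become
  integrals over one slab.\<close>

lemma nn_integral_hyp_projected:
  fixes u v :: 'a and f :: "'a \<Rightarrow> ennreal"
  assumes [measurable]: "f \<in> borel_measurable borel"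
    and inv: "\<And>x s. f (x + s *\<^sub>R u) = f x" and uv: "u \<bullet> v \<noteq> 0" and v: "norm v = 1" and u: "norm u = 1"
  shows "ennreal (\<kappa> * \<bar>u \<bullet> v\<bar>) * (\<integral>\<^sup>+ x. f x \<partial>hyp v c) = (\<integral>\<^sup>+ x. f x * indicator {x. 0 \<le> x \<bullet> u \<and> x \<bullet> u < 1} x \<partial>lborel)"
proof -
  have uu: "u \<bullet> u = 1" using u by (simp add: dot_square_norm)
  have "ennreal (\<kappa> * \<bar>u \<bullet> v\<bar>) * (\<integral>\<^sup>+ x. f x \<partial>hyp v c) = ennreal \<bar>u \<bullet> v\<bar> * (ennreal \<kappa> * (\<integral>\<^sup>+ x. f x \<partial>hyp v c))"
    using \<kappa>_pos by (simp add: ennreal_mult' mult_ac)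
  also have "\<dots> = ennreal \<bar>u \<bullet> v\<bar> * (\<integral>\<^sup>+ x. f x * indicator {x. 0 \<le> x \<bullet> v \<and> x \<bullet> v < 0 + 1} x \<partial>lborel)"
    using nn_integral_hyp_eq_slab[OF assms(1-4)] by simp
  also have "\<dots> = ennreal \<bar>u \<bullet> u\<bar> * (\<integral>\<^sup>+ x. f x * indicator {x. 0 \<le> x \<bullet> u \<and> x \<bullet> u < 0 + 1} x \<partial>lborel)"
    by (rule nn_integral_invariant_slabs[OF assms(1) inv uv]) (simp add: uu)
  finally show ?thesis by (simp add: uu)
qed

text \<open>On the hyperplane only the component \<open>w'\<close> of \<open>w\<close> orthogonal to
  \<open>v\<close> matters. The condition on it is constant along \<open>v\<close>, so the slab
  formula in direction \<open>v\<close> reduces the claim to a Lebesgue null hyperplane.\<close>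

lemma emeasure_hyp_hyperplane:
  fixes v w :: 'a
  assumes v: "norm v = 1" and w: "w - (v \<bullet> w) *\<^sub>R v \<noteq> 0"
  shows "emeasure (hyp v c) {x. x \<bullet> w = d} = 0"
proof -
  have vv: "v \<bullet> v = 1" using v by (simp add: dot_square_norm)
  define w' where "w' = w - (v \<bullet> w) *\<^sub>R v"
  define e where "e = d - c * (v \<bullet> w)"
  have vw': "v \<bullet> w' = 0" by (simp add: w'_def inner_diff_right vv)
  define f :: "'a \<Rightarrow> ennreal" where "f = indicator {x. x \<bullet> w' = e}"
  have [measurable]: "f \<in> borel_measurable borel" unfolding f_def by measurable
  have inv: "f (x + s *\<^sub>R v) = f x" for x s by (simp add: f_def indicator_def inner_add_left vw')
  have "emeasure (hyp v c) {x. x \<bullet> w = d} = (\<integral>\<^sup>+ x. indicator {x. x \<bullet> w = d} x \<partial>hyp v c)"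
    by simp
  also have "\<dots> = (\<integral>\<^sup>+ x. f x \<partial>hyp v c)"
  proof (rule nn_integral_cong_AE)
    have "AE y in hyp v c. y \<bullet> v = c"
      unfolding hyp_def by (subst AE_density) (auto simp: indicator_def)
    then show "AE x in hyp v c. indicator {x. x \<bullet> w = d} x = f x"
      by eventually_elim (auto simp: f_def indicator_def w'_def e_def inner_diff_right mult_ac)
  qed
  finally have eq: "emeasure (hyp v c) {x. x \<bullet> w = d} = (\<integral>\<^sup>+ x. f x \<partial>hyp v c)" .
  have "ennreal \<kappa> * (\<integral>\<^sup>+ x. f x \<partial>hyp v c) = (\<integral>\<^sup>+ x. f x * indicator {x. 0 \<le> x \<bullet> v \<and> x \<bullet> v < 1} x \<partial>lborel)"
    by (rule nn_integral_hyp_eq_slab[of _ v]) (auto simp: inv vv v)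
  also have "\<dots> \<le> (\<integral>\<^sup>+ x. indicator {x. x \<bullet> w' = e} x \<partial>lborel)"
    by (intro nn_integral_mono) (auto simp: f_def indicator_def)
  also have "\<dots> = 0" using emeasure_lborel_hyperplane[of w' e] w by (simp add: w'_def)
  finally show ?thesis using \<kappa>_pos by (simp add: eq)
qed

text \<open>The same reduction with the cylinder over the equator in place of the sphere. Read as a
  statement about the sphere, it says that great subspheres are null.\<close>

lemma emeasure_hyp_sphere:
  fixes v :: 'a
  assumes v: "norm v = 1"
  shows "emeasure (hyp v 0) (sphere 0 1) = 0"
proof -
  have vv: "v \<bullet> v = 1" using v by (simp add: dot_square_norm)
  define f :: "'a \<Rightarrow> ennreal" where "f = indicator {x. norm (x - (x \<bullet> v) *\<^sub>R v) = 1}"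
  have [measurable]: "f \<in> borel_measurable borel" unfolding f_def by measurable
  have inv: "f (x + s *\<^sub>R v) = f x" for x s
    by (simp add: f_def indicator_def inner_add_left vv algebra_simps)
  have "emeasure (hyp v 0) (sphere 0 1) = (\<integral>\<^sup>+ x. indicator (sphere 0 1) x \<partial>hyp v 0)"
    by simp
  also have "\<dots> = (\<integral>\<^sup>+ x. f x \<partial>hyp v 0)"
  proof (rule nn_integral_cong_AE)
    have "AE y in hyp v 0. y \<bullet> v = 0"
      unfolding hyp_def by (subst AE_density) (auto simp: indicator_def)
    then show "AE x in hyp v 0. indicator (sphere 0 1) x = f x"
      by eventually_elim (auto simp: f_def indicator_def)
  qed
  finally have eq: "emeasure (hyp v 0) (sphere 0 1) = (\<integral>\<^sup>+ x. f x \<partial>hyp v 0)" .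
  have "ennreal \<kappa> * (\<integral>\<^sup>+ x. f x \<partial>hyp v 0) = (\<integral>\<^sup>+ x. f x * indicator {x. 0 \<le> x \<bullet> v \<and> x \<bullet> v < 1} x \<partial>lborel)"
    by (rule nn_integral_hyp_eq_slab[of _ v]) (auto simp: inv vv v)
  also have "\<dots> \<le> (\<integral>\<^sup>+ x. indicator {x. norm (x - (x \<bullet> v) *\<^sub>R v) = 1} x \<partial>lborel)"
    by (intro nn_integral_mono) (auto simp: f_def indicator_def)
  also have "\<dots> = 0" using emeasure_lborel_cylinder[OF vv] by simp
  finally show ?thesis using \<kappa>_pos by (simp add: eq)
qed

end

section \<open>Surface measure of the unit sphere\<close>

lemma hausdorff_outer_finite_UN:
  assumes "finite I" "\<And>i. i \<in> I \<Longrightarrow> hausdorff_outer s (A i) < \<infinity>"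
  shows "hausdorff_outer s (\<Union>i\<in>I. A i) < \<infinity>"
  using assms
proof (induction I)
  case (insert i I)
  have "hausdorff_outer s (\<Union>i\<in>insert i I. A i) \<le> hausdorff_outer s (A i) + hausdorff_outer s (\<Union>i\<in>I. A i)"
    using hausdorff_outer_Un by simp
  also have "\<dots> < \<infinity>" using insert by simp
  finally show ?case .
qed (simp add: hausdorff_outer_empty)

text \<open>With x = a p and y = b q one has |x - y|^2 - |p - q|^2 = (a - b)^2 + 2 (a b - 1) (1 - p
  . q), and both summands are nonnegative.\<close>

lemma dist_normalize_le:
  fixes x y :: "'a::euclidean_space"
  assumes "norm x \<ge> 1" "norm y \<ge> 1"
  shows "dist (x /\<^sub>R norm x) (y /\<^sub>R norm y) \<le> dist x y"
proof -
  define a b where "a = norm x" and "b = norm y"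
  define p q where "p = x /\<^sub>R a" and "q = y /\<^sub>R b"
  have ab: "a \<ge> 1" "b \<ge> 1" using assms by (auto simp: a_def b_def)
  have n1: "norm p = 1" "norm q = 1"
    using ab unfolding p_def q_def norm_scaleR a_def[symmetric] b_def[symmetric] by simp_all
  have t: "p \<bullet> q \<le> 1"
    using norm_cauchy_schwarz[of p q] unfolding n1 by simp
  have xy: "x = a *\<^sub>R p" "y = b *\<^sub>R q" using ab unfolding p_def q_def by simp_all
  have pq: "p \<bullet> p = 1" "q \<bullet> q = 1" using n1 by (simp_all add: dot_square_norm)
  have "(norm (p - q))\<^sup>2 = 2 - 2 * (p \<bullet> q)"
    unfolding power2_norm_eq_inner by (simp add: inner_diff_left inner_diff_right pq inner_commute)
  moreover have "(norm (x - y))\<^sup>2 = a\<^sup>2 + b\<^sup>2 - 2 * (a * b * (p \<bullet> q))"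
    unfolding power2_norm_eq_inner xy
    by (simp add: inner_diff_left inner_diff_right pq inner_commute power2_eq_square algebra_simps)
  moreover have "0 \<le> (a - b)\<^sup>2 + 2 * ((a * b - 1) * (1 - p \<bullet> q))"
    using ab t mult_mono[of 1 a 1 b] by (intro add_nonneg_nonneg mult_nonneg_nonneg) auto
  ultimately have "(norm (p - q))\<^sup>2 \<le> (norm (x - y))\<^sup>2"
    by (simp add: power2_eq_square algebra_simps)
  then have "norm (p - q) \<le> norm (x - y)" by (rule power2_le_imp_le) simp
  then show ?thesis unfolding p_def q_def a_def b_def dist_norm .
qed

text \<open>The sphere is covered by the radial projections of the faces of the cube [-1,1]^n, and
  radial projection does not increase distances outside the open unit ball.\<close>

lemma hausdorff_outer_sphere_finite:
  assumes dim: "DIM('a::euclidean_space) \<ge> 2"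
  shows "hausdorff_outer (real DIM('a) - 1) (sphere (0::'a) 1) < \<infinity>"
proof -
  let ?s = "real DIM('a) - 1"
  let ?n = "\<lambda>x::'a. x /\<^sub>R norm x"
  define F where "F = (\<lambda>(b::'a, c::real). cbox (- One) One \<inter> {x. x \<bullet> b = c})"
  define I where "I = (Basis :: 'a set) \<times> {1, -1::real}"
  have big: "norm x \<ge> 1" if "x \<in> F i" "i \<in> I" for x i
    using that Basis_le_norm[of "fst i" x] by (auto simp: F_def I_def)
  have "sphere 0 1 \<subseteq> (\<Union>i\<in>I. ?n ` F i)"
  proof
    fix y :: 'a assume y: "y \<in> sphere 0 1"
    define m where "m = Max ((\<lambda>j. \<bar>y \<bullet> j\<bar>) ` Basis)"
    have m_ge: "\<bar>y \<bullet> j\<bar> \<le> m" if "j \<in> Basis" for j using that by (auto simp: m_def)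
    have "m \<in> (\<lambda>j. \<bar>y \<bullet> j\<bar>) ` Basis" unfolding m_def by (rule Max_in) auto
    then obtain b where b: "b \<in> Basis" "m = \<bar>y \<bullet> b\<bar>" by auto
    have "m > 0"
    proof (rule ccontr)
      assume "\<not> m > 0"
      then have "y \<bullet> j = 0" if "j \<in> Basis" for j using m_ge[OF that] by linarith
      then have "y = 0" by (auto intro: euclidean_eqI)
      then show False using y by simp
    qed
    define x where "x = y /\<^sub>R m"
    have xj: "x \<bullet> j = y \<bullet> j / m" for j by (simp add: x_def divide_inverse_commute)
    have "x \<in> cbox (- One) One"
      using m_ge \<open>m > 0\<close> by (force simp: mem_box xj abs_le_iff field_simps)
    moreover have "x \<bullet> b = 1 \<or> x \<bullet> b = -1"
      using b(2) \<open>m > 0\<close> by (auto simp: xj abs_if field_simps split: if_splits)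
    ultimately obtain i where i: "i \<in> I" "x \<in> F i" using b(1) by (auto simp: I_def F_def)
    have "?n x = y" using y \<open>m > 0\<close> by (simp add: x_def)
    then have "y \<in> ?n ` F i" using i(2) by (intro image_eqI[of _ _ x]) simp_all
    then show "y \<in> (\<Union>i\<in>I. ?n ` F i)" using i(1) by (rule UN_I[rotated])
  qed
  then have "hausdorff_outer ?s (sphere (0::'a) 1) \<le> hausdorff_outer ?s (\<Union>i\<in>I. ?n ` F i)"
    by (rule hausdorff_outer_mono)
  also have "\<dots> < \<infinity>"
  proof (rule hausdorff_outer_finite_UN)
    show "finite I" by (simp add: I_def)
    fix i assume i: "i \<in> I"
    have "hausdorff_outer ?s (?n ` F i) \<le> ennreal (1 powr ?s) * hausdorff_outer ?s (F i)"
      by (rule hausdorff_outer_lipschitz) (use big[OF _ i] dist_normalize_le dim in auto)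
    also have "\<dots> < \<infinity>"
      using i hausdorff_outer_hyperplane_finite[OF dim, of "fst i" "cbox (- One) One" "snd i"]
      by (auto simp: I_def F_def split: prod.splits)
    finally show "hausdorff_outer ?s (?n ` F i) < \<infinity>" .
  qed
  finally show ?thesis .
qed

text \<open>Orthogonal projection does not increase distances and maps the sphere onto the
  equatorial disc, which has positive measure.\<close>

lemma hausdorff_outer_sphere_pos:
  assumes dim: "DIM('a::euclidean_space) \<ge> 2"
  shows "hausdorff_outer (real DIM('a) - 1) (sphere (0::'a) 1) > 0"
proof -
  let ?s = "real DIM('a) - 1"
  obtain v :: 'a where "v \<in> Basis" by fastforce
  then have v: "norm v = 1" "v \<bullet> v = 1" by auto
  let ?p = "\<lambda>x::'a. x - (x \<bullet> v) *\<^sub>R v"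
  have le: "norm (?p x) \<le> norm x" for x
  proof -
    have "?p x \<bullet> ?p x = x \<bullet> x - (x \<bullet> v) * (x \<bullet> v)"
      by (simp add: inner_diff_left inner_diff_right v inner_commute[of v x])
    then have "(norm (?p x))\<^sup>2 \<le> (norm x)\<^sup>2"
      unfolding power2_norm_eq_inner by simp
    then show ?thesis by (rule power2_le_imp_le) simp
  qed
  have "cball 0 1 \<inter> {x. x \<bullet> v = 0} \<subseteq> ?p ` sphere 0 1"
  proof
    fix y assume y: "y \<in> cball 0 1 \<inter> {x. x \<bullet> v = 0}"
    define x where "x = y + sqrt (1 - (norm y)\<^sup>2) *\<^sub>R v"
    have le1: "(norm y)\<^sup>2 \<le> 1" using y by (simp add: power_le_one)
    have "(norm x)\<^sup>2 = (norm y)\<^sup>2 + (sqrt (1 - (norm y)\<^sup>2))\<^sup>2"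
      unfolding power2_norm_eq_inner x_def using y
      by (simp add: inner_add_left inner_add_right v inner_commute power2_eq_square)
    then have "(norm x)\<^sup>2 = 1" using le1 by simp
    then have "norm x = 1" using norm_ge_zero[of x] by (auto simp: power2_eq_1_iff)
    moreover have "?p x = y" using y by (simp add: x_def inner_add_left v)
    ultimately show "y \<in> ?p ` sphere 0 1" by (intro image_eqI[of _ _ x]) simp_all
  qed
  then have "hausdorff_outer ?s (cball 0 1 \<inter> {x. x \<bullet> v = 0}) \<le> hausdorff_outer ?s (?p ` sphere 0 1)"
    by (rule hausdorff_outer_mono)
  also have "\<dots> \<le> ennreal (1 powr ?s) * hausdorff_outer ?s (sphere (0::'a) 1)"
  proof (rule hausdorff_outer_lipschitz)
    fix x y :: 'a
    have eq: "?p x - ?p y = ?p (x - y)" by (simp add: inner_diff_left scaleR_diff_left)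
    show "dist (?p x) (?p y) \<le> 1 * dist x y" using le[of "x - y"] unfolding dist_norm eq by simp
  qed (use dim in auto)
  finally show ?thesis
    using hausdorff_outer_disc_pos[OF dim v(1), of 1] by auto
qed

definition sph :: "'a::euclidean_space measure" where
  "sph = density hmeas (indicator (sphere 0 1))"

lemma sets_sph [measurable_cong, simp]: "sets sph = sets borel"
  by (simp add: sph_def)

lemma space_sph [simp]: "space sph = UNIV"
  by (simp add: sph_def)

lemma borel_measurable_sph [simp]: "borel_measurable sph = borel_measurable borel"
  by (rule measurable_cong_sets) auto

lemma nn_integral_sph:
  assumes "g \<in> borel_measurable borel"
  shows "(\<integral>\<^sup>+ x. g x \<partial>sph) = (\<integral>\<^sup>+ x. g x * indicator (sphere 0 1) x \<partial>hmeas)"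
proof -
  have "(indicator (sphere 0 1) :: 'a \<Rightarrow> ennreal) \<in> borel_measurable hmeas"
    by (intro borel_measurable_indicator) simp
  then show ?thesis
    unfolding sph_def using assms by (subst nn_integral_density) (auto simp: mult.commute)
qed

lemma emeasure_sph:
  fixes A :: "'a::euclidean_space set"
  assumes A: "A \<in> sets borel"
  shows "emeasure sph A = hausdorff_outer (real DIM('a) - 1) (A \<inter> sphere 0 1)"
proof -
  have S: "sphere (0::'a) 1 \<in> sets borel" by simp
  have "emeasure sph A = emeasure hmeas (A \<inter> sphere 0 1)"
    unfolding sph_def using A S
    by (subst emeasure_density) (auto simp: indicator_inter_arith[symmetric] Int_commute intro!: borel_measurable_indicator)
  then show ?thesis using A S by (simp add: hmeas_def emeasure_hausdorff_measure)
qed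

lemma AE_sph_norm: "AE u in sph. norm (u::'a::euclidean_space) = 1"
proof -
  have "(indicator (sphere 0 1) :: 'a \<Rightarrow> ennreal) \<in> borel_measurable hmeas"
    by (intro borel_measurable_indicator) simp
  then show ?thesis unfolding sph_def by (subst AE_density) (auto simp: indicator_def)
qed

lemma finite_measure_sph:
  assumes "DIM('a::euclidean_space) \<ge> 2"
  shows "finite_measure (sph :: 'a measure)"
  using hausdorff_outer_sphere_finite[OF assms] by (intro finite_measureI) (simp add: emeasure_sph)

lemma emeasure_sph_pos:
  assumes "DIM('a::euclidean_space) \<ge> 2"
  shows "emeasure (sph :: 'a measure) UNIV > 0"
  using hausdorff_outer_sphere_pos[OF assms] by (simp add: emeasure_sph)

lemma nn_integral_sph_uminus:
  assumes [measurable]: "g \<in> borel_measurable borel"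
  shows "(\<integral>\<^sup>+ u. g (- u) \<partial>sph) = (\<integral>\<^sup>+ u. g u \<partial>(sph::'a::euclidean_space measure))"
proof -
  have [measurable]: "(indicator (sphere 0 1) :: 'a \<Rightarrow> ennreal) \<in> borel_measurable borel"
    by (intro borel_measurable_indicator) simp
  have "(\<integral>\<^sup>+ u. g (- u) \<partial>sph) = (\<integral>\<^sup>+ u. g (- u) * indicator (sphere 0 1) (- u) \<partial>hmeas)"
    by (subst nn_integral_sph) (auto simp: indicator_def)
  also have "\<dots> = (\<integral>\<^sup>+ u. g u * indicator (sphere 0 1) u \<partial>hmeas)"
    by (rule nn_integral_hmeas_isometry) (auto simp: dist_minus surj_uminus)
  finally show ?thesis by (simp add: nn_integral_sph)
qed

context hausdorff_slices begin

lemma AE_sph_inner_neq_0: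
  fixes v :: 'a
  assumes v: "norm v = 1"
  shows "AE u in sph. u \<bullet> v \<noteq> 0"
proof (rule AE_I)
  show "{x \<in> space sph. \<not> x \<bullet> v \<noteq> 0} \<subseteq> {x. x \<bullet> v = 0}" by auto
  have "emeasure sph {x. x \<bullet> v = 0} = emeasure (hyp v 0) (sphere 0 1)"
    by (simp add: emeasure_sph emeasure_hyp Int_commute)
  then show "emeasure sph {x. x \<bullet> v = 0} = 0" using emeasure_hyp_sphere[OF v] by simp
qed simp

end

section \<open>Chords of polytopes with given facet normals\<close>

lemma tendsto_Min:
  fixes f :: "'i \<Rightarrow> 'b \<Rightarrow> real"
  assumes "finite I" "I \<noteq> {}" "\<And>i. i \<in> I \<Longrightarrow> (f i \<longlongrightarrow> l i) F"
  shows "((\<lambda>x. Min ((\<lambda>i. f i x) ` I)) \<longlongrightarrow> Min (l ` I)) F"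
  using assms by (induction I rule: finite_ne_induct) (auto intro: tendsto_min)

definition facet_polytope :: "nat \<Rightarrow> (nat \<Rightarrow> 'a::euclidean_space) \<Rightarrow> (nat \<Rightarrow> real) \<Rightarrow> 'a set" where
  "facet_polytope N v h = {x. \<forall>j<N. x \<bullet> v j \<le> h j}"

text \<open>General position is reduced here to pairwise independence of the normals, which makes
  ridges and ties of crossing times null sets. Its full strength returns in
  \<open>relations_direction_bound\<close>.\<close>

locale facet_normals = hausdorff_slices \<kappa> T for \<kappa> :: real and T :: "'a::euclidean_space itself" +
  fixes N :: nat and v :: "nat \<Rightarrow> 'a"
  assumes norm_v: "i < N \<Longrightarrow> norm (v i) = 1"
    and positive_spanning: "u \<noteq> 0 \<Longrightarrow> \<exists>j<N. u \<bullet> v j > 0"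
    and not_parallel: "i < N \<Longrightarrow> j < N \<Longrightarrow> i \<noteq> j \<Longrightarrow> v j \<noteq> c *\<^sub>R v i"
begin

abbreviation P :: "(nat \<Rightarrow> real) \<Rightarrow> 'a set" where "P \<equiv> facet_polytope N v"

text \<open>The line \<open>x + t u\<close> crosses the \<open>j\<close>-th facet hyperplane at \<open>t = crossing h u x j\<close>.\<close>
definition crossing :: "(nat \<Rightarrow> real) \<Rightarrow> 'a \<Rightarrow> 'a \<Rightarrow> nat \<Rightarrow> real" where
  "crossing h u x j = (h j - x \<bullet> v j) / (u \<bullet> v j)"

definition up :: "'a \<Rightarrow> nat set" where
  "up u = {j. j < N \<and> 0 < u \<bullet> v j}"

definition exit_time :: "(nat \<Rightarrow> real) \<Rightarrow> 'a \<Rightarrow> 'a \<Rightarrow> real" where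
  "exit_time h u x = Min (crossing h u x ` up u)"

text \<open>Signed: for generic \<open>u\<close> it is negative exactly when the line through
  \<open>x\<close> misses \<open>P h\<close>, so it is meaningful for all \<open>x\<close> and not
  only inside the polytope.\<close>

definition chord :: "(nat \<Rightarrow> real) \<Rightarrow> 'a \<Rightarrow> 'a \<Rightarrow> real" where
  "chord h u x = exit_time h u x + exit_time h (- u) x"

definition generic :: "'a \<Rightarrow> bool" where
  "generic u \<longleftrightarrow> norm u = 1 \<and> (\<forall>j<N. u \<bullet> v j \<noteq> 0)"

text \<open>Membership of a point of the i-th facet hyperplane in \<open>P h\<close>, extended to be
  constant along \<open>u\<close> so that the projection formula applies.\<close>

definition active :: "(nat \<Rightarrow> real) \<Rightarrow> 'a \<Rightarrow> nat \<Rightarrow> 'a set" where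
  "active h u i = {x. x + crossing h u x i *\<^sub>R u \<in> P h}"

lemma finite_up [simp]: "finite (up u)" by (simp add: up_def)

lemma up_nonempty: "u \<noteq> 0 \<Longrightarrow> up u \<noteq> {}"
  using positive_spanning[of u] by (auto simp: up_def)

lemma generic_nonzero: "generic u \<Longrightarrow> u \<noteq> 0" by (auto simp: generic_def)

lemma generic_uminus: "generic u \<Longrightarrow> generic (- u)" by (auto simp: generic_def)

lemma mem_P: "x \<in> P h \<longleftrightarrow> (\<forall>j<N. x \<bullet> v j \<le> h j)"
  by (simp add: facet_polytope_def)

lemma closed_P: "closed (P h)"
proof -
  have "P h = (\<Inter>j\<in>{..<N}. {x. v j \<bullet> x \<le> h j})" by (auto simp: mem_P inner_commute)
  then show ?thesis by (simp add: closed_INT closed_halfspace_le)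
qed

lemma borel_P [measurable]: "P h \<in> sets borel"
  by (rule borel_closed[OF closed_P])

lemma exit_time_le: "j \<in> up u \<Longrightarrow> exit_time h u x \<le> crossing h u x j"
  by (simp add: exit_time_def)

lemma exit_time_attained: "u \<noteq> 0 \<Longrightarrow> \<exists>j\<in>up u. exit_time h u x = crossing h u x j"
proof -
  assume "u \<noteq> 0"
  then have "Min (crossing h u x ` up u) \<in> crossing h u x ` up u"
    using up_nonempty[of u] by (intro Min_in) auto
  then show ?thesis unfolding exit_time_def by (auto simp del: Min_in)
qed

lemma exit_time_ge_iff: "u \<noteq> 0 \<Longrightarrow> t \<le> exit_time h u x \<longleftrightarrow> (\<forall>j\<in>up u. t \<le> crossing h u x j)"
  using up_nonempty[of u] by (simp add: exit_time_def)

lemma crossing_uminus: "crossing h (- u) x j = - crossing h u x j"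
  by (simp add: crossing_def)

lemma crossing_shift: "u \<bullet> v j \<noteq> 0 \<Longrightarrow> crossing h u (x + s *\<^sub>R u) j = crossing h u x j - s"
  by (simp add: crossing_def inner_add_left field_simps)

lemma exit_time_shift: "u \<noteq> 0 \<Longrightarrow> exit_time h u (x + s *\<^sub>R u) = exit_time h u x - s"
proof (rule antisym)
  assume u: "u \<noteq> 0"
  obtain j where j: "j \<in> up u" "exit_time h u x = crossing h u x j" using exit_time_attained[OF u] by blast
  show "exit_time h u (x + s *\<^sub>R u) \<le> exit_time h u x - s"
    using exit_time_le[OF j(1), of h "x + s *\<^sub>R u"] j by (simp add: crossing_shift up_def)
  show "exit_time h u x - s \<le> exit_time h u (x + s *\<^sub>R u)"
    unfolding exit_time_ge_iff[OF u] using exit_time_le[of _ u h x] by (auto simp: crossing_shift up_def)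
qed

lemma chord_shift: "u \<noteq> 0 \<Longrightarrow> chord h u (x + s *\<^sub>R u) = chord h u x"
  using exit_time_shift[of u h x s] exit_time_shift[of "- u" h x "- s"] by (simp add: chord_def)

lemma chord_uminus: "chord h (- u) x = chord h u x"
  by (simp add: chord_def)

lemma line_mem_P_ge:
  assumes x: "x \<in> P h" and "u \<noteq> 0" "t \<ge> 0"
  shows "x + t *\<^sub>R u \<in> P h \<longleftrightarrow> t \<le> exit_time h u x"
proof -
  have "x + t *\<^sub>R u \<in> P h \<longleftrightarrow> (\<forall>j\<in>up u. x \<bullet> v j + t * (u \<bullet> v j) \<le> h j)"
  proof
    assume *: "\<forall>j\<in>up u. x \<bullet> v j + t * (u \<bullet> v j) \<le> h j"
    show "x + t *\<^sub>R u \<in> P h"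
      unfolding mem_P
    proof (intro allI impI)
      fix j assume j: "j < N"
      show "(x + t *\<^sub>R u) \<bullet> v j \<le> h j"
      proof (cases "u \<bullet> v j > 0")
        case True
        then show ?thesis using * j by (auto simp: up_def inner_add_left)
      next
        case False
        then have "t * (u \<bullet> v j) \<le> 0" using \<open>t \<ge> 0\<close> by (simp add: mult_le_0_iff)
        moreover have "x \<bullet> v j \<le> h j" using x j by (simp add: mem_P)
        ultimately show ?thesis by (simp add: inner_add_left)
      qed
    qed
  qed (auto simp: mem_P up_def inner_add_left)
  also have "\<dots> \<longleftrightarrow> (\<forall>j\<in>up u. t \<le> crossing h u x j)"
    by (intro ball_cong refl) (auto simp: up_def crossing_def field_simps)
  finally show ?thesis by (simp add: exit_time_ge_iff[OF \<open>u \<noteq> 0\<close>])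
qed

lemma exit_time_nonneg: "x \<in> P h \<Longrightarrow> u \<noteq> 0 \<Longrightarrow> 0 \<le> exit_time h u x"
  using line_mem_P_ge[of x h u 0] by simp

lemma line_mem_P:
  assumes u: "generic u"
  shows "x + t *\<^sub>R u \<in> P h \<longleftrightarrow> - exit_time h (- u) x \<le> t \<and> t \<le> exit_time h u x"
proof -
  have u0: "u \<noteq> 0" "- u \<noteq> 0" using u by (auto simp: generic_def)
  have "x + t *\<^sub>R u \<in> P h \<longleftrightarrow> (\<forall>j\<in>up u. x \<bullet> v j + t * (u \<bullet> v j) \<le> h j) \<and> (\<forall>j\<in>up (- u). x \<bullet> v j + t * (u \<bullet> v j) \<le> h j)"
    using u by (auto simp: mem_P up_def generic_def inner_add_left) (meson linorder_neqE_linordered_idom)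
  also have "(\<forall>j\<in>up u. x \<bullet> v j + t * (u \<bullet> v j) \<le> h j) \<longleftrightarrow> (\<forall>j\<in>up u. t \<le> crossing h u x j)"
    by (intro ball_cong refl) (auto simp: up_def crossing_def field_simps)
  also have "(\<forall>j\<in>up (- u). x \<bullet> v j + t * (u \<bullet> v j) \<le> h j) \<longleftrightarrow> (\<forall>j\<in>up (- u). - t \<le> crossing h (- u) x j)"
    by (intro ball_cong refl) (auto simp: up_def crossing_def field_simps)
  finally show ?thesis
    using exit_time_ge_iff[OF u0(1), of t h x] exit_time_ge_iff[OF u0(2), of "- t" h x] by auto
qed

lemma active_iff:
  assumes "generic u"
  shows "x \<in> active h u i \<longleftrightarrow> - exit_time h (- u) x \<le> crossing h u x i \<and> crossing h u x i \<le> exit_time h u x"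
  by (simp add: active_def line_mem_P[OF assms])

lemma active_chord_nonneg: "generic u \<Longrightarrow> x \<in> active h u i \<Longrightarrow> 0 \<le> chord h u x"
  by (simp add: active_iff chord_def)

lemma active_shift:
  assumes "i < N" "u \<bullet> v i \<noteq> 0"
  shows "x + s *\<^sub>R u \<in> active h u i \<longleftrightarrow> x \<in> active h u i"
proof -
  have "(x + s *\<^sub>R u) + crossing h u (x + s *\<^sub>R u) i *\<^sub>R u = x + crossing h u x i *\<^sub>R u"
    unfolding crossing_shift[OF assms(2)] by (simp add: scaleR_diff_left)
  then show ?thesis by (simp only: active_def mem_Collect_eq)
qed

lemma radial_fun_P:
  assumes x: "x \<in> P h" and u: "u \<noteq> 0"
  shows "radial_fun (P h) x u = exit_time h u x"
proof -
  have "{t. 0 \<le> t \<and> x + t *\<^sub>R u \<in> P h} = {0..exit_time h u x}"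
    using line_mem_P_ge[OF x u] by auto
  then show ?thesis using exit_time_nonneg[OF x u] by (simp add: radial_fun_def)
qed

lemma crossing_measurable: "(\<lambda>p. crossing h (fst p) (snd p) j) \<in> borel_measurable (borel \<Otimes>\<^sub>M borel)"
  unfolding crossing_def by measurable

lemma exit_time_measurable: "(\<lambda>p. exit_time h (fst p) (snd p)) \<in> borel_measurable (borel \<Otimes>\<^sub>M borel)"
proof -
  \<comment> \<open>The index set of the minimum depends on \<open>u\<close>. Splitting by which
    inner products are positive leaves finitely many minima over fixed index sets.\<close>
  have "exit_time h u x = (\<Sum>J\<in>Pow {..<N}. indicator {u. \<forall>j<N. (0 < u \<bullet> v j) = (j \<in> J)} u * Min (crossing h u x ` J))" for u x
  proof -
    have "(\<Sum>J\<in>Pow {..<N}. indicator {u. \<forall>j<N. (0 < u \<bullet> v j) = (j \<in> J)} u * Min (crossing h u x ` J))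
       = (\<Sum>J\<in>{up u}. indicator {u. \<forall>j<N. (0 < u \<bullet> v j) = (j \<in> J)} u * Min (crossing h u x ` J))"
      by (rule sum.mono_neutral_right) (auto simp: up_def indicator_def)
    moreover have "\<forall>j<N. (0 < u \<bullet> v j) = (j \<in> up u)" by (auto simp: up_def)
    ultimately show ?thesis by (simp add: exit_time_def)
  qed
  moreover have "(\<lambda>p. \<Sum>J\<in>Pow {..<N}. indicator {u. \<forall>j<N. (0 < u \<bullet> v j) = (j \<in> J)} (fst p) * Min (crossing h (fst p) (snd p) ` J))
     \<in> borel_measurable (borel \<Otimes>\<^sub>M borel)"
  proof (intro borel_measurable_sum borel_measurable_times)
    fix J assume "J \<in> Pow {..<N}"
    then have "finite J" by (auto intro: finite_subset)
    then have "(\<lambda>p. Min ((\<lambda>j. crossing h (fst p) (snd p) j) ` J)) \<in> borel_measurable (borel \<Otimes>\<^sub>M borel)"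
      by (intro borel_measurable_Min crossing_measurable)
    then show "(\<lambda>p. Min (crossing h (fst p) (snd p) ` J)) \<in> borel_measurable (borel \<Otimes>\<^sub>M borel)" .
    have "{u::'a. \<forall>j<N. (0 < u \<bullet> v j) = (j \<in> J)} \<in> sets borel" by measurable
    then show "(\<lambda>p. indicator {u. \<forall>j<N. (0 < u \<bullet> v j) = (j \<in> J)} (fst p) :: real) \<in> borel_measurable (borel \<Otimes>\<^sub>M borel)"
      by (intro measurable_compose[OF measurable_fst borel_measurable_indicator])
  qed
  ultimately show ?thesis by simp
qed

lemma exit_time_measurable' [measurable (raw)]:
  assumes [measurable]: "f \<in> borel_measurable M" "g \<in> borel_measurable M"
  shows "(\<lambda>p. exit_time h (f p) (g p)) \<in> borel_measurable M"
proof -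
  have "(\<lambda>p. (f p, g p)) \<in> M \<rightarrow>\<^sub>M borel \<Otimes>\<^sub>M borel" by measurable
  from measurable_compose[OF this exit_time_measurable] show ?thesis by simp
qed

lemma chord_measurable' [measurable (raw)]:
  assumes [measurable]: "f \<in> borel_measurable M" "g \<in> borel_measurable M"
  shows "(\<lambda>p. chord h (f p) (g p)) \<in> borel_measurable M"
  unfolding chord_def by measurable

lemma borel_active [measurable]: "active h u i \<in> sets borel"
proof -
  have "(\<lambda>x. x + crossing h u x i *\<^sub>R u) \<in> borel_measurable borel" unfolding crossing_def by measurable
  from measurable_sets[OF this borel_P] show ?thesis by (simp add: active_def vimage_def)
qed

text \<open>The largest inner product with a normal is continuous and, by
  \<open>positive_spanning\<close>, positive on the compact unit sphere; its minimum there serves as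
  \<open>c\<close>.\<close>

lemma inner_lower_bound:
  obtains c where "c > 0" "\<And>x. \<exists>j<N. c * norm x \<le> x \<bullet> v j"
proof -
  have N: "{..<N} \<noteq> {}"
  proof -
    obtain b :: 'a where "b \<in> Basis" by fastforce
    then have "b \<noteq> 0" by (rule nonzero_Basis)
    then show ?thesis using positive_spanning[of b] by auto
  qed
  define m where "m = (\<lambda>x::'a. Max ((\<lambda>j. x \<bullet> v j) ` {..<N}))"
  have m_le: "x \<bullet> v j \<le> m x" if "j < N" for x j using that by (simp add: m_def)
  have m_in: "\<exists>j<N. m x = x \<bullet> v j" for x
  proof -
    have "m x \<in> (\<lambda>j. x \<bullet> v j) ` {..<N}" unfolding m_def using N by (intro Max_in) auto
    then show ?thesis by auto
  qed
  \<comment> \<open>Rewritten as a minimum so that \<open>tendsto_Min\<close> gives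
    continuity.\<close>
  have "m x = - Min ((\<lambda>j. - (x \<bullet> v j)) ` {..<N})" for x
  proof -
    have "Min ((\<lambda>j. - (x \<bullet> v j)) ` {..<N}) = - m x"
    proof (rule Min_eqI)
      obtain j where "j < N" "m x = x \<bullet> v j" using m_in by blast
      then show "- m x \<in> (\<lambda>j. - (x \<bullet> v j)) ` {..<N}" by auto
    qed (auto simp: m_le)
    then show ?thesis by simp
  qed
  moreover have "continuous_on UNIV (\<lambda>x::'a. - Min ((\<lambda>j. - (x \<bullet> v j)) ` {..<N}))"
    unfolding continuous_on_def using N
    by (intro ballI tendsto_minus tendsto_Min) (auto intro!: tendsto_intros)
  ultimately have cont: "continuous_on (sphere 0 1) m"
    using continuous_on_subset[of UNIV m "sphere 0 1"] by simp
  have "sphere (0::'a) 1 \<noteq> {}" by simp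
  from continuous_attains_inf[OF compact_sphere this cont] obtain u0 where
    u0: "norm u0 = 1" "\<And>u. norm u = 1 \<Longrightarrow> m u0 \<le> m u" by auto
  show thesis
  proof
    have "u0 \<noteq> 0" using u0 by auto
    then obtain j where "j < N" "u0 \<bullet> v j > 0" using positive_spanning by blast
    then show "m u0 > 0" using m_le[of j u0] by simp
    fix x
    show "\<exists>j<N. m u0 * norm x \<le> x \<bullet> v j"
    proof (cases "x = 0")
      case True
      then show ?thesis using N by (auto intro!: exI[of _ 0])
    next
      case False
      define u where "u = x /\<^sub>R norm x"
      have "norm u = 1" using False by (simp add: u_def)
      obtain j where j: "j < N" "m u = u \<bullet> v j" using m_in by blast
      have "m u0 \<le> u \<bullet> v j" using u0(2)[OF \<open>norm u = 1\<close>] j by simp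
      moreover have "x \<bullet> v j = norm x * (u \<bullet> v j)" using False by (simp add: u_def)
      ultimately have "m u0 * norm x \<le> x \<bullet> v j" by (simp add: mult.commute mult_left_mono)
      then show ?thesis using j by blast
    qed
  qed
qed

text \<open>\<open>c\<close> does not depend on \<open>h\<close>, which gives common bounds along
  sequences of support numbers.\<close>

lemma P_subset_cball:
  obtains c where "c > 0" "\<And>h M. (\<And>j. j < N \<Longrightarrow> h j \<le> M) \<Longrightarrow> P h \<subseteq> cball 0 (M / c)"
proof -
  obtain c where c: "c > 0" "\<And>x. \<exists>j<N. c * norm x \<le> x \<bullet> v j" using inner_lower_bound by blast
  show thesis
  proof (rule that[OF c(1)], rule subsetI)
    fix h M x assume h: "\<And>j. j < N \<Longrightarrow> h j \<le> M" and x: "x \<in> P h"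
    obtain j where "j < N" "c * norm x \<le> x \<bullet> v j" using c(2) by blast
    then have "c * norm x \<le> M" using h x by (force simp: mem_P)
    then show "x \<in> cball 0 (M / c)" using c(1) by (simp add: field_simps)
  qed
qed

lemma P_bounded: obtains R where "R > 0" "P h \<subseteq> cball 0 R"
proof -
  obtain c where c: "c > 0" "\<And>h M. (\<And>j. j < N \<Longrightarrow> h j \<le> M) \<Longrightarrow> P h \<subseteq> cball 0 (M / c)"
    using P_subset_cball by blast
  define M where "M = (\<Sum>j<N. \<bar>h j\<bar>) + 1"
  have "h j \<le> M" if "j < N" for j
  proof -
    have "\<bar>h j\<bar> \<le> (\<Sum>j<N. \<bar>h j\<bar>)" using that by (intro member_le_sum) auto
    then show ?thesis by (simp add: M_def)
  qed
  moreover have "M > 0" by (simp add: M_def add_nonneg_pos sum_nonneg)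
  ultimately show thesis using c by (intro that[of "M / c"]) auto
qed

text \<open>Confines those points of the slab whose line meets a given ball, so that the slab
  integrands have bounded support.\<close>

lemma bounded_on_line:
  assumes u: "norm u = 1" and y: "x + t *\<^sub>R u \<in> cball 0 R" and x: "\<bar>x \<bullet> u\<bar> \<le> r"
  shows "norm x \<le> 2 * R + r"
proof -
  have uu: "u \<bullet> u = 1" using u by (simp add: dot_square_norm)
  have "\<bar>(x + t *\<^sub>R u) \<bullet> u\<bar> \<le> norm (x + t *\<^sub>R u) * norm u" by (rule Cauchy_Schwarz_ineq2)
  then have "\<bar>x \<bullet> u + t\<bar> \<le> R" using y u by (simp add: inner_add_left uu)
  then have "\<bar>t\<bar> \<le> R + r" using x by linarith
  moreover have "norm x \<le> norm (x + t *\<^sub>R u) + \<bar>t\<bar>"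
    using norm_triangle_ineq4[of "x + t *\<^sub>R u" "t *\<^sub>R u"] u by simp
  ultimately show ?thesis using y by simp
qed

lemma chord_le_diameter:
  assumes u: "generic u" and "0 \<le> chord h u x" and R: "P h \<subseteq> cball 0 R"
  shows "chord h u x \<le> 2 * R" and "x + exit_time h u x *\<^sub>R u \<in> P h"
proof -
  have a: "x + exit_time h u x *\<^sub>R u \<in> P h" and b: "x + (- exit_time h (- u) x) *\<^sub>R u \<in> P h"
    using assms(2) unfolding line_mem_P[OF u] chord_def by auto
  show "x + exit_time h u x *\<^sub>R u \<in> P h" by (rule a)
  have "(x + exit_time h u x *\<^sub>R u) - (x + (- exit_time h (- u) x) *\<^sub>R u) = chord h u x *\<^sub>R u"
    by (simp add: chord_def scaleR_add_left)
  then have "\<bar>chord h u x\<bar> = norm ((x + exit_time h u x *\<^sub>R u) - (x + (- exit_time h (- u) x) *\<^sub>R u))"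
    using u by (simp add: generic_def)
  also have "\<dots> \<le> norm (x + exit_time h u x *\<^sub>R u) + norm (x + (- exit_time h (- u) x) *\<^sub>R u)"
    by (rule norm_triangle_ineq4)
  also have "\<dots> \<le> R + R" using a b R by (intro add_mono) auto
  finally show "chord h u x \<le> 2 * R" by simp
qed

text \<open>A tie of two crossing times is an affine equation in \<open>x\<close> with normal
  \<open>w\<close>, and \<open>w = 0\<close> would make two facet normals parallel.\<close>

lemma AE_crossing_distinct:
  assumes u: "generic u"
  shows "AE x in lborel. \<forall>i<N. \<forall>j<N. i \<noteq> j \<longrightarrow> crossing h u x i \<noteq> crossing h u x j"
proof -
  have "AE x in lborel. i \<noteq> j \<longrightarrow> crossing h u x i \<noteq> crossing h u x j" if ij: "i < N" "j < N" for i j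
  proof (cases "i = j")
    case False
    define a b where "a = u \<bullet> v i" and "b = u \<bullet> v j"
    have ab: "a \<noteq> 0" "b \<noteq> 0" using u ij by (auto simp: generic_def a_def b_def)
    define w where "w = v i /\<^sub>R a - v j /\<^sub>R b"
    have "w \<noteq> 0"
    proof
      assume "w = 0"
      then have "v j /\<^sub>R b = v i /\<^sub>R a" by (simp add: w_def)
      then have "b *\<^sub>R (v j /\<^sub>R b) = b *\<^sub>R (v i /\<^sub>R a)" by (rule arg_cong)
      then have "v j = (b / a) *\<^sub>R v i" using ab by (simp add: divide_inverse)
      then show False using not_parallel[OF ij False] by blast
    qed
    from AE_lborel_inner_neq[OF this, of "h i / a - h j / b"] show ?thesis
    proof eventually_elim
      fix x assume "x \<bullet> w \<noteq> h i / a - h j / b"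
      moreover have "x \<bullet> w = (x \<bullet> v i) / a - (x \<bullet> v j) / b"
        by (simp add: w_def inner_diff_right divide_inverse mult.commute)
      ultimately show "i \<noteq> j \<longrightarrow> crossing h u x i \<noteq> crossing h u x j"
        by (auto simp: crossing_def a_def b_def diff_divide_distrib)
    qed
  qed simp
  then have "AE x in lborel. \<forall>i\<in>{..<N}. \<forall>j\<in>{..<N}. i \<noteq> j \<longrightarrow> crossing h u x i \<noteq> crossing h u x j"
    by (intro AE_finite_allI) auto
  then show ?thesis by eventually_elim auto
qed

lemma exit_time_uminus_attained:
  assumes "u \<noteq> 0"
  obtains m where "m \<in> up (- u)" "exit_time h (- u) x = - crossing h u x m"
  using exit_time_attained[of "- u" h x] assms by (auto simp: crossing_uminus)

text \<open>Off the null set where two of the crossing times agree, exactly the two facets through the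
  endpoints of the chord are active.\<close>
lemma active_generic:
  assumes u: "generic u" and dist: "\<forall>i<N. \<forall>j<N. i \<noteq> j \<longrightarrow> crossing h u x i \<noteq> crossing h u x j"
    and k: "k \<in> up u" "exit_time h u x = crossing h u x k"
    and m: "m \<in> up (- u)" "exit_time h (- u) x = - crossing h u x m" and i: "i < N"
  shows "x \<in> active h u i \<longleftrightarrow> chord h u x > 0 \<and> (i = k \<or> i = m)"
proof -
  have km: "k < N" "m < N" "k \<noteq> m" using k(1) m(1) by (auto simp: up_def)
  have ch: "chord h u x = crossing h u x k - crossing h u x m" using k m by (simp add: chord_def)
  have ne: "chord h u x \<noteq> 0" using dist km ch by auto
  have act: "x \<in> active h u i \<longleftrightarrow> crossing h u x m \<le> crossing h u x i \<and> crossing h u x i \<le> crossing h u x k"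
    using active_iff[OF u] k m by simp
  show ?thesis
  proof
    assume a: "x \<in> active h u i"
    then have pos: "chord h u x > 0" using active_chord_nonneg[OF u a] ne by linarith
    have "i \<in> up u \<or> i \<in> up (- u)" using u i by (auto simp: generic_def up_def)
    then show "chord h u x > 0 \<and> (i = k \<or> i = m)"
    proof
      assume "i \<in> up u"
      then have "crossing h u x k \<le> crossing h u x i" using exit_time_le[of i u h x] k by simp
      then have "crossing h u x k = crossing h u x i" using a act by simp
      then show ?thesis using dist i km pos by blast
    next
      assume "i \<in> up (- u)"
      then have "- crossing h u x m \<le> - crossing h u x i" using exit_time_le[of i "- u" h x] m by (simp add: crossing_uminus)
      then have "crossing h u x m = crossing h u x i" using a act by simp
      then show ?thesis using dist i km pos by blast
    qed
  next
    assume "chord h u x > 0 \<and> (i = k \<or> i = m)"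
    then show "x \<in> active h u i" unfolding act using ch by auto
  qed
qed

lemma exit_time_tendsto:
  assumes "u \<noteq> 0" "\<And>j. j < N \<Longrightarrow> ((\<lambda>k. H k j) \<longlongrightarrow> h j) F" "(X \<longlongrightarrow> x) F"
  shows "((\<lambda>k. exit_time (H k) u (X k)) \<longlongrightarrow> exit_time h u x) F"
  unfolding exit_time_def
  by (rule tendsto_Min) (use assms up_nonempty in \<open>auto simp: crossing_def up_def intro!: tendsto_intros\<close>)

lemma chord_tendsto:
  assumes "u \<noteq> 0" "\<And>j. j < N \<Longrightarrow> ((\<lambda>k. H k j) \<longlongrightarrow> h j) F" "(X \<longlongrightarrow> x) F"
  shows "((\<lambda>k. chord (H k) u (X k)) \<longlongrightarrow> chord h u x) F"
  unfolding chord_def by (intro tendsto_add exit_time_tendsto) (use assms in auto)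

text \<open>Without ties, being active is decided by finitely many strict inequalities, which
  persist under small changes of \<open>h\<close>.\<close>

lemma active_eventually:
  assumes u: "generic u" and dist: "\<forall>i<N. \<forall>j<N. i \<noteq> j \<longrightarrow> crossing h u x i \<noteq> crossing h u x j"
    and H: "\<And>j. j < N \<Longrightarrow> ((\<lambda>k. H k j) \<longlongrightarrow> h j) F" and i: "i < N"
  shows "\<forall>\<^sub>F k in F. x \<in> active (H k) u i \<longleftrightarrow> x \<in> active h u i"
proof -
  have mem: "x \<in> active h' u i \<longleftrightarrow> (\<forall>j\<in>{..<N} - {i}. (crossing h' u x i - crossing h' u x j) * (u \<bullet> v j) \<le> 0)" for h'
  proof -
    have *: "(x + crossing h' u x i *\<^sub>R u) \<bullet> v j \<le> h' j \<longleftrightarrow> (crossing h' u x i - crossing h' u x j) * (u \<bullet> v j) \<le> 0" if "j < N" for j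
    proof -
      have "crossing h' u x j * (u \<bullet> v j) = h' j - x \<bullet> v j" using that u by (simp add: crossing_def generic_def)
      then show ?thesis unfolding inner_add_left inner_scaleR_left left_diff_distrib by (smt (verit))
    qed
    show ?thesis unfolding active_def mem_P mem_Collect_eq using * by auto
  qed
  have ev: "\<forall>\<^sub>F k in F. (crossing (H k) u x i - crossing (H k) u x j) * (u \<bullet> v j) \<le> 0 \<longleftrightarrow> (crossing h u x i - crossing h u x j) * (u \<bullet> v j) \<le> 0"
    if j: "j \<in> {..<N} - {i}" for j
  proof -
    have lim: "((\<lambda>k. (crossing (H k) u x i - crossing (H k) u x j) * (u \<bullet> v j)) \<longlongrightarrow> (crossing h u x i - crossing h u x j) * (u \<bullet> v j)) F"
      unfolding crossing_def using j i u H by (intro tendsto_intros) (auto simp: generic_def)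
    have "(crossing h u x i - crossing h u x j) * (u \<bullet> v j) \<noteq> 0"
      using dist i j u by (auto simp: generic_def)
    then consider "(crossing h u x i - crossing h u x j) * (u \<bullet> v j) < 0" | "(crossing h u x i - crossing h u x j) * (u \<bullet> v j) > 0"
      by linarith
    then show ?thesis
    proof cases
      case 1
      show ?thesis using order_tendstoD(2)[OF lim 1] by eventually_elim (use 1 in auto)
    next
      case 2
      show ?thesis using order_tendstoD(1)[OF lim 2] by eventually_elim (use 2 in auto)
    qed
  qed
  have "\<forall>\<^sub>F k in F. \<forall>j\<in>{..<N} - {i}. (crossing (H k) u x i - crossing (H k) u x j) * (u \<bullet> v j) \<le> 0 \<longleftrightarrow> (crossing h u x i - crossing h u x j) * (u \<bullet> v j) \<le> 0"
    by (rule eventually_ball_finite) (use ev in auto)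
  then show ?thesis by eventually_elim (auto simp: mem)
qed

end

section \<open>Flux of a chord weight through a facet\<close>

lemma integrable_lborel_bounded_support:
  fixes f :: "'a::euclidean_space \<Rightarrow> real"
  assumes "f \<in> borel_measurable borel" "\<And>x. \<bar>f x\<bar> \<le> M * indicator (cball 0 C) x"
  shows "integrable lborel f"
proof (rule Bochner_Integration.integrable_bound)
  show "integrable lborel (\<lambda>x::'a. M * indicator (cball 0 C) x)"
    using emeasure_lborel_cball_finite[of "0::'a" C] by (intro integrable_mult_right integrable_real_indicator) auto
qed (use assms in \<open>auto intro!: AE_I2 intro: order_trans[OF _ abs_ge_self]\<close>)

text \<open>Continuity is asked only at positive arguments, since the weights below may jump at 0;
  boundedness near 0 makes the slab integrals finite.\<close>

definition chord_weight :: "(real \<Rightarrow> real) \<Rightarrow> bool" where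
  "chord_weight g \<longleftrightarrow> g \<in> borel_measurable borel \<and> (\<forall>s. 0 \<le> g s) \<and> continuous_on {0<..} g \<and>
     (\<forall>L. \<exists>M. \<forall>s. 0 \<le> s \<longrightarrow> s \<le> L \<longrightarrow> g s \<le> M)"

text \<open>Vanishing at nonpositive arguments makes lines that miss the polytope contribute
  nothing, and the Lipschitz bound dominates difference quotients.\<close>

definition weight_primitive :: "(real \<Rightarrow> real) \<Rightarrow> (real \<Rightarrow> real) \<Rightarrow> bool" where
  "weight_primitive G g \<longleftrightarrow> G \<in> borel_measurable borel \<and> (\<forall>s\<le>0. G s = 0) \<and> (\<forall>s. 0 \<le> G s) \<and> (\<forall>s>0. (G has_real_derivative g s) (at s)) \<and>
     (\<forall>L. \<exists>M. \<forall>s t. s \<le> L \<longrightarrow> t \<le> L \<longrightarrow> \<bar>G s - G t\<bar> \<le> M * \<bar>s - t\<bar>)"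

context facet_normals begin

text \<open>For a unit vector \<open>u\<close> every line of direction \<open>u\<close> meets it in
  an interval of length 1, so integrating a function constant along \<open>u\<close> over it means
  integrating over the space of lines.\<close>

definition slab :: "'a \<Rightarrow> 'a set" where
  "slab u = {x. 0 \<le> x \<bullet> u \<and> x \<bullet> u < 1}"

definition facet_flux :: "(real \<Rightarrow> real) \<Rightarrow> (nat \<Rightarrow> real) \<Rightarrow> 'a \<Rightarrow> nat \<Rightarrow> ennreal" where
  "facet_flux g h u i = (\<integral>\<^sup>+ z. ennreal (g (chord h u z)) * indicator (P h) z \<partial>hyp (v i) (h i))"

definition slab_flux :: "(real \<Rightarrow> real) \<Rightarrow> (nat \<Rightarrow> real) \<Rightarrow> 'a \<Rightarrow> nat \<Rightarrow> real" where
  "slab_flux g h u i = (LINT x|lborel. g (chord h u x) * indicator (active h u i \<inter> slab u) x)"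

lemma borel_slab [measurable]: "slab u \<in> sets borel"
  unfolding slab_def by measurable

lemma AE_hyp: "AE y in hyp w c. y \<bullet> w = c" for w :: 'a
  unfolding hyp_def by (subst AE_density) (auto simp: indicator_def)

lemma facet_flux_eq_nn_integral_slab:
  assumes u: "generic u" and i: "i < N" and [measurable]: "g \<in> borel_measurable borel"
  shows "ennreal (\<kappa> * \<bar>u \<bullet> v i\<bar>) * facet_flux g h u i
    = (\<integral>\<^sup>+ x. ennreal (g (chord h u x)) * indicator (active h u i) x * indicator (slab u) x \<partial>lborel)"
proof -
  have ui: "u \<bullet> v i \<noteq> 0" "norm u = 1" "u \<noteq> 0" using u i by (auto simp: generic_def)
  define f where "f = (\<lambda>x. ennreal (g (chord h u x)) * indicator (active h u i) x)"
  have [measurable]: "f \<in> borel_measurable borel" unfolding f_def by measurable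
  have inv: "f (x + s *\<^sub>R u) = f x" for x s
    using chord_shift[OF ui(3), of h x s] active_shift[OF i ui(1), of x s h] by (simp add: f_def indicator_def)
  have "facet_flux g h u i = (\<integral>\<^sup>+ x. f x \<partial>hyp (v i) (h i))"
    unfolding facet_flux_def
  proof (rule nn_integral_cong_AE)
    \<comment> \<open>On the facet hyperplane the crossing time is 0, so being active there means
      lying in \<open>P h\<close>.\<close>
    show "AE z in hyp (v i) (h i). ennreal (g (chord h u z)) * indicator (P h) z = f z"
      using AE_hyp[of "v i" "h i"]
      by eventually_elim (simp add: f_def active_def crossing_def indicator_def)
  qed
  then show ?thesis
    using nn_integral_hyp_projected[OF \<open>f \<in> _\<close> inv ui(1) norm_v[OF i] ui(2), of "h i"]
    by (simp add: f_def slab_def)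
qed

lemma norm_le_of_active:
  assumes u: "generic u" and R: "P h \<subseteq> cball 0 R" and x: "x \<in> active h u i" "x \<in> slab u"
  shows "norm x \<le> 2 * R + 1"
proof (rule bounded_on_line)
  show "x + crossing h u x i *\<^sub>R u \<in> cball 0 R" using x(1) R by (auto simp: active_def)
qed (use u x(2) in \<open>auto simp: generic_def slab_def\<close>)

lemma slab_flux_integrand_bound:
  fixes g :: "real \<Rightarrow> real"
  assumes u: "generic u" and R: "P h \<subseteq> cball 0 R" and "0 \<le> R"
    and g: "\<And>s. 0 \<le> g s" and M: "\<And>s. 0 \<le> s \<Longrightarrow> s \<le> 2 * R \<Longrightarrow> g s \<le> M"
  shows "\<bar>g (chord h u x) * indicator (active h u i \<inter> slab u) x\<bar> \<le> M * indicator (cball 0 (2 * R + 1)) x"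
proof (cases "x \<in> active h u i \<inter> slab u")
  case True
  then have "norm x \<le> 2 * R + 1" using norm_le_of_active[OF u R] by blast
  moreover have "0 \<le> chord h u x" using True active_chord_nonneg[OF u] by blast
  moreover from this have "chord h u x \<le> 2 * R" by (rule chord_le_diameter(1)[OF u _ R])
  ultimately have "g (chord h u x) \<le> M" by (intro M)
  moreover have "indicator (active h u i \<inter> slab u) x = (1::real)" using True by (rule indicator_simps(1))
  moreover have "indicator (cball 0 (2 * R + 1)) x = (1::real)"
    using \<open>norm x \<le> 2 * R + 1\<close> by (intro indicator_simps(1)) simp
  ultimately show ?thesis using g[of "chord h u x"] by (simp only: mult_1_right abs_of_nonneg)
next
  case False
  have "0 \<le> M" using M[of 0] g[of 0] \<open>0 \<le> R\<close> by auto
  then show ?thesis using False by (auto simp: indicator_def)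
qed

lemma integrable_slab_flux:
  assumes u: "generic u" and g: "chord_weight g"
  shows "integrable lborel (\<lambda>x. g (chord h u x) * indicator (active h u i \<inter> slab u) x)"
proof -
  have [measurable]: "g \<in> borel_measurable borel" using g by (simp add: chord_weight_def)
  obtain R where R: "R > 0" "P h \<subseteq> cball 0 R" using P_bounded by blast
  obtain M where M: "\<And>s. 0 \<le> s \<Longrightarrow> s \<le> 2 * R \<Longrightarrow> g s \<le> M"
    using g unfolding chord_weight_def by blast
  show ?thesis
    by (rule integrable_lborel_bounded_support[OF _ slab_flux_integrand_bound[OF u R(2) less_imp_le[OF R(1)] _ M]])
       (use g in \<open>auto simp: chord_weight_def\<close>)
qed

lemma slab_flux_nonneg: "chord_weight g \<Longrightarrow> 0 \<le> slab_flux g h u i"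
  unfolding slab_flux_def by (intro integral_nonneg_AE AE_I2) (auto simp: chord_weight_def)

lemma facet_flux_eq_slab_flux:
  assumes u: "generic u" and i: "i < N" and g: "chord_weight g"
  shows "facet_flux g h u i = ennreal (slab_flux g h u i / (\<kappa> * \<bar>u \<bullet> v i\<bar>))"
proof -
  have [measurable]: "g \<in> borel_measurable borel" using g by (simp add: chord_weight_def)
  define a where "a = \<kappa> * \<bar>u \<bullet> v i\<bar>"
  have a: "a > 0" using u i \<kappa>_pos by (simp add: a_def generic_def)
  have "ennreal a * facet_flux g h u i
     = (\<integral>\<^sup>+ x. ennreal (g (chord h u x) * indicator (active h u i \<inter> slab u) x) \<partial>lborel)"
    unfolding a_def facet_flux_eq_nn_integral_slab[OF u i \<open>g \<in> _\<close>]
    by (intro nn_integral_cong) (auto simp: indicator_def)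
  also have "\<dots> = ennreal (slab_flux g h u i)"
    unfolding slab_flux_def
    by (rule nn_integral_eq_integral[OF integrable_slab_flux[OF u g]]) (use g in \<open>auto simp: chord_weight_def\<close>)
  finally have "ennreal (1/a) * (ennreal a * facet_flux g h u i) = ennreal (1/a) * ennreal (slab_flux g h u i)"
    by simp
  then show ?thesis
    using a unfolding a_def[symmetric] by (simp add: mult.assoc[symmetric] ennreal_mult'[symmetric])
qed

lemma P_uniformly_bounded:
  assumes H: "\<And>j. j < N \<Longrightarrow> (\<lambda>k. H k j) \<longlonglongrightarrow> h j"
  obtains R where "R > 0" "\<And>k. P (H k) \<subseteq> cball 0 R"
proof -
  obtain c where c: "c > 0" "\<And>h M. (\<And>j. j < N \<Longrightarrow> h j \<le> M) \<Longrightarrow> P h \<subseteq> cball 0 (M / c)"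
    using P_subset_cball by blast
  have "\<exists>B. \<forall>k. \<bar>H k j\<bar> \<le> B" if "j < N" for j
    using convergent_imp_Bseq[OF convergentI[OF H[OF that]]] by (auto simp: Bseq_def)
  then obtain B where B: "\<And>j k. j < N \<Longrightarrow> \<bar>H k j\<bar> \<le> B j" by metis
  define M where "M = (\<Sum>j<N. \<bar>B j\<bar>) + 1"
  have "H k j \<le> M" if "j < N" for k j
  proof -
    have "\<bar>B j\<bar> \<le> (\<Sum>j<N. \<bar>B j\<bar>)" using that by (intro member_le_sum) auto
    then show ?thesis using B[OF that, of k] by (simp add: M_def)
  qed
  moreover have "M > 0" by (simp add: M_def add_nonneg_pos sum_nonneg)
  ultimately show thesis using c by (intro that[of "M / c"]) auto
qed

text \<open>Dominated convergence: off ties, activity of a line is eventually constant, and an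
  active line has a positive chord, where \<open>g\<close> is continuous.\<close>

lemma slab_flux_tendsto:
  assumes u: "generic u" and g: "chord_weight g" and i: "i < N"
    and H: "\<And>j. j < N \<Longrightarrow> (\<lambda>k. H k j) \<longlonglongrightarrow> h j"
  shows "(\<lambda>k. slab_flux g (H k) u i) \<longlonglongrightarrow> slab_flux g h u i"
proof -
  have [measurable]: "g \<in> borel_measurable borel" and g0: "\<And>s. 0 \<le> g s"
    using g by (auto simp: chord_weight_def)
  have u0: "u \<noteq> 0" by (rule generic_nonzero[OF u])
  obtain R where R: "R > 0" "\<And>k. P (H k) \<subseteq> cball 0 R" using P_uniformly_bounded[of H h] H by blast
  obtain M where M: "\<And>s. 0 \<le> s \<Longrightarrow> s \<le> 2 * R \<Longrightarrow> g s \<le> M"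
    using g unfolding chord_weight_def by blast
  show ?thesis
    unfolding slab_flux_def
  proof (rule integral_dominated_convergence[where w="\<lambda>x. M * indicator (cball 0 (2 * R + 1)) x"])
    show "integrable lborel (\<lambda>x::'a. M * indicator (cball 0 (2 * R + 1)) x)"
      using M[of 0] g0[of 0] R by (intro integrable_lborel_bounded_support[where M=M]) (auto simp: indicator_def)
    show "AE x in lborel. norm (g (chord (H k) u x) * indicator (active (H k) u i \<inter> slab u) x)
        \<le> M * indicator (cball 0 (2 * R + 1)) x" for k
      using slab_flux_integrand_bound[OF u R(2) less_imp_le[OF R(1)] g0 M] by (intro AE_I2) (simp only: real_norm_def)
    show "AE x in lborel. (\<lambda>k. g (chord (H k) u x) * indicator (active (H k) u i \<inter> slab u) x)
        \<longlonglongrightarrow> g (chord h u x) * indicator (active h u i \<inter> slab u) x"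
      using AE_crossing_distinct[OF u, of h]
    proof eventually_elim
      fix x assume dist: "\<forall>i<N. \<forall>j<N. i \<noteq> j \<longrightarrow> crossing h u x i \<noteq> crossing h u x j"
      have ev: "\<forall>\<^sub>F k in sequentially. x \<in> active (H k) u i \<longleftrightarrow> x \<in> active h u i"
        by (rule active_eventually[OF u dist H i])
      show "(\<lambda>k. g (chord (H k) u x) * indicator (active (H k) u i \<inter> slab u) x)
        \<longlonglongrightarrow> g (chord h u x) * indicator (active h u i \<inter> slab u) x"
      proof (cases "x \<in> active h u i")
        case True
        obtain k where k: "k \<in> up u" "exit_time h u x = crossing h u x k"
          using exit_time_attained[OF u0] by blast
        obtain m where m: "m \<in> up (- u)" "exit_time h (- u) x = - crossing h u x m"
          using exit_time_uminus_attained[OF u0] by blast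
        have pos: "chord h u x > 0" using active_generic[OF u dist k m i] True by simp
        have "isCont g (chord h u x)"
          using g pos by (simp add: chord_weight_def continuous_on_eq_continuous_at)
        then have "(\<lambda>k. g (chord (H k) u x)) \<longlonglongrightarrow> g (chord h u x)"
          by (rule isCont_tendsto_compose) (rule chord_tendsto[OF u0 H tendsto_const])
        then have "(\<lambda>k. g (chord (H k) u x) * indicator (active h u i \<inter> slab u) x)
            \<longlonglongrightarrow> g (chord h u x) * indicator (active h u i \<inter> slab u) x"
          by (intro tendsto_intros)
        then show ?thesis
          by (rule Lim_transform_eventually) (use ev in eventually_elim, simp add: indicator_def)
      next
        case False
        have "\<forall>\<^sub>F k in sequentially. 0 = g (chord (H k) u x) * indicator (active (H k) u i \<inter> slab u) x"
          using ev by eventually_elim (use False in \<open>simp add: indicator_def\<close>)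
        then show ?thesis using False by (intro Lim_transform_eventually[OF tendsto_const]) (auto simp: indicator_def)
      qed
    qed
  qed measurable
qed

section \<open>First variation of the chord length\<close>

lemma exit_time_lipschitz:
  assumes "u \<noteq> 0" and C: "\<And>j. j < N \<Longrightarrow> u \<bullet> v j \<noteq> 0 \<Longrightarrow> 1 / \<bar>u \<bullet> v j\<bar> \<le> C"
  shows "exit_time h u (x + e) \<le> exit_time h u x + C * norm e"
proof -
  obtain j where j: "j \<in> up u" "exit_time h u x = crossing h u x j" using exit_time_attained[OF assms(1)] by blast
  then have jN: "j < N" "u \<bullet> v j > 0" by (auto simp: up_def)
  have "- (e \<bullet> v j) \<le> norm e"
    using Cauchy_Schwarz_ineq2[of e "v j"] norm_v[OF jN(1)] by simp
  then have "- (e \<bullet> v j) * (1 / (u \<bullet> v j)) \<le> norm e * C"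
    using C[OF jN(1)] jN(2) by (intro mult_mono) auto
  moreover have "crossing h u (x + e) j = crossing h u x j + - (e \<bullet> v j) * (1 / (u \<bullet> v j))"
    using jN(2) by (simp add: crossing_def inner_add_left field_simps)
  ultimately show ?thesis using exit_time_le[OF j(1), of h "x + e"] j(2) by (simp add: mult.commute)
qed

lemma chord_lipschitz:
  assumes u: "generic u"
  obtains K where "K \<ge> 0" "\<And>h x e. \<bar>chord h u (x + e) - chord h u x\<bar> \<le> K * norm e"
proof -
  define C where "C = (\<Sum>j<N. 1 / \<bar>u \<bullet> v j\<bar>)"
  have C: "1 / \<bar>u \<bullet> v j\<bar> \<le> C" if "j < N" for j
    unfolding C_def using that by (intro member_le_sum) auto
  have le: "exit_time h w (x + e) \<le> exit_time h w x + C * norm e" if "w = u \<or> w = - u" for h w x e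
    using that u C by (intro exit_time_lipschitz) (auto simp: generic_def)
  have le2: "chord h u (x + e) \<le> chord h u x + 2 * C * norm e" for h x e
    using le[of u h x e] le[of "- u" h x e] by (simp add: chord_def algebra_simps)
  have "\<bar>chord h u (x + e) - chord h u x\<bar> \<le> 2 * C * norm e" for h x e
    using le2[of h x e] le2[of h "x + e" "- e"] by (simp add: abs_le_iff)
  moreover have "C \<ge> 0" unfolding C_def by (intro sum_nonneg) auto
  ultimately show thesis by (intro that[of "2 * C"]) auto
qed

text \<open>If the earliest crossing is unique, the same index attains the minimum at all nearby
  points, so along \<open>e\<close> the exit time is locally affine with the slope of that one
  crossing time.\<close>

lemma exit_time_directional:
  assumes u: "generic u" and dist: "\<forall>i<N. \<forall>j<N. i \<noteq> j \<longrightarrow> crossing h u x i \<noteq> crossing h u x j"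
    and k: "k \<in> up u" "exit_time h u x = crossing h u x k"
    and t: "t \<longlonglongrightarrow> 0"
  shows "\<forall>\<^sub>F n in sequentially. exit_time h u (x + t n *\<^sub>R e) = exit_time h u x - t n * ((e \<bullet> v k) / (u \<bullet> v k))"
proof -
  have kN: "k < N" "u \<bullet> v k > 0" using k by (auto simp: up_def)
  have ev: "\<forall>\<^sub>F n in sequentially. crossing h u (x + t n *\<^sub>R e) k \<le> crossing h u (x + t n *\<^sub>R e) j"
    if j: "j \<in> up u" for j
  proof (cases "j = k")
    case False
    have jN: "j < N" "u \<bullet> v j > 0" using j by (auto simp: up_def)
    have "crossing h u x k < crossing h u x j"
      using exit_time_le[OF j, of h x] k dist jN kN False by (metis order_le_less)
    moreover have "(\<lambda>n. crossing h u (x + t n *\<^sub>R e) j - crossing h u (x + t n *\<^sub>R e) k)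
        \<longlonglongrightarrow> crossing h u (x + 0 *\<^sub>R e) j - crossing h u (x + 0 *\<^sub>R e) k"
      unfolding crossing_def using jN kN t by (intro tendsto_intros) auto
    ultimately have "\<forall>\<^sub>F n in sequentially. 0 < crossing h u (x + t n *\<^sub>R e) j - crossing h u (x + t n *\<^sub>R e) k"
      by (intro order_tendstoD(1)) auto
    then show ?thesis by eventually_elim simp
  qed simp
  have "\<forall>\<^sub>F n in sequentially. \<forall>j\<in>up u. crossing h u (x + t n *\<^sub>R e) k \<le> crossing h u (x + t n *\<^sub>R e) j"
    by (rule eventually_ball_finite) (use ev in auto)
  then show ?thesis
  proof eventually_elim
    fix n assume *: "\<forall>j\<in>up u. crossing h u (x + t n *\<^sub>R e) k \<le> crossing h u (x + t n *\<^sub>R e) j"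
    have "exit_time h u (x + t n *\<^sub>R e) = crossing h u (x + t n *\<^sub>R e) k"
      unfolding exit_time_def by (rule Min_eqI) (use * k in auto)
    then show "exit_time h u (x + t n *\<^sub>R e) = exit_time h u x - t n * ((e \<bullet> v k) / (u \<bullet> v k))"
      using k kN by (simp add: crossing_def inner_add_left field_simps)
  qed
qed

text \<open>The integral of \<open>G (chord h u x)\<close> over one period of the direction \<open>u\<close> is invariant under
  translations; its derivative along \<open>e\<close> is the \<open>e\<close>-component of the total flux.\<close>
lemma slab_flux_balance:
  assumes u: "generic u" and g: "chord_weight g" and G: "weight_primitive G g"
  shows "(\<Sum>i<N. ((e \<bullet> v i) / \<bar>u \<bullet> v i\<bar>) * slab_flux g h u i) = 0"
proof -
  have [measurable]: "g \<in> borel_measurable borel" "G \<in> borel_measurable borel"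
    and G0: "\<And>s. s \<le> 0 \<Longrightarrow> G s = 0" "\<And>s. 0 \<le> G s"
    and G': "\<And>s. s > 0 \<Longrightarrow> (G has_real_derivative g s) (at s)"
    using g G by (auto simp: chord_weight_def weight_primitive_def)
  have u0: "u \<noteq> 0" and uu: "u \<bullet> u = 1" and nu: "norm u = 1"
    using u by (auto simp: generic_def dot_square_norm)
  obtain R where R: "R > 0" "P h \<subseteq> cball 0 R" using P_bounded by blast
  obtain M' where M': "\<And>s t. s \<le> 2 * R \<Longrightarrow> t \<le> 2 * R \<Longrightarrow> \<bar>G s - G t\<bar> \<le> M' * \<bar>s - t\<bar>"
    using G unfolding weight_primitive_def by meson
  define M where "M = \<bar>M'\<bar>"
  have M: "\<bar>G s - G t\<bar> \<le> M * \<bar>s - t\<bar>" if "s \<le> 2 * R" "t \<le> 2 * R" for s t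
    by (rule order_trans[OF M'[OF that] mult_right_mono]) (simp_all add: M_def)
  have M0: "M \<ge> 0" by (simp add: M_def)
  obtain K where K: "K \<ge> 0" "\<And>h x e. \<bar>chord h u (x + e) - chord h u x\<bar> \<le> K * norm e"
    using chord_lipschitz[OF u] by blast
  define \<Gamma> where "\<Gamma> = (\<lambda>x. G (chord h u x))"
  have [measurable]: "\<Gamma> \<in> borel_measurable borel" unfolding \<Gamma>_def by measurable
  have \<Gamma>0: "0 \<le> \<Gamma> x" for x by (simp add: \<Gamma>_def G0)
  have chord_le: "chord h u x \<le> 2 * R" for x
    using chord_le_diameter(1)[OF u _ R(2), of x] R(1) by (cases "0 \<le> chord h u x") auto
  have supp: "norm x \<le> 2 * (R + norm a) + 1" if "chord h u (x + a) > 0" "x \<in> slab u" for x a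
  proof (rule bounded_on_line[OF nu])
    have "(x + a) + exit_time h u (x + a) *\<^sub>R u \<in> P h"
      using chord_le_diameter(2)[OF u _ R(2), of "x + a"] that by simp
    then have "norm ((x + a) + exit_time h u (x + a) *\<^sub>R u) \<le> R" using R(2) by auto
    moreover have "norm (x + exit_time h u (x + a) *\<^sub>R u) \<le> norm ((x + a) + exit_time h u (x + a) *\<^sub>R u) + norm a"
      using norm_triangle_ineq4[of "(x + a) + exit_time h u (x + a) *\<^sub>R u" a] by (simp add: algebra_simps)
    ultimately show "x + exit_time h u (x + a) *\<^sub>R u \<in> cball 0 (R + norm a)" by simp
  qed (use that in \<open>auto simp: slab_def\<close>)
  have int_\<Gamma>: "integrable lborel (\<lambda>x. \<Gamma> (x + a) * indicator (slab u) x)" for a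
  proof (rule integrable_lborel_bounded_support)
    fix x
    show "\<bar>\<Gamma> (x + a) * indicator (slab u) x\<bar> \<le> (M * (2 * R)) * indicator (cball 0 (2 * (R + norm a) + 1)) x"
    proof (cases "chord h u (x + a) > 0 \<and> x \<in> slab u")
      case True
      have "\<bar>G (chord h u (x + a)) - G 0\<bar> \<le> M * \<bar>chord h u (x + a) - 0\<bar>"
        using chord_le R(1) by (intro M) auto
      also have "\<dots> \<le> M * (2 * R)" using True chord_le[of "x + a"] M0 by (intro mult_left_mono) auto
      finally show ?thesis using True supp[of x a] G0 by (simp add: \<Gamma>_def)
    next
      case False
      then have eq: "\<Gamma> (x + a) * indicator (slab u) x = 0" by (auto simp: \<Gamma>_def G0 indicator_def)
      show ?thesis unfolding eq using M0 R(1) by simp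
    qed
  qed measurable
  \<comment> \<open>Translation moves the slab along with the integrand. Since
    \<open>\<Gamma>\<close> is constant along \<open>u\<close>, the shifted slab may be replaced by
    the original one.\<close>
  have transl: "(LINT x|lborel. \<Gamma> (x + a) * indicator (slab u) x) = (LINT x|lborel. \<Gamma> x * indicator (slab u) x)" for a
  proof -
    have "(\<integral>\<^sup>+ x. ennreal (\<Gamma> (x + a) * indicator (slab u) x) \<partial>lborel)
        = (\<integral>\<^sup>+ x. ennreal (\<Gamma> (x + a)) * indicator {x. a \<bullet> u \<le> x \<bullet> u \<and> x \<bullet> u < a \<bullet> u + 1} (x + a) \<partial>lborel)"
      by (intro nn_integral_cong) (auto simp: indicator_def slab_def inner_add_left)
    also have "\<dots> = (\<integral>\<^sup>+ x. ennreal (\<Gamma> x) * indicator {x. a \<bullet> u \<le> x \<bullet> u \<and> x \<bullet> u < a \<bullet> u + 1} x \<partial>lborel)"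
      by (rule nn_integral_lborel_translate[where g="\<lambda>x. ennreal (\<Gamma> x) * indicator {x. a \<bullet> u \<le> x \<bullet> u \<and> x \<bullet> u < a \<bullet> u + 1} x"]) measurable
    also have "\<dots> = (\<integral>\<^sup>+ x. ennreal (\<Gamma> x) * indicator {x. 0 \<le> x \<bullet> u \<and> x \<bullet> u < 0 + 1} x \<partial>lborel)"
      using nn_integral_invariant_slabs[of "\<lambda>x. ennreal (\<Gamma> x)" u u u "a \<bullet> u" 0] chord_shift[OF u0]
      by (simp add: uu \<Gamma>_def)
    also have "\<dots> = (\<integral>\<^sup>+ x. ennreal (\<Gamma> x * indicator (slab u) x) \<partial>lborel)"
      by (intro nn_integral_cong) (auto simp: indicator_def slab_def)
    finally have "(\<integral>\<^sup>+ x. ennreal (\<Gamma> (x + a) * indicator (slab u) x) \<partial>lborel)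
      = (\<integral>\<^sup>+ x. ennreal (\<Gamma> x * indicator (slab u) x) \<partial>lborel)" .
    then show ?thesis
      by (subst (1 2) integral_eq_nn_integral) (auto simp: \<Gamma>0)
  qed
  define t where "t = (\<lambda>n. 1 / real (Suc n))"
  have t: "t \<longlonglongrightarrow> 0" unfolding t_def by (rule LIMSEQ_Suc[OF lim_1_over_n])
  have t0: "t n > 0" "t n \<le> 1" for n by (auto simp: t_def)
  \<comment> \<open>Off ties and for a positive chord, this is minus the derivative of the chord
    length along \<open>e\<close>, because only the entry and exit facets are active.\<close>
  define D where "D = (\<lambda>x. \<Sum>i<N. ((e \<bullet> v i) / \<bar>u \<bullet> v i\<bar>) * indicator (active h u i) x)"
  define \<Phi> where "\<Phi> = (\<lambda>n x. (\<Gamma> (x + t n *\<^sub>R e) - \<Gamma> x) / t n * indicator (slab u) x)"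
  have \<Phi>_bound: "\<bar>\<Phi> n x\<bar> \<le> (M * (K * norm e)) * indicator (cball 0 (2 * (R + norm e) + 1)) x" for n x
  proof (cases "x \<in> slab u \<and> (chord h u x > 0 \<or> chord h u (x + t n *\<^sub>R e) > 0)")
    case True
    have "norm (t n *\<^sub>R e) \<le> norm e" using t0[of n] by (simp add: mult_left_le_one_le)
    moreover have "norm x \<le> 2 * (R + norm (0::'a)) + 1 \<or> norm x \<le> 2 * (R + norm (t n *\<^sub>R e)) + 1"
      using True supp[of x 0] supp[of x "t n *\<^sub>R e"] by (metis add_0_right)
    ultimately have "norm x \<le> 2 * (R + norm e) + 1"
      using norm_ge_zero[of e] unfolding norm_zero by (smt (verit))
    moreover have "\<bar>\<Gamma> (x + t n *\<^sub>R e) - \<Gamma> x\<bar> \<le> M * (K * norm (t n *\<^sub>R e))"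
      unfolding \<Gamma>_def
      by (rule order_trans[OF M[OF chord_le chord_le] mult_left_mono[OF K(2) M0]])
    then have "\<bar>(\<Gamma> (x + t n *\<^sub>R e) - \<Gamma> x) / t n\<bar> \<le> M * (K * norm e)"
      using t0[of n] by (simp add: field_simps)
    ultimately show ?thesis using True by (simp add: \<Phi>_def)
  next
    case False
    then have "\<Phi> n x = 0" by (auto simp: \<Phi>_def \<Gamma>_def G0 indicator_def not_less)
    then show ?thesis using M0 K(1) by simp
  qed
  \<comment> \<open>By invariance every difference quotient has integral 0; the integral of the
    limit is the asserted sum up to sign.\<close>
  have "(\<lambda>n. LINT x|lborel. \<Phi> n x) \<longlonglongrightarrow> (LINT x|lborel. - g (chord h u x) * D x * indicator (slab u) x)"
  proof (rule integral_dominated_convergence[where w="\<lambda>x. (M * (K * norm e)) * indicator (cball 0 (2 * (R + norm e) + 1)) x"])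
    show "integrable lborel (\<lambda>x::'a. (M * (K * norm e)) * indicator (cball 0 (2 * (R + norm e) + 1)) x)"
      using M0 K(1) by (intro integrable_lborel_bounded_support[where M="M * (K * norm e)"]) (auto simp: indicator_def)
    show "AE x in lborel. norm (\<Phi> n x) \<le> (M * (K * norm e)) * indicator (cball 0 (2 * (R + norm e) + 1)) x" for n
      using \<Phi>_bound by (intro AE_I2) (simp only: real_norm_def)
    show "AE x in lborel. (\<lambda>n. \<Phi> n x) \<longlonglongrightarrow> - g (chord h u x) * D x * indicator (slab u) x"
      using AE_crossing_distinct[OF u, of h]
    proof eventually_elim
      fix x assume dist: "\<forall>i<N. \<forall>j<N. i \<noteq> j \<longrightarrow> crossing h u x i \<noteq> crossing h u x j"
      obtain k where k: "k \<in> up u" "exit_time h u x = crossing h u x k"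
        using exit_time_attained[OF u0] by blast
      obtain m where m: "m \<in> up (- u)" "exit_time h (- u) x = - crossing h u x m"
        using exit_time_uminus_attained[OF u0] by blast
      have km: "k < N" "m < N" "k \<noteq> m" "u \<bullet> v k > 0" "u \<bullet> v m < 0" using k(1) m(1) by (auto simp: up_def)
      \<comment> \<open>Both denominators are absolute values, as the entry facet \<open>m\<close>
        is the exit facet for the reversed direction.\<close>
      define c where "c = (e \<bullet> v k) / \<bar>u \<bullet> v k\<bar> + (e \<bullet> v m) / \<bar>u \<bullet> v m\<bar>"
      have act: "x \<in> active h u i \<longleftrightarrow> chord h u x > 0 \<and> (i = k \<or> i = m)" if "i < N" for i
        by (rule active_generic[OF u dist k m that])
      have D: "D x = (if chord h u x > 0 then c else 0)"
      proof -
        have "D x = (\<Sum>i<N. if chord h u x > 0 \<and> i \<in> {k, m} then (e \<bullet> v i) / \<bar>u \<bullet> v i\<bar> else 0)"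
          unfolding D_def by (intro sum.cong) (auto simp: act indicator_def)
        also have "\<dots> = (if chord h u x > 0 then \<Sum>i\<in>{..<N} \<inter> {k, m}. (e \<bullet> v i) / \<bar>u \<bullet> v i\<bar> else 0)"
          by (simp add: sum.inter_restrict)
        also have "{..<N} \<inter> {k, m} = {k, m}" using km by auto
        finally show ?thesis using km by (simp add: c_def)
      qed
      have dist': "\<forall>i<N. \<forall>j<N. i \<noteq> j \<longrightarrow> crossing h (- u) x i \<noteq> crossing h (- u) x j"
        using dist by (simp add: crossing_uminus)
      have m': "exit_time h (- u) x = crossing h (- u) x m" using m by (simp add: crossing_uminus)
      have evc: "\<forall>\<^sub>F n in sequentially. chord h u (x + t n *\<^sub>R e) = chord h u x - t n * c"
        using exit_time_directional[OF u dist k t, of e] exit_time_directional[OF generic_uminus[OF u] dist' m(1) m' t, of e]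
      proof eventually_elim
        case (elim n)
        then show ?case using km unfolding chord_def c_def by (simp add: algebra_simps)
      qed
      have lim: "(\<lambda>n. (\<Gamma> (x + t n *\<^sub>R e) - \<Gamma> x) / t n) \<longlonglongrightarrow> - g (chord h u x) * D x"
      proof (cases "chord h u x > 0")
        case True
        have deriv: "((\<lambda>s. G (chord h u x - s * c)) has_real_derivative g (chord h u x) * (0 - 1 * c)) (at 0)"
          by (rule DERIV_chain2[where f=G]) (use G'[OF True] in \<open>auto intro!: derivative_eq_intros\<close>)
        have "(\<lambda>n. (G (chord h u x - t n * c) - G (chord h u x - 0 * c)) / (t n - 0)) \<longlonglongrightarrow> g (chord h u x) * (0 - 1 * c)"
          using deriv[unfolded has_field_derivative_iff] t t0(1)
          by (rule_tac filterlim_compose[of "\<lambda>s. (G (chord h u x - s * c) - G (chord h u x - 0 * c)) / (s - 0)" _ "at 0"])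
             (auto simp: filterlim_at intro!: always_eventually less_imp_neq[symmetric])
        moreover have "\<forall>\<^sub>F n in sequentially. (G (chord h u x - t n * c) - G (chord h u x - 0 * c)) / (t n - 0)
            = (\<Gamma> (x + t n *\<^sub>R e) - \<Gamma> x) / t n"
          using evc by eventually_elim (simp add: \<Gamma>_def)
        ultimately have "(\<lambda>n. (\<Gamma> (x + t n *\<^sub>R e) - \<Gamma> x) / t n) \<longlonglongrightarrow> g (chord h u x) * (0 - 1 * c)"
          by (rule Lim_transform_eventually)
        then show ?thesis using True D by simp
      next
        case False
        \<comment> \<open>Chord 0 would be a tie. A negative chord stays negative nearby, where
          \<open>G\<close> vanishes.\<close>
        have "chord h u x \<noteq> 0" using dist km k m by (auto simp: chord_def)
        then have neg: "chord h u x < 0" using False by simp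
        have "(\<lambda>n. chord h u x - t n * c) \<longlonglongrightarrow> chord h u x - 0 * c"
          using t by (intro tendsto_intros)
        then have "\<forall>\<^sub>F n in sequentially. chord h u x - t n * c < 0"
          using neg by (intro order_tendstoD(2)) auto
        then have "\<forall>\<^sub>F n in sequentially. 0 = (\<Gamma> (x + t n *\<^sub>R e) - \<Gamma> x) / t n"
          using evc by eventually_elim (use neg in \<open>simp add: \<Gamma>_def G0\<close>)
        then show ?thesis using False D by (intro Lim_transform_eventually[OF tendsto_const]) auto
      qed
      then show "(\<lambda>n. \<Phi> n x) \<longlonglongrightarrow> - g (chord h u x) * D x * indicator (slab u) x"
        unfolding \<Phi>_def by (intro tendsto_mult tendsto_const)
    qed
  qed (unfold \<Phi>_def D_def, measurable)
  moreover have "(LINT x|lborel. \<Phi> n x) = 0" for n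
  proof -
    have "(LINT x|lborel. \<Phi> n x) = (LINT x|lborel. (\<Gamma> (x + t n *\<^sub>R e) * indicator (slab u) x - \<Gamma> x * indicator (slab u) x) / t n)"
      unfolding \<Phi>_def by (intro Bochner_Integration.integral_cong) (auto simp: algebra_simps diff_divide_distrib)
    also have "\<dots> = ((LINT x|lborel. \<Gamma> (x + t n *\<^sub>R e) * indicator (slab u) x) - (LINT x|lborel. \<Gamma> x * indicator (slab u) x)) / t n"
      using int_\<Gamma>[of "t n *\<^sub>R e"] int_\<Gamma>[of 0] by simp
    finally show ?thesis by (simp add: transl)
  qed
  ultimately have "(LINT x|lborel. - g (chord h u x) * D x * indicator (slab u) x) = 0"
    by (simp add: tendsto_const_iff)
  moreover have "(LINT x|lborel. - g (chord h u x) * D x * indicator (slab u) x)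
     = (LINT x|lborel. (\<Sum>i<N. - ((e \<bullet> v i) / \<bar>u \<bullet> v i\<bar>) * (g (chord h u x) * indicator (active h u i \<inter> slab u) x)))"
    unfolding D_def
    by (intro Bochner_Integration.integral_cong) (auto simp: sum_distrib_left sum_distrib_right indicator_def sum_negf intro!: sum.cong)
  moreover have "\<dots> = (\<Sum>i<N. - ((e \<bullet> v i) / \<bar>u \<bullet> v i\<bar>) * slab_flux g h u i)"
    unfolding slab_flux_def using integrable_slab_flux[OF u g]
    by (subst Bochner_Integration.integral_sum) auto
  ultimately show ?thesis by (simp add: sum_negf)
qed

end

section \<open>Power weights\<close>

text \<open>For \<open>q < 1\<close> the weight \<open>s powr (q - 1)\<close> is singular at \<open>0\<close>; positive \<open>\<delta>\<close> regularises it.\<close>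
definition powr_weight :: "real \<Rightarrow> real \<Rightarrow> real \<Rightarrow> real" where
  "powr_weight q \<delta> s = (if s \<le> 0 then 0 else (s + \<delta>) powr (q - 1))"

definition powr_primitive :: "real \<Rightarrow> real \<Rightarrow> real \<Rightarrow> real" where
  "powr_primitive q \<delta> s = (if s \<le> 0 then 0 else ((s + \<delta>) powr q - \<delta> powr q) / q)"

lemma powr_weight_measurable [measurable]: "powr_weight q \<delta> \<in> borel_measurable borel"
  unfolding powr_weight_def by measurable

lemma powr_weight_nonneg: "0 \<le> powr_weight q \<delta> s"
  by (simp add: powr_weight_def)

lemma powr_weight_bounded:
  assumes "q > 0" "\<delta> \<ge> 0" "\<delta> > 0 \<or> q \<ge> 1"
  shows "\<exists>M\<ge>0. \<forall>s\<le>L. powr_weight q \<delta> s \<le> M"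
proof (intro exI conjI allI impI)
  \<comment> \<open>For q at least 1 the weight increases up to (L + \<delta>)^(q-1); for q < 1 it
    decreases from \<delta>^(q-1). The sum covers both cases.\<close>
  let ?M = "\<delta> powr (q - 1) + (L + \<delta>) powr (q - 1)"
  show "0 \<le> ?M" by simp
  fix s assume "s \<le> L"
  show "powr_weight q \<delta> s \<le> ?M"
  proof (cases "s \<le> 0")
    case False
    then have "(s + \<delta>) powr (q - 1) \<le> ?M"
    proof (cases "q \<ge> 1")
      case True
      then have "(s + \<delta>) powr (q - 1) \<le> (L + \<delta>) powr (q - 1)"
        using False \<open>s \<le> L\<close> \<open>\<delta> \<ge> 0\<close> by (intro powr_mono2) auto
      moreover have "0 \<le> \<delta> powr (q - 1)" by simp
      ultimately show ?thesis by linarith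
    next
      case q: False
      then have "(s + \<delta>) powr (q - 1) \<le> \<delta> powr (q - 1)"
        using False assms by (intro powr_mono2') auto
      moreover have "0 \<le> (L + \<delta>) powr (q - 1)" by simp
      ultimately show ?thesis by linarith
    qed
    then show ?thesis using False by (simp add: powr_weight_def)
  qed (simp add: powr_weight_def)
qed

lemma chord_weight_powr_weight:
  assumes "q > 0" "\<delta> \<ge> 0" "\<delta> > 0 \<or> q \<ge> 1"
  shows "chord_weight (powr_weight q \<delta>)"
  unfolding chord_weight_def
proof (intro conjI allI)
  have "continuous_on {0<..} (\<lambda>s. (s + \<delta>) powr (q - 1))"
    using \<open>\<delta> \<ge> 0\<close> by (intro continuous_intros) auto
  then show "continuous_on {0<..} (powr_weight q \<delta>)"
    by (rule continuous_on_eq) (simp add: powr_weight_def)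
  fix L
  show "\<exists>M. \<forall>s. 0 \<le> s \<longrightarrow> s \<le> L \<longrightarrow> powr_weight q \<delta> s \<le> M"
    using powr_weight_bounded[OF assms, of L] by blast
qed (auto simp: powr_weight_nonneg)

lemma powr_primitive_continuous:
  assumes "q > 0" "\<delta> \<ge> 0"
  shows "continuous_on {0..} (powr_primitive q \<delta>)"
proof -
  have "continuous_on {0..} (\<lambda>s. ((s + \<delta>) powr q - \<delta> powr q) / q)"
    using assms by (intro continuous_intros continuous_on_powr') auto
  then show ?thesis
    by (rule continuous_on_eq) (auto simp: powr_primitive_def)
qed

lemma powr_primitive_deriv:
  assumes "q > 0" "\<delta> \<ge> 0" "s > 0"
  shows "(powr_primitive q \<delta> has_real_derivative powr_weight q \<delta> s) (at s)"
proof -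
  have "((\<lambda>s. ((s + \<delta>) powr q - \<delta> powr q) / q) has_real_derivative (s + \<delta>) powr (q - 1)) (at s)"
    using assms by (auto intro!: derivative_eq_intros has_real_derivative_powr')
  moreover have "\<forall>\<^sub>F t in nhds s. ((t + \<delta>) powr q - \<delta> powr q) / q = powr_primitive q \<delta> t"
    using eventually_nhds_in_open[of "{0<..}" s] assms by (auto elim!: eventually_mono simp: powr_primitive_def)
  ultimately show ?thesis
    using assms by (subst DERIV_cong_ev[OF refl _ refl, symmetric]) (auto simp: powr_weight_def)
qed

text \<open>On the nonnegative axis the mean value theorem bounds increments by the bounded weight;
  an increment across 0 starts from the value 0 at 0.\<close>

lemma weight_primitive_powr:
  assumes "q > 0" "\<delta> \<ge> 0" "\<delta> > 0 \<or> q \<ge> 1"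
  shows "weight_primitive (powr_primitive q \<delta>) (powr_weight q \<delta>)"
  unfolding weight_primitive_def
proof (intro conjI allI impI)
  show "powr_primitive q \<delta> \<in> borel_measurable borel" unfolding powr_primitive_def by measurable
  show "0 \<le> powr_primitive q \<delta> s" for s
    using assms by (auto simp: powr_primitive_def intro!: divide_nonneg_pos powr_mono2)
  show "s \<le> 0 \<Longrightarrow> powr_primitive q \<delta> s = 0" for s by (simp add: powr_primitive_def)
  show "s > 0 \<Longrightarrow> (powr_primitive q \<delta> has_real_derivative powr_weight q \<delta> s) (at s)" for s
    using assms by (intro powr_primitive_deriv)
  fix L
  obtain M where M: "M \<ge> 0" "\<And>s. s \<le> L \<Longrightarrow> powr_weight q \<delta> s \<le> M"
    using powr_weight_bounded[OF assms, of L] by blast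
  let ?G = "powr_primitive q \<delta>"
  have pos: "\<bar>?G t - ?G s\<bar> \<le> M * (t - s)" if "0 \<le> s" "s < t" "t \<le> L" for s t
  proof -
    have "\<exists>l z. s < z \<and> z < t \<and> DERIV ?G z :> l \<and> ?G t - ?G s = (t - s) * l"
    proof (rule MVT[OF \<open>s < t\<close>])
      show "continuous_on {s..t} ?G"
        by (rule continuous_on_subset[OF powr_primitive_continuous]) (use assms that in auto)
      fix x assume "s < x"
      then show "?G differentiable (at x)"
        using powr_primitive_deriv[of q \<delta> x] assms that by (auto simp: real_differentiable_def)
    qed
    then obtain l z where z: "s < z" "z < t" "DERIV ?G z :> l" "?G t - ?G s = (t - s) * l" by blast
    have "l = powr_weight q \<delta> z"
      using DERIV_unique[OF z(3) powr_primitive_deriv] assms that z by auto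
    then have "0 \<le> l" "l \<le> M" using M(2)[of z] that z by (auto simp: powr_weight_nonneg)
    then have "(t - s) * l \<le> (t - s) * M" "0 \<le> (t - s) * l" using that by (auto intro: mult_left_mono)
    then show ?thesis unfolding z(4) by (simp add: mult.commute)
  qed
  have lt: "\<bar>?G t - ?G s\<bar> \<le> M * (t - s)" if "s < t" "t \<le> L" for s t
  proof -
    consider "0 \<le> s" | "t \<le> 0" | "s < 0" "0 < t" by linarith
    then show ?thesis
    proof cases
      case 2
      then show ?thesis using that M(1) by (simp add: powr_primitive_def)
    next
      case 3
      have "\<bar>?G t - ?G 0\<bar> \<le> M * (t - 0)" using 3 that by (intro pos) auto
      also have "\<dots> \<le> M * (t - s)" using 3 M(1) by (intro mult_left_mono) auto
      finally show ?thesis using 3 by (simp add: powr_primitive_def)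
    qed (use pos that in auto)
  qed
  show "\<exists>M. \<forall>s t. s \<le> L \<longrightarrow> t \<le> L \<longrightarrow> \<bar>?G s - ?G t\<bar> \<le> M * \<bar>s - t\<bar>"
  proof (intro exI allI impI)
    fix s t assume "s \<le> L" "t \<le> L"
    then show "\<bar>?G s - ?G t\<bar> \<le> M * \<bar>s - t\<bar>"
      using lt[of s t] lt[of t s] by (cases s t rule: linorder_cases) (auto simp: abs_minus_commute)
  qed
qed

section \<open>Error of the regularised weight\<close>

definition weight_gap :: "real \<Rightarrow> real \<Rightarrow> real \<Rightarrow> real" where
  "weight_gap q \<delta> s = (if s \<le> 0 then 0 else s powr (q - 1) - (s + \<delta>) powr (q - 1))"

lemma weight_gap_measurable [measurable]: "weight_gap q \<delta> \<in> borel_measurable borel"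
  unfolding weight_gap_def by measurable

lemma weight_gap_nonneg: "q < 1 \<Longrightarrow> \<delta> \<ge> 0 \<Longrightarrow> 0 \<le> weight_gap q \<delta> s"
  by (auto simp: weight_gap_def intro: powr_mono2')

text \<open>Only a lower bound for the chord will be available; by monotonicity it gives an upper
  bound for the gap.\<close>

lemma weight_gap_antimono:
  assumes q: "q < 1" and "\<delta> \<ge> 0" and st: "0 < s" "s \<le> t"
  shows "weight_gap q \<delta> t \<le> weight_gap q \<delta> s"
proof -
  let ?f = "\<lambda>s. s powr (q - 1) - (s + \<delta>) powr (q - 1)"
  have "?f t \<le> ?f s"
  proof (rule DERIV_nonpos_imp_nonincreasing[OF st(2)])
    fix x assume x: "s \<le> x" "x \<le> t"
    show "\<exists>y. (?f has_real_derivative y) (at x) \<and> y \<le> 0"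
    proof (intro exI conjI)
      show "(?f has_real_derivative (q - 1) * x powr (q - 2) - (q - 1) * (x + \<delta>) powr (q - 2)) (at x)"
        using x st \<open>\<delta> \<ge> 0\<close> by (auto intro!: derivative_eq_intros has_real_derivative_powr')
      have "(x + \<delta>) powr (q - 2) \<le> x powr (q - 2)" using x st \<open>\<delta> \<ge> 0\<close> q by (intro powr_mono2') auto
      then show "(q - 1) * x powr (q - 2) - (q - 1) * (x + \<delta>) powr (q - 2) \<le> 0"
        using q by (simp add: mult_left_mono_neg)
    qed
  qed
  then show ?thesis using st by (simp add: weight_gap_def)
qed

text \<open>The bound is independent of \<open>L\<close> and tends to 0 with \<delta>. It is read
  off from the primitive \<open>F\<close>: F L is nonpositive, and - F a is at most (a + \<delta>)^q
  / q.\<close>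

lemma nn_integral_weight_gap_le:
  assumes q: "0 < q" "q < 1" and \<delta>: "\<delta> > 0" and True: "L > \<delta>"
  shows "(\<integral>\<^sup>+ s. ennreal (weight_gap q \<delta> s) * indicator {0<..L} s \<partial>lborel) \<le> ennreal ((2 * \<delta>) powr q / q)"
proof -
  define F where "F = (\<lambda>s. (s powr q - (s + \<delta>) powr q) / q)"
  have Icc: "(\<integral>\<^sup>+ s. ennreal (weight_gap q \<delta> s) * indicator {a..L} s \<partial>lborel) \<le> ennreal ((2 * \<delta>) powr q / q)"
    if a: "0 < a" "a \<le> \<delta>" for a
  proof -
    have "(\<integral>\<^sup>+ s. ennreal (weight_gap q \<delta> s) * indicator {a..L} s \<partial>lborel) = ennreal (F L - F a)"
    proof (rule nn_integral_FTC_Icc)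
      fix x assume x: "x \<in> {a..L}"
      then show "(F has_real_derivative weight_gap q \<delta> x) (at x)"
        unfolding F_def weight_gap_def using a q \<delta>
        by (auto intro!: derivative_eq_intros has_real_derivative_powr' simp: field_simps)
    qed (use a True q \<delta> in \<open>auto simp: weight_gap_nonneg\<close>)
    also have "F L - F a \<le> (2 * \<delta>) powr q / q"
    proof -
      have "L powr q \<le> (L + \<delta>) powr q" "(a + \<delta>) powr q \<le> (2 * \<delta>) powr q"
        using a True q \<delta> by (auto intro!: powr_mono2)
      moreover have "0 \<le> a powr q" by simp
      ultimately have "(L powr q - (L + \<delta>) powr q) - (a powr q - (a + \<delta>) powr q) \<le> (2 * \<delta>) powr q" by linarith
      then show ?thesis using q by (simp add: F_def diff_divide_distrib[symmetric] divide_right_mono)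
    qed
    finally show ?thesis by (simp add: ennreal_leI)
  qed
  \<comment> \<open>The primitive is not differentiable at 0, so (0, L] is exhausted by closed
    intervals.\<close>
  define f where "f = (\<lambda>n s. ennreal (weight_gap q \<delta> s) * indicator {\<delta> / real (Suc n)..L} s)"
  have inc: "incseq f"
  proof (rule incseq_SucI, rule le_funI)
    fix n s
    have "\<delta> / real (Suc (Suc n)) \<le> \<delta> / real (Suc n)" using \<delta> by (intro divide_left_mono) auto
    then show "f n s \<le> f (Suc n) s"
      unfolding f_def by (intro mult_left_mono) (auto simp: indicator_def)
  qed
  have "(\<integral>\<^sup>+ s. ennreal (weight_gap q \<delta> s) * indicator {0<..L} s \<partial>lborel) \<le> (\<integral>\<^sup>+ s. (SUP n. f n s) \<partial>lborel)"
  proof (rule nn_integral_mono)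
    fix s
    show "ennreal (weight_gap q \<delta> s) * indicator {0<..L} s \<le> (SUP n. f n s)"
    proof (cases "s \<in> {0<..L}")
      case s: True
      obtain n where "inverse (real (Suc n)) < s / \<delta>" using reals_Archimedean[of "s / \<delta>"] s \<delta> by auto
      then have "\<delta> / real (Suc n) \<le> s" using \<delta> by (simp add: field_simps)
      then have "ennreal (weight_gap q \<delta> s) * indicator {0<..L} s = f n s" using s by (simp add: f_def)
      then show ?thesis by (metis SUP_upper UNIV_I)
    qed simp
  qed
  also have "\<dots> = (SUP n. integral\<^sup>N lborel (f n))"
    by (rule nn_integral_monotone_convergence_SUP[OF inc]) (simp add: f_def)
  also have "\<dots> \<le> ennreal ((2 * \<delta>) powr q / q)"
    unfolding f_def using \<delta> by (intro SUP_least Icc) (auto simp: field_simps)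
  finally show ?thesis .
qed

context hausdorff_slices begin

text \<open>If \<open>w\<close> is not a multiple of \<open>v\<close>, the coordinate z . w on the
  part of the hyperplane inside a ball has a density at most \<open>C\<close>, the same for all
  offsets. The proof extends the integrand along \<open>v\<close> to a unit slab and slices that by
  the component of \<open>w\<close> orthogonal to \<open>v\<close>.\<close>

lemma nn_integral_hyp_strip:
  fixes v w :: 'a
  assumes v: "norm v = 1" and w: "w - (v \<bullet> w) *\<^sub>R v \<noteq> 0"
  obtains C where "C \<ge> 0" "\<And>c a (\<phi> :: real \<Rightarrow> ennreal). \<phi> \<in> borel_measurable borel \<Longrightarrow>
      (\<integral>\<^sup>+ z. \<phi> (a - z \<bullet> w) * indicator (cball 0 R) z \<partial>hyp v c) \<le> ennreal C * (\<integral>\<^sup>+ s. \<phi> s \<partial>lborel)"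
proof -
  have vv: "v \<bullet> v = 1" using v by (simp add: dot_square_norm)
  define w' where "w' = w - (v \<bullet> w) *\<^sub>R v"
  define b where "b = norm w'"
  define n where "n = w' /\<^sub>R b"
  have b: "b > 0" using w by (simp add: b_def w'_def)
  have n: "norm n = 1" using b by (simp add: n_def b_def)
  have vw': "v \<bullet> w' = 0" by (simp add: w'_def inner_diff_right vv)
  have nw': "n \<bullet> w' = b" using b by (simp add: n_def b_def dot_square_norm power2_eq_square)
  have w'n: "w' = b *\<^sub>R n" using b by (simp add: n_def)
  have fin: "emeasure (hyp n 0) (cball 0 (R + 1)) < \<infinity>"
    using hausdorff_outer_hyperplane_finite[OF dim n, of "cball 0 (R + 1)" 0] by (simp add: emeasure_hyp)
  define C where "C = enn2real (emeasure (hyp n 0) (cball 0 (R + 1))) / b"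
  have C: "emeasure (hyp n 0) (cball 0 (R + 1)) = ennreal (C * b)"
    using fin b by (simp add: C_def less_top)
  show thesis
  proof
    show "C \<ge> 0" using b by (simp add: C_def)
    fix c a and \<phi> :: "real \<Rightarrow> ennreal"
    assume [measurable]: "\<phi> \<in> borel_measurable borel"
    \<comment> \<open>On the hyperplane, a - z . w agrees with a' - z . w', and the latter is
      constant along \<open>v\<close>.\<close>
    define a' where "a' = a - c * (v \<bullet> w)"
    define f where "f = (\<lambda>x. \<phi> (a' - x \<bullet> w') * indicator {x. norm (x - (x \<bullet> v) *\<^sub>R v) \<le> R} x)"
    have [measurable]: "f \<in> borel_measurable borel" unfolding f_def by measurable
    have [measurable]: "cball (0::'a) r \<in> sets borel" for r by simp
    have inv: "f (x + s *\<^sub>R v) = f x" for x s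
      by (simp add: f_def indicator_def inner_add_left vw' vv algebra_simps)
    have pn: "norm (x - (x \<bullet> v) *\<^sub>R v) \<le> norm x" for x
    proof -
      have "(x - (x \<bullet> v) *\<^sub>R v) \<bullet> (x - (x \<bullet> v) *\<^sub>R v) = x \<bullet> x - (x \<bullet> v) * (x \<bullet> v)"
        by (simp add: inner_diff_left inner_diff_right vv inner_commute[of v x])
      then have "(norm (x - (x \<bullet> v) *\<^sub>R v))\<^sup>2 \<le> (norm x)\<^sup>2" unfolding power2_norm_eq_inner by simp
      then show ?thesis by (rule power2_le_imp_le) simp
    qed
    have "(\<integral>\<^sup>+ z. \<phi> (a - z \<bullet> w) * indicator (cball 0 R) z \<partial>hyp v c) \<le> (\<integral>\<^sup>+ z. f z \<partial>hyp v c)"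
    proof (rule nn_integral_mono_AE)
      have "AE y in hyp v c. y \<bullet> v = c"
        unfolding hyp_def by (subst AE_density) (auto simp: indicator_def)
      then show "AE z in hyp v c. \<phi> (a - z \<bullet> w) * indicator (cball 0 R) z \<le> f z"
      proof eventually_elim
        fix z assume z: "z \<bullet> v = c"
        have "a - z \<bullet> w = a' - z \<bullet> w'"
          using z by (simp add: a'_def w'_def inner_diff_right)
        then show "\<phi> (a - z \<bullet> w) * indicator (cball 0 R) z \<le> f z"
          using order_trans[OF pn, of z R] by (auto simp: f_def indicator_def)
      qed
    qed
    then have "ennreal \<kappa> * (\<integral>\<^sup>+ z. \<phi> (a - z \<bullet> w) * indicator (cball 0 R) z \<partial>hyp v c) \<le> ennreal \<kappa> * (\<integral>\<^sup>+ z. f z \<partial>hyp v c)"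
      by (rule mult_left_mono) simp
    also have "\<dots> = (\<integral>\<^sup>+ x. f x * indicator {x. 0 \<le> x \<bullet> v \<and> x \<bullet> v < 1} x \<partial>lborel)"
      by (rule nn_integral_hyp_eq_slab[of _ v]) (auto simp: inv vv v)
    \<comment> \<open>In the slab the projection has norm at most \<open>R\<close> and the height is
      below 1, hence the radius R + 1.\<close>
    also have "\<dots> \<le> (\<integral>\<^sup>+ x. \<phi> (a' - x \<bullet> w') * indicator (cball 0 (R + 1)) x \<partial>lborel)"
    proof (rule nn_integral_mono)
      fix x
      have "norm x \<le> R + 1" if "norm (x - (x \<bullet> v) *\<^sub>R v) \<le> R" "0 \<le> x \<bullet> v" "x \<bullet> v < 1"
        using norm_triangle_ineq[of "x - (x \<bullet> v) *\<^sub>R v" "(x \<bullet> v) *\<^sub>R v"] that v by simp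
      then show "f x * indicator {x. 0 \<le> x \<bullet> v \<and> x \<bullet> v < 1} x \<le> \<phi> (a' - x \<bullet> w') * indicator (cball 0 (R + 1)) x"
        by (auto simp: f_def indicator_def)
    qed
    also have "\<dots> = ennreal \<kappa> * (\<integral>\<^sup>+ t. (\<integral>\<^sup>+ y. \<phi> (a' - (y + t *\<^sub>R n) \<bullet> w') * indicator (cball 0 (R + 1)) (y + t *\<^sub>R n) \<partial>hyp n 0) \<partial>lborel)"
      by (rule slices[OF n]) measurable
    also have "\<dots> \<le> ennreal \<kappa> * (\<integral>\<^sup>+ t. \<phi> (a' + (- b) * t) * ennreal (C * b) \<partial>lborel)"
    proof (intro mult_left_mono nn_integral_mono)
      fix t :: real
      have "(\<integral>\<^sup>+ y. \<phi> (a' - (y + t *\<^sub>R n) \<bullet> w') * indicator (cball 0 (R + 1)) (y + t *\<^sub>R n) \<partial>hyp n 0)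
         \<le> (\<integral>\<^sup>+ y. \<phi> (a' + (- b) * t) * indicator (cball 0 (R + 1)) y \<partial>hyp n 0)"
      proof (rule nn_integral_mono_AE)
        have "AE y in hyp n 0. y \<bullet> n = 0"
          unfolding hyp_def by (subst AE_density) (auto simp: indicator_def)
        then show "AE y in hyp n 0. \<phi> (a' - (y + t *\<^sub>R n) \<bullet> w') * indicator (cball 0 (R + 1)) (y + t *\<^sub>R n)
            \<le> \<phi> (a' + (- b) * t) * indicator (cball 0 (R + 1)) y"
        proof eventually_elim
          fix y assume y: "y \<bullet> n = 0"
          have nn: "n \<bullet> n = 1" using n by (simp add: dot_square_norm)
          have "(norm (y + t *\<^sub>R n))\<^sup>2 = (norm y)\<^sup>2 + t\<^sup>2"
            unfolding power2_norm_eq_inner using y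
            by (simp add: inner_add_left inner_add_right inner_commute nn power2_eq_square)
          then have "(norm y)\<^sup>2 \<le> (norm (y + t *\<^sub>R n))\<^sup>2" by simp
          then have "norm y \<le> norm (y + t *\<^sub>R n)" by (rule power2_le_imp_le) simp
          moreover have "(y + t *\<^sub>R n) \<bullet> w' = b * t"
            using y nw' by (simp add: inner_add_left) (simp add: w'n)
          ultimately show "\<phi> (a' - (y + t *\<^sub>R n) \<bullet> w') * indicator (cball 0 (R + 1)) (y + t *\<^sub>R n)
            \<le> \<phi> (a' + (- b) * t) * indicator (cball 0 (R + 1)) y"
            by (auto simp: indicator_def)
        qed
      qed
      also have "\<dots> = \<phi> (a' + (- b) * t) * ennreal (C * b)"
        by (simp add: nn_integral_cmult_indicator C)
      finally show "(\<integral>\<^sup>+ y. \<phi> (a' - (y + t *\<^sub>R n) \<bullet> w') * indicator (cball 0 (R + 1)) (y + t *\<^sub>R n) \<partial>hyp n 0)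
         \<le> \<phi> (a' + (- b) * t) * ennreal (C * b)" .
    qed simp
    \<comment> \<open>The substitution s = a' - b t contributes 1/b and cancels the factor b kept in
      \<open>C * b\<close>.\<close>
    also have "(\<integral>\<^sup>+ t. \<phi> (a' + (- b) * t) * ennreal (C * b) \<partial>lborel) = ennreal C * (ennreal \<bar>- b\<bar> * (\<integral>\<^sup>+ t. \<phi> (a' + (- b) * t) \<partial>lborel))"
    proof -
      have Cb: "ennreal (C * b) = ennreal C * ennreal b" using b by (intro ennreal_mult) (auto simp: C_def)
      show ?thesis using b unfolding Cb by (subst nn_integral_multc) (auto simp: mult_ac)
    qed
    also have "ennreal \<bar>- b\<bar> * (\<integral>\<^sup>+ t. \<phi> (a' + (- b) * t) \<partial>lborel) = (\<integral>\<^sup>+ s. \<phi> s \<partial>lborel)"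
      using b by (subst nn_integral_real_affine[of \<phi> "- b" a']) auto
    finally show "(\<integral>\<^sup>+ z. \<phi> (a - z \<bullet> w) * indicator (cball 0 R) z \<partial>hyp v c) \<le> ennreal C * (\<integral>\<^sup>+ s. \<phi> s \<partial>lborel)"
      using \<kappa>_pos by (simp add: ennreal_mult_le_mult_iff)
  qed
qed

text \<open>Sections of the ball by parallel hyperplanes are moved to the hyperplane through the
  origin; they are empty once |c| exceeds \<open>R\<close>.\<close>

lemma emeasure_hyp_cball_uniform:
  fixes v :: 'a
  assumes v: "norm v = 1"
  obtains C where "C \<ge> 0" "\<And>c. emeasure (hyp v c) (cball 0 R) \<le> ennreal C"
proof -
  have vv: "v \<bullet> v = 1" using v by (simp add: dot_square_norm)
  have fin: "emeasure (hyp v 0) (cball 0 (2 * R)) < \<infinity>"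
    using hausdorff_outer_hyperplane_finite[OF dim v, of "cball 0 (2 * R)" 0] by (simp add: emeasure_hyp)
  show thesis
  proof
    show "0 \<le> enn2real (emeasure (hyp v 0) (cball 0 (2 * R)))" by simp
    fix c
    show "emeasure (hyp v c) (cball 0 R) \<le> ennreal (enn2real (emeasure (hyp v 0) (cball 0 (2 * R))))"
    proof (cases "\<bar>c\<bar> \<le> R")
      case True
      have "emeasure (hyp v c) (cball 0 R) = (\<integral>\<^sup>+ x. indicator (cball 0 R) x \<partial>hyp v c)" by simp
      also have "\<dots> = (\<integral>\<^sup>+ x. indicator (cball 0 R) (x + c *\<^sub>R v) \<partial>hyp v 0)"
        by (subst nn_integral_hyp_translate) (auto simp: vv intro!: borel_measurable_indicator)
      also have "\<dots> \<le> (\<integral>\<^sup>+ x. indicator (cball 0 (2 * R)) x \<partial>hyp v 0)"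
      proof (rule nn_integral_mono)
        fix x
        have "norm x \<le> 2 * R" if "norm (x + c *\<^sub>R v) \<le> R"
          using norm_triangle_ineq4[of "x + c *\<^sub>R v" "c *\<^sub>R v"] that v True by simp
        then show "indicator (cball 0 R) (x + c *\<^sub>R v) \<le> (indicator (cball 0 (2 * R)) x :: ennreal)"
          by (auto simp: indicator_def)
      qed
      finally show ?thesis using fin by (simp add: less_top)
    next
      case False
      have "cball 0 R \<inter> {x. x \<bullet> v = c} = {}"
      proof (rule equals0I)
        fix x assume "x \<in> cball 0 R \<inter> {x. x \<bullet> v = c}"
        then show False using Cauchy_Schwarz_ineq2[of x v] v False by auto
      qed
      then show ?thesis by (simp add: emeasure_hyp hausdorff_outer_empty)
    qed
  qed
qed

end

section \<open>Regularisation and the total flux\<close>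

lemma tendsto_uniform_approx:
  fixes a :: "nat \<Rightarrow> real"
  assumes "\<epsilon> \<longlonglongrightarrow> 0" and b: "\<And>k. (\<lambda>n. b k n) \<longlonglongrightarrow> b' k"
    and an: "\<And>k n. \<bar>a n - b k n\<bar> \<le> \<epsilon> k" and a: "\<And>k. \<bar>a' - b' k\<bar> \<le> \<epsilon> k"
  shows "a \<longlonglongrightarrow> a'"
proof (rule LIMSEQ_I)
  fix r :: real assume r: "r > 0"
  have "\<forall>\<^sub>F k in sequentially. \<epsilon> k < r / 3" using order_tendstoD(2)[OF assms(1), of "r / 3"] r by simp
  then obtain k where k: "\<epsilon> k < r / 3" by (auto simp: eventually_sequentially)
  obtain n0 where n0: "\<And>n. n \<ge> n0 \<Longrightarrow> norm (b k n - b' k) < r / 3"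
    using LIMSEQ_D[OF b[of k], of "r / 3"] r by auto
  show "\<exists>no. \<forall>n\<ge>no. norm (a n - a') < r"
  proof (intro exI allI impI)
    fix n assume "n0 \<le> n"
    then have "\<bar>b k n - b' k\<bar> < r / 3" using n0 by simp
    moreover have "\<bar>a n - b k n\<bar> < r / 3" "\<bar>a' - b' k\<bar> < r / 3"
      using an[of n k] a[of k] k by linarith+
    ultimately show "norm (a n - a') < r" unfolding real_norm_def by arith
  qed
qed

context facet_normals begin

text \<open>A parameter sequence tending to 0; for q at least 1 it is constantly 0, as the power
  weight is then bounded near 0.\<close>

definition regularisation :: "real \<Rightarrow> nat \<Rightarrow> real" where
  "regularisation q k = (if q < 1 then 1 / real (Suc k) else 0)"

definition power_flux :: "real \<Rightarrow> (nat \<Rightarrow> real) \<Rightarrow> 'a \<Rightarrow> nat \<Rightarrow> ennreal" where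
  "power_flux q = facet_flux (\<lambda>s. s powr (q - 1))"

abbreviation regular_flux :: "real \<Rightarrow> nat \<Rightarrow> (nat \<Rightarrow> real) \<Rightarrow> 'a \<Rightarrow> nat \<Rightarrow> ennreal" where
  "regular_flux q k \<equiv> facet_flux (powr_weight q (regularisation q k))"

lemma chord_weight_regularised: "q > 0 \<Longrightarrow> chord_weight (powr_weight q (regularisation q k))"
  by (rule chord_weight_powr_weight) (auto simp: regularisation_def)

lemma weight_primitive_regularised:
  "q > 0 \<Longrightarrow> weight_primitive (powr_primitive q (regularisation q k)) (powr_weight q (regularisation q k))"
  by (rule weight_primitive_powr) (auto simp: regularisation_def)

lemma chord_nonneg: "z \<in> P h \<Longrightarrow> u \<noteq> 0 \<Longrightarrow> 0 \<le> chord h u z"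
  using exit_time_nonneg[of z h u] exit_time_nonneg[of z h "- u"] by (simp add: chord_def)

lemma regular_flux_le:
  assumes "q > 0"
  shows "regular_flux q k h u i \<le> power_flux q h u i"
  unfolding facet_flux_def power_flux_def
proof (intro nn_integral_mono mult_right_mono ennreal_leI)
  fix z
  let ?s = "chord h u z"
  show "powr_weight q (regularisation q k) ?s \<le> ?s powr (q - 1)"
    by (auto simp: powr_weight_def regularisation_def intro!: powr_mono2')
qed simp

text \<open>The direction \<open>w\<close> points inward at the facet point, so the chord is the
  exit time at some facet \<open>k\<close>. The distance to that hyperplane is the chord times w . v
  k, a factor of at most 1.\<close>

lemma facet_chord_ge_aux:
  assumes i: "i < N" and w: "norm w = 1" "w \<bullet> v i < 0"
    and z: "z \<in> P h" "z \<bullet> v i = h i" and pos: "chord h w z > 0"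
  shows "\<exists>k<N. k \<noteq> i \<and> 0 < h k - z \<bullet> v k \<and> h k - z \<bullet> v k \<le> chord h w z"
proof -
  have w0: "w \<noteq> 0" "- w \<noteq> 0" using w by auto
  have "exit_time h (- w) z \<le> crossing h (- w) z i"
    using i w by (intro exit_time_le) (simp add: up_def)
  then have "exit_time h (- w) z = 0"
    using exit_time_nonneg[OF z(1) w0(2)] z(2) by (simp add: crossing_def)
  then have ch: "chord h w z = exit_time h w z" by (simp add: chord_def)
  obtain k where k: "k \<in> up w" "exit_time h w z = crossing h w z k"
    using exit_time_attained[OF w0(1)] by blast
  then have kN: "k < N" "w \<bullet> v k > 0" by (auto simp: up_def)
  have "w \<bullet> v k \<le> 1" using norm_cauchy_schwarz[of w "v k"] w norm_v[OF kN(1)] by simp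
  moreover have eq: "h k - z \<bullet> v k = chord h w z * (w \<bullet> v k)" using kN ch k by (simp add: crossing_def)
  ultimately have "h k - z \<bullet> v k \<le> chord h w z" using pos by (simp add: mult_left_le)
  moreover have "0 < h k - z \<bullet> v k" using eq pos kN by simp
  moreover have "k \<noteq> i" using kN w by auto
  ultimately show ?thesis using kN by blast
qed

lemma facet_chord_ge:
  assumes i: "i < N" and u: "generic u"
    and z: "z \<in> P h" "z \<bullet> v i = h i" and pos: "chord h u z > 0"
  shows "\<exists>k<N. k \<noteq> i \<and> 0 < h k - z \<bullet> v k \<and> h k - z \<bullet> v k \<le> chord h u z"
proof -
  have "u \<bullet> v i \<noteq> 0" "norm u = 1" using u i by (auto simp: generic_def)
  then consider "u \<bullet> v i < 0" | "- u \<bullet> v i < 0" by force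
  then show ?thesis
  proof cases
    case 1
    show ?thesis by (rule facet_chord_ge_aux[OF i \<open>norm u = 1\<close> 1 z pos])
  next
    case 2
    have "norm (- u) = 1" "chord h (- u) z > 0" using \<open>norm u = 1\<close> pos by (simp_all add: chord_uminus)
    from facet_chord_ge_aux[OF i this(1) 2 z this(2)] show ?thesis unfolding chord_uminus .
  qed
qed

text \<open>At a facet point the gap of a positive chord is at most the gap of the distance to some
  other facet hyperplane. Which one depends on the point and on \<open>u\<close>, so the sum over
  all others is taken; each summand is a one-dimensional integral, uniformly in \<open>u\<close> and
  \<open>h\<close>.\<close>

lemma gap_flux_le:
  assumes i: "i < N" and q: "0 < q" "q < 1" and R: "R \<ge> 0"
  obtains C where "C \<ge> 0" "\<And>h u \<delta>. P h \<subseteq> cball 0 R \<Longrightarrow> generic u \<Longrightarrow> \<delta> > 0 \<Longrightarrow>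
     facet_flux (weight_gap q \<delta>) h u i \<le> ennreal (C * ((2 * \<delta>) powr q / q))"
proof -
  let ?J = "{..<N} - {i}"
  define Q where "Q = (\<lambda>j C. C \<ge> 0 \<and> (\<forall>c a (\<phi> :: real \<Rightarrow> ennreal). \<phi> \<in> borel_measurable borel \<longrightarrow>
      (\<integral>\<^sup>+ z. \<phi> (a - z \<bullet> v j) * indicator (cball 0 R) z \<partial>hyp (v i) c) \<le> ennreal C * (\<integral>\<^sup>+ s. \<phi> s \<partial>lborel)))"
  have "\<exists>C. Q j C" if j: "j \<in> ?J" for j
  proof -
    have "v j \<noteq> (v i \<bullet> v j) *\<^sub>R v i" using j i by (intro not_parallel) auto
    then have "v j - (v i \<bullet> v j) *\<^sub>R v i \<noteq> 0" by simp
    from nn_integral_hyp_strip[OF norm_v[OF i] this, of R] show ?thesis unfolding Q_def by metis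
  qed
  then obtain Cj where Q: "\<And>j. j \<in> ?J \<Longrightarrow> Q j (Cj j)" by metis
  have Cj: "Cj j \<ge> 0" if "j \<in> ?J" for j using Q[OF that] by (simp add: Q_def)
  have Cj2: "(\<integral>\<^sup>+ z. \<phi> (a - z \<bullet> v j) * indicator (cball 0 R) z \<partial>hyp (v i) c) \<le> ennreal (Cj j) * (\<integral>\<^sup>+ s. \<phi> s \<partial>lborel)"
    if "j \<in> ?J" "\<phi> \<in> borel_measurable borel" for j c a and \<phi> :: "real \<Rightarrow> ennreal"
    using Q[OF that(1)] that(2) by (simp add: Q_def)
  show thesis
  proof
    show "0 \<le> (\<Sum>j\<in>?J. Cj j)" using Cj by (rule sum_nonneg)
    fix h u \<delta> assume hR: "P h \<subseteq> cball 0 R" and u: "generic u" and \<delta>: "\<delta> > (0::real)"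
    \<comment> \<open>Chords have length at most 2 R; the additional 2 \<delta> meets the condition
      \<open>L > \<delta>\<close> of \<open>nn_integral_weight_gap_le\<close>.\<close>
    define \<phi> where "\<phi> = (\<lambda>s. ennreal (weight_gap q \<delta> s) * indicator {0<..2 * R + 2 * \<delta>} s)"
    have [measurable]: "\<phi> \<in> borel_measurable borel" unfolding \<phi>_def by measurable
    have [measurable]: "cball (0::'a) R \<in> sets borel" by simp
    have "facet_flux (weight_gap q \<delta>) h u i \<le> (\<integral>\<^sup>+ z. (\<Sum>j\<in>?J. \<phi> (h j - z \<bullet> v j) * indicator (cball 0 R) z) \<partial>hyp (v i) (h i))"
      unfolding facet_flux_def
    proof (rule nn_integral_mono_AE)
      show "AE z in hyp (v i) (h i). ennreal (weight_gap q \<delta> (chord h u z)) * indicator (P h) z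
          \<le> (\<Sum>j\<in>?J. \<phi> (h j - z \<bullet> v j) * indicator (cball 0 R) z)"
        using AE_hyp[of "v i" "h i"]
      proof eventually_elim
        fix z assume z: "z \<bullet> v i = h i"
        show "ennreal (weight_gap q \<delta> (chord h u z)) * indicator (P h) z
          \<le> (\<Sum>j\<in>?J. \<phi> (h j - z \<bullet> v j) * indicator (cball 0 R) z)"
        proof (cases "z \<in> P h \<and> chord h u z > 0")
          case True
          then obtain k where k: "k < N" "k \<noteq> i" "0 < h k - z \<bullet> v k" "h k - z \<bullet> v k \<le> chord h u z"
            using facet_chord_ge[OF i u, of z h] z by blast
          have zR: "z \<in> cball 0 R" using True hR by blast
          have "chord h u z \<le> 2 * R" using True chord_le_diameter(1)[OF u _ hR] by auto
          then have "h k - z \<bullet> v k \<in> {0<..2 * R + 2 * \<delta>}" using k \<delta> by auto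
          then have "\<phi> (h k - z \<bullet> v k) = ennreal (weight_gap q \<delta> (h k - z \<bullet> v k))" by (simp add: \<phi>_def)
          moreover have "weight_gap q \<delta> (chord h u z) \<le> weight_gap q \<delta> (h k - z \<bullet> v k)"
            using q \<delta> k by (intro weight_gap_antimono) auto
          ultimately have "ennreal (weight_gap q \<delta> (chord h u z)) * indicator (P h) z
             \<le> \<phi> (h k - z \<bullet> v k) * indicator (cball 0 R) z"
            using True zR by (simp add: ennreal_leI)
          also have "\<dots> \<le> (\<Sum>j\<in>?J. \<phi> (h j - z \<bullet> v j) * indicator (cball 0 R) z)"
            using k by (intro member_le_sum) auto
          finally show ?thesis .
        next
          case False
          then have eq: "ennreal (weight_gap q \<delta> (chord h u z)) * indicator (P h) z = 0"
            by (auto simp: weight_gap_def indicator_def)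
          show ?thesis unfolding eq by simp
        qed
      qed
    qed
    also have "\<dots> = (\<Sum>j\<in>?J. (\<integral>\<^sup>+ z. \<phi> (h j - z \<bullet> v j) * indicator (cball 0 R) z \<partial>hyp (v i) (h i)))"
      by (rule nn_integral_sum) measurable
    also have "\<dots> \<le> (\<Sum>j\<in>?J. ennreal (Cj j) * ennreal ((2 * \<delta>) powr q / q))"
    proof (rule sum_mono)
      fix j assume j: "j \<in> ?J"
      have "(\<integral>\<^sup>+ z. \<phi> (h j - z \<bullet> v j) * indicator (cball 0 R) z \<partial>hyp (v i) (h i)) \<le> ennreal (Cj j) * (\<integral>\<^sup>+ s. \<phi> s \<partial>lborel)"
        by (rule Cj2[OF j]) simp
      also have "\<dots> \<le> ennreal (Cj j) * ennreal ((2 * \<delta>) powr q / q)"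
        unfolding \<phi>_def using R \<delta> q by (intro mult_left_mono nn_integral_weight_gap_le) auto
      finally show "(\<integral>\<^sup>+ z. \<phi> (h j - z \<bullet> v j) * indicator (cball 0 R) z \<partial>hyp (v i) (h i)) \<le> ennreal (Cj j) * ennreal ((2 * \<delta>) powr q / q)" .
    qed
    also have "\<dots> = ennreal ((\<Sum>j\<in>?J. Cj j) * ((2 * \<delta>) powr q / q))"
    proof -
      have X: "0 \<le> (2 * \<delta>) powr q / q" using q by simp
      have "(\<Sum>j\<in>?J. ennreal (Cj j) * ennreal ((2 * \<delta>) powr q / q)) = (\<Sum>j\<in>?J. ennreal (Cj j * ((2 * \<delta>) powr q / q)))"
        using Cj X by (intro sum.cong refl ennreal_mult[symmetric])
      also have "\<dots> = ennreal (\<Sum>j\<in>?J. Cj j * ((2 * \<delta>) powr q / q))"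
        using Cj X by (intro sum_ennreal mult_nonneg_nonneg)
      finally show ?thesis by (simp only: sum_distrib_right)
    qed
    finally show "facet_flux (weight_gap q \<delta>) h u i \<le> ennreal ((\<Sum>j\<in>?J. Cj j) * ((2 * \<delta>) powr q / q))" .
  qed
qed

lemma power_flux_le_regular:
  assumes i: "i < N" and q: "0 < q" and R: "R \<ge> 0"
  obtains \<epsilon> where "\<epsilon> \<longlonglongrightarrow> 0" "\<And>k. \<epsilon> k \<ge> 0"
    "\<And>h u k. P h \<subseteq> cball 0 R \<Longrightarrow> generic u \<Longrightarrow> power_flux q h u i \<le> regular_flux q k h u i + ennreal (\<epsilon> k)"
proof (cases "q < 1")
  case True
  obtain C where C: "C \<ge> 0" "\<And>h u \<delta>. P h \<subseteq> cball 0 R \<Longrightarrow> generic u \<Longrightarrow> \<delta> > 0 \<Longrightarrow>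
     facet_flux (weight_gap q \<delta>) h u i \<le> ennreal (C * ((2 * \<delta>) powr q / q))"
    using gap_flux_le[OF i q True R] by blast
  define \<delta> where "\<delta> = regularisation q"
  have \<delta>: "\<delta> k > 0" for k using True by (simp add: \<delta>_def regularisation_def)
  show thesis
  proof
    have "\<delta> = (\<lambda>k. 1 / real (Suc k))" using True by (simp add: \<delta>_def regularisation_def fun_eq_iff)
    then have "\<delta> \<longlonglongrightarrow> 0" using LIMSEQ_Suc[OF lim_1_over_n] by (simp only:)
    then have l0: "(\<lambda>k. 2 * \<delta> k) \<longlonglongrightarrow> 0" using tendsto_mult[OF tendsto_const[of 2]] by fastforce
    have "\<forall>\<^sub>F k in sequentially. 0 \<le> 2 * \<delta> k" using \<delta> by (auto simp: less_imp_le)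
    then have "(\<lambda>k. (2 * \<delta> k) powr q) \<longlonglongrightarrow> 0 powr q"
      by (intro tendsto_powr'[OF l0 tendsto_const]) (use q in simp)
    then have "(\<lambda>k. C * ((2 * \<delta> k) powr q / q)) \<longlonglongrightarrow> C * (0 powr q / q)"
      using q by (intro tendsto_mult tendsto_divide tendsto_const) auto
    then show "(\<lambda>k. C * ((2 * \<delta> k) powr q / q)) \<longlonglongrightarrow> 0" by simp
    show "0 \<le> C * ((2 * \<delta> k) powr q / q)" for k using C(1) q by simp
    fix h u k assume hR: "P h \<subseteq> cball 0 R" and u: "generic u"
    have "power_flux q h u i \<le> (\<integral>\<^sup>+ z. ennreal (powr_weight q (\<delta> k) (chord h u z)) * indicator (P h) z
        + ennreal (weight_gap q (\<delta> k) (chord h u z)) * indicator (P h) z \<partial>hyp (v i) (h i))"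
      unfolding power_flux_def facet_flux_def
    proof (rule nn_integral_mono)
      fix z
      show "ennreal (chord h u z powr (q - 1)) * indicator (P h) z
        \<le> ennreal (powr_weight q (\<delta> k) (chord h u z)) * indicator (P h) z
          + ennreal (weight_gap q (\<delta> k) (chord h u z)) * indicator (P h) z"
      proof (cases "z \<in> P h")
        case z: True
        then have "0 \<le> chord h u z" using chord_nonneg[OF z generic_nonzero[OF u]] by simp
        \<comment> \<open>For a positive chord this is an equality; at chord 0 all three terms
          vanish, as \<open>0 powr (q - 1) = 0\<close>.\<close>
        then have "chord h u z powr (q - 1) \<le> powr_weight q (\<delta> k) (chord h u z) + weight_gap q (\<delta> k) (chord h u z)"
          by (auto simp: powr_weight_def weight_gap_def)
        then show ?thesis using z weight_gap_nonneg[of q "\<delta> k"] True \<delta>[of k]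
          by (simp add: powr_weight_nonneg ennreal_leI flip: ennreal_plus)
      qed simp
    qed
    also have "\<dots> = regular_flux q k h u i + facet_flux (weight_gap q (\<delta> k)) h u i"
      unfolding facet_flux_def \<delta>_def by (rule nn_integral_add) measurable
    also have "\<dots> \<le> regular_flux q k h u i + ennreal (C * ((2 * \<delta> k) powr q / q))"
      by (intro add_left_mono C(2) hR u \<delta>)
    finally show "power_flux q h u i \<le> regular_flux q k h u i + ennreal (C * ((2 * \<delta> k) powr q / q))" .
  qed
next
  case False
  show thesis
  proof
    fix h u k assume hR: "P h \<subseteq> cball 0 R" and u: "generic u"
    have "power_flux q h u i \<le> regular_flux q k h u i"
      unfolding power_flux_def facet_flux_def
    proof (rule nn_integral_mono)
      fix z
      show "ennreal (chord h u z powr (q - 1)) * indicator (P h) z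
        \<le> ennreal (powr_weight q (regularisation q k) (chord h u z)) * indicator (P h) z"
        using chord_nonneg[of z h u] generic_nonzero[OF u] False
        by (auto simp: indicator_def powr_weight_def regularisation_def)
    qed
    then show "power_flux q h u i \<le> regular_flux q k h u i + ennreal 0" by simp
  qed auto
qed

text \<open>Supplies the dominating constant for averaging over directions while \<open>h\<close>
  varies.\<close>

lemma power_flux_bounded:
  assumes i: "i < N" and q: "0 < q" and R: "R \<ge> 0"
  obtains C where "C \<ge> 0" "\<And>h u. P h \<subseteq> cball 0 R \<Longrightarrow> generic u \<Longrightarrow> power_flux q h u i \<le> ennreal C"
proof -
  obtain \<epsilon> where \<epsilon>: "\<And>k. \<epsilon> k \<ge> 0"
    "\<And>h u k. P h \<subseteq> cball 0 R \<Longrightarrow> generic u \<Longrightarrow> power_flux q h u i \<le> regular_flux q k h u i + ennreal (\<epsilon> k)"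
    using power_flux_le_regular[OF i q R] by metis
  have "regularisation q 0 \<ge> 0" "regularisation q 0 > 0 \<or> q \<ge> 1" by (auto simp: regularisation_def)
  then obtain M where M: "M \<ge> 0" "\<And>s. s \<le> 2 * R \<Longrightarrow> powr_weight q (regularisation q 0) s \<le> M"
    using powr_weight_bounded[OF q, of "regularisation q 0" "2 * R"] by blast
  obtain A where A: "A \<ge> 0" "\<And>c. emeasure (hyp (v i) c) (cball 0 R) \<le> ennreal A"
    using emeasure_hyp_cball_uniform[OF norm_v[OF i], of R] by metis
  show thesis
  proof
    show "0 \<le> M * A + \<epsilon> 0" using M A \<epsilon>(1) by simp
    fix h u assume hR: "P h \<subseteq> cball 0 R" and u: "generic u"
    have "regular_flux q 0 h u i \<le> (\<integral>\<^sup>+ z. ennreal M * indicator (cball 0 R) z \<partial>hyp (v i) (h i))"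
      unfolding facet_flux_def
    proof (rule nn_integral_mono)
      fix z
      show "ennreal (powr_weight q (regularisation q 0) (chord h u z)) * indicator (P h) z \<le> ennreal M * indicator (cball 0 R) z"
      proof (cases "z \<in> P h")
        case True
        then have "chord h u z \<le> 2 * R"
          using chord_le_diameter(1)[OF u chord_nonneg[OF True generic_nonzero[OF u]] hR] by simp
        then show ?thesis using True hR M(2) by (auto simp: ennreal_leI)
      qed simp
    qed
    also have "\<dots> = ennreal M * emeasure (hyp (v i) (h i)) (cball 0 R)"
      by (rule nn_integral_cmult_indicator) simp
    also have "\<dots> \<le> ennreal M * ennreal A" by (intro mult_left_mono A) simp
    finally have "regular_flux q 0 h u i \<le> ennreal (M * A)" using M(1) by (simp add: ennreal_mult')
    then have "power_flux q h u i \<le> ennreal (M * A) + ennreal (\<epsilon> 0)"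
      using \<epsilon>(2)[OF hR u, of 0] by (meson add_right_mono order_trans)
    then show "power_flux q h u i \<le> ennreal (M * A + \<epsilon> 0)" using M A \<epsilon>(1) by simp
  qed
qed

section \<open>The flux as a real number and its average over directions\<close>

definition real_flux :: "real \<Rightarrow> (nat \<Rightarrow> real) \<Rightarrow> 'a \<Rightarrow> nat \<Rightarrow> real" where
  "real_flux q h u i = enn2real (power_flux q h u i)"

lemma power_flux_eq_real_flux:
  assumes "i < N" "q > 0" "generic u"
  shows "power_flux q h u i = ennreal (real_flux q h u i)"
proof -
  obtain R where R: "R > 0" "P h \<subseteq> cball 0 R" using P_bounded by blast
  obtain C where "\<And>h u. P h \<subseteq> cball 0 R \<Longrightarrow> generic u \<Longrightarrow> power_flux q h u i \<le> ennreal C"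
    using power_flux_bounded[OF assms(1,2), of R] R(1) by (metis less_imp_le)
  then have "power_flux q h u i \<le> ennreal C" using R(2) assms(3) by blast
  then have "power_flux q h u i < top" using order_le_less_trans ennreal_less_top by blast
  then show ?thesis by (simp add: real_flux_def)
qed

lemma real_flux_approx:
  assumes i: "i < N" and q: "0 < q" and R: "R \<ge> 0"
  obtains \<epsilon> where "\<epsilon> \<longlonglongrightarrow> 0"
    "\<And>h u k. P h \<subseteq> cball 0 R \<Longrightarrow> generic u \<Longrightarrow>
       \<bar>real_flux q h u i - slab_flux (powr_weight q (regularisation q k)) h u i / (\<kappa> * \<bar>u \<bullet> v i\<bar>)\<bar> \<le> \<epsilon> k"
proof -
  obtain \<epsilon> where \<epsilon>: "\<epsilon> \<longlonglongrightarrow> 0" "\<And>k. \<epsilon> k \<ge> 0"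
    "\<And>h u k. P h \<subseteq> cball 0 R \<Longrightarrow> generic u \<Longrightarrow> power_flux q h u i \<le> regular_flux q k h u i + ennreal (\<epsilon> k)"
    using power_flux_le_regular[OF i q R] by metis
  show thesis
  proof (rule that[OF \<epsilon>(1)])
    fix h u k assume hR: "P h \<subseteq> cball 0 R" and u: "generic u"
    let ?s = "slab_flux (powr_weight q (regularisation q k)) h u i / (\<kappa> * \<bar>u \<bullet> v i\<bar>)"
    have s0: "0 \<le> ?s" using slab_flux_nonneg[OF chord_weight_regularised[OF q]] \<kappa>_pos by simp
    have s: "regular_flux q k h u i = ennreal ?s"
      by (rule facet_flux_eq_slab_flux[OF u i chord_weight_regularised[OF q]])
    have r0: "0 \<le> real_flux q h u i" by (simp add: real_flux_def)
    note r = power_flux_eq_real_flux[OF i q u, of h]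
    have "?s \<le> real_flux q h u i"
      using regular_flux_le[OF q, of k h u i] r0 unfolding r s by simp
    moreover have "ennreal (real_flux q h u i) \<le> ennreal (?s + \<epsilon> k)"
      using \<epsilon>(3)[OF hR u, of k] unfolding r s ennreal_plus[OF s0 \<epsilon>(2)] .
    then have "real_flux q h u i \<le> ?s + \<epsilon> k"
      by (rule ennreal_le_iff[THEN iffD1, rotated]) (use s0 \<epsilon>(2)[of k] in linarith)
    ultimately show "\<bar>real_flux q h u i - ?s\<bar> \<le> \<epsilon> k" by linarith
  qed
qed

text \<open>For fixed \<open>k\<close> the regularised fluxes converge, and they approximate the
  flux uniformly as long as all polytopes stay in one ball; so the two limits may be
  exchanged.\<close>

lemma real_flux_tendsto:
  assumes u: "generic u" and i: "i < N" and q: "q > 0"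
    and H: "\<And>j. j < N \<Longrightarrow> (\<lambda>n. H n j) \<longlonglongrightarrow> h j"
  shows "(\<lambda>n. real_flux q (H n) u i) \<longlonglongrightarrow> real_flux q h u i"
proof -
  obtain R1 where R1: "R1 > 0" "\<And>n. P (H n) \<subseteq> cball 0 R1" using P_uniformly_bounded[of H h] H by blast
  obtain R2 where R2: "R2 > 0" "P h \<subseteq> cball 0 R2" using P_bounded by blast
  define R where "R = max R1 R2"
  have R: "R \<ge> 0" "P (H n) \<subseteq> cball 0 R" "P h \<subseteq> cball 0 R" for n
    using R1 R2 by (auto simp: R_def subset_iff le_max_iff_disj)
  obtain \<epsilon> where \<epsilon>: "\<epsilon> \<longlonglongrightarrow> 0" "\<And>h u k. P h \<subseteq> cball 0 R \<Longrightarrow> generic u \<Longrightarrow>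
       \<bar>real_flux q h u i - slab_flux (powr_weight q (regularisation q k)) h u i / (\<kappa> * \<bar>u \<bullet> v i\<bar>)\<bar> \<le> \<epsilon> k"
    using real_flux_approx[OF i q R(1)] by metis
  show ?thesis
  proof (rule tendsto_uniform_approx[OF \<epsilon>(1)])
    show "(\<lambda>n. slab_flux (powr_weight q (regularisation q k)) (H n) u i / (\<kappa> * \<bar>u \<bullet> v i\<bar>))
       \<longlonglongrightarrow> slab_flux (powr_weight q (regularisation q k)) h u i / (\<kappa> * \<bar>u \<bullet> v i\<bar>)" for k
      using slab_flux_tendsto[OF u chord_weight_regularised[OF q] i H] u i \<kappa>_pos
      by (intro tendsto_intros) (auto simp: generic_def)
  qed (use \<epsilon>(2) R u in auto)
qed

lemma real_flux_balance:
  assumes u: "generic u" and q: "q > 0"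
  shows "(\<Sum>i<N. (e \<bullet> v i) * real_flux q h u i) = 0"
proof -
  obtain R where R: "R > 0" "P h \<subseteq> cball 0 R" using P_bounded by blast
  define s where "s = (\<lambda>k i. slab_flux (powr_weight q (regularisation q k)) h u i / (\<kappa> * \<bar>u \<bullet> v i\<bar>))"
  have lim: "(\<lambda>k. s k i) \<longlonglongrightarrow> real_flux q h u i" if i: "i < N" for i
  proof -
    obtain \<epsilon> where \<epsilon>: "\<epsilon> \<longlonglongrightarrow> 0" "\<And>h u k. P h \<subseteq> cball 0 R \<Longrightarrow> generic u \<Longrightarrow>
       \<bar>real_flux q h u i - slab_flux (powr_weight q (regularisation q k)) h u i / (\<kappa> * \<bar>u \<bullet> v i\<bar>)\<bar> \<le> \<epsilon> k"
      using real_flux_approx[OF i q, of R] R(1) by (metis less_imp_le)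
    have "\<bar>s k i - real_flux q h u i\<bar> \<le> \<epsilon> k" for k
      using \<epsilon>(2)[OF R(2) u, of k] by (simp add: s_def abs_minus_commute)
    then show ?thesis
      by (intro LIM_zero_cancel[of "\<lambda>k. s k i"] Lim_null_comparison[OF _ \<epsilon>(1)]) simp
  qed
  have "(\<lambda>k. \<Sum>i<N. (e \<bullet> v i) * s k i) \<longlonglongrightarrow> (\<Sum>i<N. (e \<bullet> v i) * real_flux q h u i)"
    using lim by (intro tendsto_sum tendsto_mult tendsto_const) auto
  moreover have "(\<Sum>i<N. (e \<bullet> v i) * s k i) = 0" for k
  proof -
    \<comment> \<open>The factor 1 / |u . v i| from projecting the i-th facet is the weight
      occurring in \<open>slab_flux_balance\<close>, and \<kappa> comes out as a common
      factor.\<close>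
    have "(\<Sum>i<N. (e \<bullet> v i) * s k i)
      = (\<Sum>i<N. ((e \<bullet> v i) / \<bar>u \<bullet> v i\<bar>) * slab_flux (powr_weight q (regularisation q k)) h u i) / \<kappa>"
      by (simp add: s_def sum_divide_distrib field_simps)
    then show ?thesis
      unfolding slab_flux_balance[OF u chord_weight_regularised[OF q] weight_primitive_regularised[OF q]] by simp
  qed
  ultimately show ?thesis by (simp add: tendsto_const_iff)
qed

lemma AE_sph_generic: "AE u in sph. generic u"
proof -
  have "AE u in sph. \<forall>j\<in>{..<N}. u \<bullet> v j \<noteq> 0"
    using AE_sph_inner_neq_0 norm_v by (intro AE_finite_allI) auto
  with AE_sph_norm show ?thesis by eventually_elim (auto simp: generic_def)
qed

lemma power_flux_measurable:
  assumes i: "i < N"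
  shows "(\<lambda>u. power_flux q h u i) \<in> borel_measurable borel"
proof -
  interpret sigma_finite_measure "hyp (v i) (h i)" by (rule sigma_finite_hyp[OF dim norm_v[OF i]])
  show ?thesis
    unfolding power_flux_def facet_flux_def by (rule borel_measurable_nn_integral) measurable
qed

text \<open>Up to a constant the F_q-mass of the i-th facet, with the integral over directions
  outermost.\<close>

definition total_flux :: "real \<Rightarrow> (nat \<Rightarrow> real) \<Rightarrow> nat \<Rightarrow> real" where
  "total_flux q h i = (LINT u|sph. real_flux q h u i)"

lemma real_flux_nonneg: "0 \<le> real_flux q h u i"
  by (simp add: real_flux_def)

lemma total_flux_nonneg: "0 \<le> total_flux q h i"
  unfolding total_flux_def by (intro integral_nonneg_AE AE_I2 real_flux_nonneg)

lemma real_flux_measurable: "i < N \<Longrightarrow> (\<lambda>u. real_flux q h u i) \<in> borel_measurable borel"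
  unfolding real_flux_def using power_flux_measurable by simp

lemma real_flux_bounded:
  assumes i: "i < N" and q: "0 < q" and R: "R \<ge> 0"
  obtains C where "C \<ge> 0" "\<And>h u. P h \<subseteq> cball 0 R \<Longrightarrow> generic u \<Longrightarrow> real_flux q h u i \<le> C"
proof -
  obtain C where C: "C \<ge> 0" "\<And>h u. P h \<subseteq> cball 0 R \<Longrightarrow> generic u \<Longrightarrow> power_flux q h u i \<le> ennreal C"
    using power_flux_bounded[OF assms] by metis
  have "real_flux q h u i \<le> C" if "P h \<subseteq> cball 0 R" "generic u" for h u
    using C(2)[OF that] C(1) unfolding power_flux_eq_real_flux[OF i q that(2)] by (simp add: ennreal_le_iff)
  with C(1) show thesis by (rule that)
qed

lemma integrable_real_flux:
  assumes i: "i < N" and q: "q > 0"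
  shows "integrable sph (\<lambda>u. real_flux q h u i)"
proof -
  interpret finite_measure "sph :: 'a measure" by (rule finite_measure_sph[OF dim])
  obtain R where R: "R > 0" "P h \<subseteq> cball 0 R" using P_bounded by blast
  obtain C where C: "\<And>h u. P h \<subseteq> cball 0 R \<Longrightarrow> generic u \<Longrightarrow> real_flux q h u i \<le> C"
    using real_flux_bounded[OF i q, of R] R(1) by (metis less_imp_le)
  show ?thesis
  proof (rule integrable_const_bound[where B=C])
    show "AE u in sph. norm (real_flux q h u i) \<le> C"
      using AE_sph_generic by eventually_elim (use C[OF R(2)] in \<open>auto simp: real_flux_nonneg\<close>)
  qed (simp add: real_flux_measurable[OF i])
qed

lemma nn_integral_power_flux:
  assumes i: "i < N" and q: "q > 0"
  shows "(\<integral>\<^sup>+ u. power_flux q h u i \<partial>sph) = ennreal (total_flux q h i)"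
proof -
  have "(\<integral>\<^sup>+ u. power_flux q h u i \<partial>sph) = (\<integral>\<^sup>+ u. ennreal (real_flux q h u i) \<partial>sph)"
    using AE_sph_generic by (intro nn_integral_cong_AE) (auto elim!: eventually_mono simp: power_flux_eq_real_flux[OF i q])
  also have "\<dots> = ennreal (total_flux q h i)"
    unfolding total_flux_def
    by (rule nn_integral_eq_integral[OF integrable_real_flux[OF i q]]) (simp add: real_flux_nonneg)
  finally show ?thesis .
qed

lemma total_flux_tendsto:
  assumes i: "i < N" and q: "q > 0" and H: "\<And>j. j < N \<Longrightarrow> (\<lambda>n. H n j) \<longlonglongrightarrow> h j"
  shows "(\<lambda>n. total_flux q (H n) i) \<longlonglongrightarrow> total_flux q h i"
proof -
  interpret finite_measure "sph :: 'a measure" by (rule finite_measure_sph[OF dim])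
  obtain R where R: "R > 0" "\<And>n. P (H n) \<subseteq> cball 0 R" using P_uniformly_bounded[of H h] H by blast
  obtain C where C: "\<And>h u. P h \<subseteq> cball 0 R \<Longrightarrow> generic u \<Longrightarrow> real_flux q h u i \<le> C"
    using real_flux_bounded[OF i q, of R] R(1) by (metis less_imp_le)
  show ?thesis
    unfolding total_flux_def
  proof (rule integral_dominated_convergence[where w="\<lambda>_. C"])
    show "AE u in sph. (\<lambda>n. real_flux q (H n) u i) \<longlonglongrightarrow> real_flux q h u i"
      using AE_sph_generic by eventually_elim (rule real_flux_tendsto[OF _ i q H])
    show "AE u in sph. norm (real_flux q (H n) u i) \<le> C" for n
      using AE_sph_generic by eventually_elim (use C[OF R(2)] in \<open>auto simp: real_flux_nonneg\<close>)
  qed (simp_all add: real_flux_measurable[OF i])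
qed

lemma total_flux_balance:
  assumes q: "q > 0"
  shows "(\<Sum>i<N. total_flux q h i *\<^sub>R v i) = 0"
proof -
  have "e \<bullet> (\<Sum>i<N. total_flux q h i *\<^sub>R v i) = 0" for e
  proof -
    have "e \<bullet> (\<Sum>i<N. total_flux q h i *\<^sub>R v i) = (\<Sum>i<N. (e \<bullet> v i) * total_flux q h i)"
      by (simp add: inner_sum_right mult.commute)
    also have "\<dots> = (LINT u|sph. (\<Sum>i<N. (e \<bullet> v i) * real_flux q h u i))"
      unfolding total_flux_def using integrable_real_flux[OF _ q]
      by (subst Bochner_Integration.integral_sum) auto
    also have "\<dots> = (LINT u|(sph :: 'a measure). (0::real))"
    proof (rule integral_cong_AE)
      show "(\<lambda>u. \<Sum>i<N. (e \<bullet> v i) * real_flux q h u i) \<in> borel_measurable sph"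
        unfolding borel_measurable_sph
        by (intro borel_measurable_sum borel_measurable_times) (auto simp: real_flux_measurable)
      show "AE u in sph. (\<Sum>i<N. (e \<bullet> v i) * real_flux q h u i) = 0"
        using AE_sph_generic by eventually_elim (rule real_flux_balance[OF _ q])
    qed simp
    finally show ?thesis by simp
  qed
  from this[of "\<Sum>i<N. total_flux q h i *\<^sub>R v i"] show ?thesis by simp
qed

end

section \<open>Chord integrals over the facets\<close>

context facet_normals begin

lemma exit_time_scale:
  assumes "s > 0" "u \<noteq> 0"
  shows "exit_time (\<lambda>j. s * h j) u (s *\<^sub>R x) = s * exit_time h u x"
proof -
  have cr: "crossing (\<lambda>j. s * h j) u (s *\<^sub>R x) j = s * crossing h u x j" for j
    by (simp add: crossing_def right_diff_distrib)
  have "mono (\<lambda>t. s * t)" using assms(1) by (intro monoI mult_left_mono) auto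
  then have "s * Min (crossing h u x ` up u) = Min ((\<lambda>t. s * t) ` crossing h u x ` up u)"
    using up_nonempty[OF assms(2)] by (intro mono_Min_commute) auto
  then show ?thesis by (simp add: exit_time_def cr image_image)
qed

lemma chord_scale:
  "s > 0 \<Longrightarrow> u \<noteq> 0 \<Longrightarrow> chord (\<lambda>j. s * h j) u (s *\<^sub>R x) = s * chord h u x"
  by (simp add: chord_def exit_time_scale distrib_left)

lemma P_scale: "s > 0 \<Longrightarrow> s *\<^sub>R x \<in> P (\<lambda>j. s * h j) \<longleftrightarrow> x \<in> P h"
  by (simp add: mem_P)

text \<open>Area contributes the exponent n - 1, the chord weight q - 1.\<close>

lemma power_flux_scale:
  assumes s: "s > 0" and u: "u \<noteq> 0"
  shows "power_flux q (\<lambda>j. s * h j) u i = ennreal (s powr (real DIM('a) + q - 2)) * power_flux q h u i"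
proof -
  let ?d = "real DIM('a) - 1"
  let ?g = "\<lambda>h z. ennreal (chord h u z powr (q - 1)) * indicator (P h) z * indicator {x. x \<bullet> v i = h i} z"
  have m: "(\<lambda>z. ennreal (chord h u z powr (q - 1)) * indicator (P h) z) \<in> borel_measurable borel" for h
    by measurable
  have eq: "power_flux q h u i = (\<integral>\<^sup>+ z. ?g h z \<partial>hmeas)" for h
    unfolding power_flux_def facet_flux_def by (rule nn_integral_hyp[OF m])
  have g: "?g (\<lambda>j. s * h j) (s *\<^sub>R z) = ennreal (s powr (q - 1)) * ?g h z" for z
  proof (cases "z \<in> P h")
    case True
    then have "(s * chord h u z) powr (q - 1) = s powr (q - 1) * chord h u z powr (q - 1)"
      using s chord_nonneg[OF True u] by (intro powr_mult)
    then show ?thesis using s True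
      by (simp add: chord_scale[OF s u] P_scale[OF s] indicator_def ennreal_mult')
  next
    case False
    then show ?thesis using P_scale[OF s] by (simp add: indicator_def)
  qed
  have surj: "surj ((*\<^sub>R) s :: 'a \<Rightarrow> 'a)"
    using s by (intro surjI[of _ "\<lambda>x. (1 / s) *\<^sub>R x"]) simp
  have "power_flux q (\<lambda>j. s * h j) u i = (\<integral>\<^sup>+ z. ?g (\<lambda>j. s * h j) z \<partial>hausdorff_measure ?d)"
    unfolding eq hmeas_def ..
  also have "\<dots> = ennreal (s powr ?d) * (\<integral>\<^sup>+ z. ?g (\<lambda>j. s * h j) (s *\<^sub>R z) \<partial>hausdorff_measure ?d)"
    by (rule nn_integral_hausdorff_similarity[where r=s])
       (use s surj dim in \<open>auto simp: dist_norm scaleR_diff_right[symmetric]\<close>)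
  also have "\<dots> = ennreal (s powr ?d) * (\<integral>\<^sup>+ z. ennreal (s powr (q - 1)) * ?g h z \<partial>hmeas)"
    unfolding g hmeas_def ..
  also have "\<dots> = ennreal (s powr ?d) * (ennreal (s powr (q - 1)) * power_flux q h u i)"
    unfolding eq by (subst nn_integral_cmult) auto
  also have "\<dots> = ennreal (s powr ?d * s powr (q - 1)) * power_flux q h u i"
    by (simp add: ennreal_mult' mult.assoc)
  also have "s powr ?d * s powr (q - 1) = s powr (real DIM('a) + q - 2)"
    by (simp add: powr_add[symmetric])
  finally show ?thesis .
qed

lemma total_flux_scale:
  assumes i: "i < N" and q: "q > 0" and s: "s > 0"
  shows "total_flux q (\<lambda>j. s * h j) i = s powr (real DIM('a) + q - 2) * total_flux q h i"
proof -
  have "ennreal (total_flux q (\<lambda>j. s * h j) i) = (\<integral>\<^sup>+ u. ennreal (s powr (real DIM('a) + q - 2)) * power_flux q h u i \<partial>sph)"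
    unfolding nn_integral_power_flux[OF i q, symmetric]
    using AE_sph_generic by (intro nn_integral_cong_AE) (auto elim!: eventually_mono simp: power_flux_scale[OF s] generic_nonzero)
  also have "\<dots> = ennreal (s powr (real DIM('a) + q - 2)) * ennreal (total_flux q h i)"
    unfolding nn_integral_power_flux[OF i q, symmetric]
    by (rule nn_integral_cmult) (simp add: power_flux_measurable[OF i])
  also have "\<dots> = ennreal (s powr (real DIM('a) + q - 2) * total_flux q h i)"
    by (simp add: ennreal_mult')
  finally show ?thesis
    by (subst (asm) ennreal_inj) (auto simp: total_flux_nonneg)
qed

section \<open>Vanishing and positivity of the total flux\<close>

lemma total_flux_missing_facet:
  assumes i: "i < N" and q: "q > 0" and "\<And>z. z \<in> P h \<Longrightarrow> z \<bullet> v i \<noteq> h i"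
  shows "total_flux q h i = 0"
proof -
  have "power_flux q h u i = 0" for u
  proof -
    have "power_flux q h u i = (\<integral>\<^sup>+ z. 0 \<partial>hyp (v i) (h i))"
      unfolding power_flux_def facet_flux_def
      using AE_hyp[of "v i" "h i"] assms(3) by (intro nn_integral_cong_AE) (auto elim!: eventually_mono simp: indicator_def)
    then show ?thesis by simp
  qed
  then have "ennreal (total_flux q h i) = 0"
    using nn_integral_power_flux[OF i q, of h] by simp
  then show ?thesis using total_flux_nonneg[of q h i] by (simp add: ennreal_eq_0_iff)
qed

lemma ball_subset_P:
  assumes "\<And>j. j < N \<Longrightarrow> r \<le> h j"
  shows "cball 0 r \<subseteq> P h"
proof
  fix x assume x: "x \<in> cball (0::'a) r"
  have "x \<bullet> v j \<le> h j" if j: "j < N" for j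
    using norm_cauchy_schwarz[of x "v j"] norm_v[OF j] x assms[OF j] by simp
  then show "x \<in> P h" by (simp add: mem_P)
qed

lemma positive_lower_bound:
  fixes h :: "nat \<Rightarrow> real"
  assumes "\<And>j. j < N \<Longrightarrow> h j > 0"
  obtains r where "r > 0" "\<And>j. j < N \<Longrightarrow> r \<le> h j"
proof
  show "Min (insert 1 (h ` {..<N})) > (0::real)" using assms by (subst Min_gr_iff) auto
qed auto

text \<open>If all facet fluxes vanished, almost no line of direction \<open>u\<close> would meet
  \<open>P h\<close>, although \<open>P h\<close> contains a ball around the origin.\<close>

lemma slab_flux_pos:
  assumes u: "generic u" and h: "\<And>j. j < N \<Longrightarrow> h j > 0"
    and g: "chord_weight g" and gpos: "\<And>s. s > 0 \<Longrightarrow> g s > 0"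
  shows "\<exists>i<N. slab_flux g h u i > 0"
proof (rule ccontr)
  assume "\<not> ?thesis"
  then have z: "slab_flux g h u i = 0" if "i < N" for i
    using slab_flux_nonneg[OF g, of h u i] that by force
  have u0: "u \<noteq> 0" and uu: "u \<bullet> u = 1" "norm u = 1" using u by (auto simp: generic_def dot_square_norm)
  have "AE x in lborel. g (chord h u x) * indicator (active h u i \<inter> slab u) x = 0" if i: "i < N" for i
    using z[OF i] unfolding slab_flux_def
    by (subst (asm) integral_nonneg_eq_0_iff_AE[OF integrable_slab_flux[OF u g]])
       (use g in \<open>auto simp: chord_weight_def\<close>)
  then have "AE x in lborel. \<forall>i\<in>{..<N}. g (chord h u x) * indicator (active h u i \<inter> slab u) x = 0"
    by (intro AE_finite_allI) auto
  with AE_crossing_distinct[OF u, of h]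
  have AE0: "AE x in lborel. \<not> (x \<in> slab u \<and> (\<exists>t. x + t *\<^sub>R u \<in> P h))"
  proof eventually_elim
    fix x assume dist: "\<forall>i<N. \<forall>j<N. i \<noteq> j \<longrightarrow> crossing h u x i \<noteq> crossing h u x j"
      and zero: "\<forall>i\<in>{..<N}. g (chord h u x) * indicator (active h u i \<inter> slab u) x = 0"
    show "\<not> (x \<in> slab u \<and> (\<exists>t. x + t *\<^sub>R u \<in> P h))"
    proof
      assume a: "x \<in> slab u \<and> (\<exists>t. x + t *\<^sub>R u \<in> P h)"
      then have nn: "chord h u x \<ge> 0" by (auto simp: line_mem_P[OF u] chord_def)
      obtain k where k: "k \<in> up u" "exit_time h u x = crossing h u x k"
        using exit_time_attained[OF u0] by blast
      obtain m where m: "m \<in> up (- u)" "exit_time h (- u) x = - crossing h u x m"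
        using exit_time_uminus_attained[OF u0] by blast
      have km: "k < N" "m < N" "k \<noteq> m" using k(1) m(1) by (auto simp: up_def)
      have "chord h u x \<noteq> 0" using dist km k m by (auto simp: chord_def)
      then have pos: "chord h u x > 0" using nn by simp
      have "x \<in> active h u k" using active_generic[OF u dist k m km(1)] pos by simp
      then show False using zero a km(1) gpos[OF pos] by (auto simp: indicator_def)
    qed
  qed
  obtain r where r: "r > 0" "\<And>j. j < N \<Longrightarrow> r \<le> h j" using positive_lower_bound[of h] h by blast
  \<comment> \<open>The centre u / 2 lies in the middle of the slab and is moved to the origin by t
    = -1/2. The bound 1/2 keeps the ball in the slab, the bound \<open>r\<close> keeps the moved
    ball in the polytope.\<close>
  define c where "c = min r (1/2)"
  have sub: "ball ((1/2) *\<^sub>R u) c \<subseteq> {x. x \<in> slab u \<and> (\<exists>t. x + t *\<^sub>R u \<in> P h)}"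
  proof
    fix x assume "x \<in> ball ((1/2) *\<^sub>R u) c"
    then have y: "norm (x - (1/2) *\<^sub>R u) < c" by (simp add: dist_norm norm_minus_commute)
    have "\<bar>(x - (1/2) *\<^sub>R u) \<bullet> u\<bar> \<le> norm (x - (1/2) *\<^sub>R u) * norm u" by (rule Cauchy_Schwarz_ineq2)
    then have "\<bar>x \<bullet> u - 1/2\<bar> < 1/2" using y uu by (simp add: inner_diff_left c_def)
    then have "x \<in> slab u" unfolding slab_def mem_Collect_eq by linarith
    moreover have "x + (- 1/2) *\<^sub>R u \<in> cball 0 r" using y by (simp add: c_def)
    then have "x + (- 1/2) *\<^sub>R u \<in> P h" using ball_subset_P[of r h] r by blast
    ultimately show "x \<in> {x. x \<in> slab u \<and> (\<exists>t. x + t *\<^sub>R u \<in> P h)}" by blast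
  qed
  have "AE x in lborel. x \<notin> ball ((1/2) *\<^sub>R u) c" using AE0 by eventually_elim (use sub in blast)
  then have "emeasure lborel (ball ((1/2) *\<^sub>R u) c) = 0"
    by (subst (asm) AE_iff_measurable[where N="ball ((1/2) *\<^sub>R u) c"]) auto
  moreover have "ball ((1/2) *\<^sub>R u) c \<noteq> {}" using r by (simp add: c_def)
  ultimately show False
    using open_not_negligible[of "ball ((1/2) *\<^sub>R u) c"]
    by (simp add: negligible_iff_null_sets null_sets_completion_iff null_sets_def)
qed

lemma total_flux_pos:
  assumes h: "\<And>j. j < N \<Longrightarrow> h j > 0" and q: "q > 0"
  shows "\<exists>i<N. total_flux q h i > 0"
proof (rule ccontr)
  assume "\<not> ?thesis"
  then have z: "total_flux q h i = 0" if "i < N" for i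
    using total_flux_nonneg[of q h i] that by force
  have "AE u in sph. power_flux q h u i = 0" if i: "i < N" for i
    using nn_integral_power_flux[OF i q, of h] z[OF i] power_flux_measurable[OF i, of q h]
    by (simp add: nn_integral_0_iff_AE)
  then have "AE u in sph. \<forall>i\<in>{..<N}. power_flux q h u i = 0"
    by (intro AE_finite_allI) auto
  \<comment> \<open>A statement that is false everywhere yet holds almost everywhere, against the
    positive total mass of the sphere.\<close>
  with AE_sph_generic have "AE u in sph. u \<noteq> (u :: 'a)"
  proof eventually_elim
    fix u assume u: "generic u" and zero: "\<forall>i\<in>{..<N}. power_flux q h u i = 0"
    have "\<exists>i<N. slab_flux (powr_weight q (regularisation q 0)) h u i > 0"
      by (rule slab_flux_pos[OF u h chord_weight_regularised[OF q]])
         (auto simp: powr_weight_def regularisation_def)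
    then obtain i where i: "i < N" "slab_flux (powr_weight q (regularisation q 0)) h u i > 0" by blast
    have "regular_flux q 0 h u i = 0" using regular_flux_le[OF q, of 0 h u i] zero i by auto
    then have "slab_flux (powr_weight q (regularisation q 0)) h u i / (\<kappa> * \<bar>u \<bullet> v i\<bar>) \<le> 0"
      unfolding facet_flux_eq_slab_flux[OF u i(1) chord_weight_regularised[OF q]] by (simp add: ennreal_eq_0_iff)
    moreover have "\<kappa> * \<bar>u \<bullet> v i\<bar> > 0" using i u \<kappa>_pos by (simp add: generic_def)
    from divide_pos_pos[OF i(2) this]
    have "slab_flux (powr_weight q (regularisation q 0)) h u i / (\<kappa> * \<bar>u \<bullet> v i\<bar>) > 0" .
    ultimately show "u \<noteq> u" by linarith
  qed
  then have "emeasure (sph :: 'a measure) UNIV = 0"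
    by (subst (asm) AE_iff_measurable[where N=UNIV]) auto
  then show False using emeasure_sph_pos[OF dim] by simp
qed

lemma emeasure_ridge:
  assumes "i < N" "j < N" "i \<noteq> j"
  shows "emeasure hmeas {x. x \<bullet> v i = a \<and> x \<bullet> v j = b} = 0"
proof -
  have "v j \<noteq> (v i \<bullet> v j) *\<^sub>R v i" using assms by (intro not_parallel) auto
  then have "v j - (v i \<bullet> v j) *\<^sub>R v i \<noteq> 0" by simp
  from emeasure_hyp_hyperplane[OF norm_v[OF assms(1)] this, of a b]
  have "hausdorff_outer (real DIM('a) - 1) ({x. x \<bullet> v j = b} \<inter> {x. x \<bullet> v i = a}) = 0"
    by (simp add: emeasure_hyp)
  moreover have "{x. x \<bullet> v j = b} \<inter> {x. x \<bullet> v i = a} = {x. x \<bullet> v i = a \<and> x \<bullet> v j = b}" by auto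
  moreover have "{x::'a. x \<bullet> v i = a \<and> x \<bullet> v j = b} \<in> sets borel" by measurable
  ultimately show ?thesis by (simp add: hmeas_def emeasure_hausdorff_measure)
qed

text \<open>Together with \<open>outer_normal_facet\<close> this makes the outer normal unique at
  almost every boundary point.\<close>

lemma AE_one_facet:
  "AE z in hmeas. \<forall>i<N. \<forall>j<N. i \<noteq> j \<longrightarrow> \<not> (z \<bullet> v i = h i \<and> z \<bullet> v j = h j)"
proof -
  have "AE z in hmeas. i \<noteq> j \<longrightarrow> \<not> (z \<bullet> v i = h i \<and> z \<bullet> v j = h j)" if ij: "i < N" "j < N" for i j
  proof (cases "i = j")
    case False
    then show ?thesis
      using emeasure_ridge[OF ij False, of "h i" "h j"]
      by (intro AE_I[where N="{x. x \<bullet> v i = h i \<and> x \<bullet> v j = h j}"]) auto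
  qed simp
  then have "AE z in hmeas. \<forall>i\<in>{..<N}. \<forall>j\<in>{..<N}. i \<noteq> j \<longrightarrow> \<not> (z \<bullet> v i = h i \<and> z \<bullet> v j = h j)"
    by (intro AE_finite_allI) auto
  then show ?thesis by eventually_elim auto
qed

section \<open>Boundary points of the polytope and their normals\<close>

lemma interior_P:
  assumes "\<And>j. j < N \<Longrightarrow> z \<bullet> v j < h j"
  shows "z \<in> interior (P h)"
proof -
  have "open (\<Inter>j\<in>{..<N}. {x. v j \<bullet> x < h j})" by (intro open_INT ballI open_halfspace_lt) auto
  moreover have "(\<Inter>j\<in>{..<N}. {x. v j \<bullet> x < h j}) \<subseteq> P h" by (fastforce simp: mem_P inner_commute intro: less_imp_le)
  moreover have "z \<in> (\<Inter>j\<in>{..<N}. {x. v j \<bullet> x < h j})" using assms by (auto simp: inner_commute)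
  ultimately show ?thesis by (meson interiorI)
qed

lemma facet_subset_frontier:
  assumes i: "i < N" and z: "z \<in> P h" "z \<bullet> v i = h i"
  shows "z \<in> frontier (P h)"
proof -
  have "z \<notin> interior (P h)"
  proof
    assume "z \<in> interior (P h)"
    then obtain e where e: "e > 0" "cball z e \<subseteq> P h" by (auto simp: mem_interior_cball)
    have "z + e *\<^sub>R v i \<in> cball z e" using e norm_v[OF i] by (simp add: dist_norm)
    then have "(z + e *\<^sub>R v i) \<bullet> v i \<le> h i" using e i by (auto simp: mem_P)
    then show False using z e norm_v[OF i] by (simp add: inner_add_left dot_square_norm)
  qed
  then show ?thesis using z closure_subset by (auto simp: frontier_def)
qed

lemma frontier_P_facet:
  assumes "z \<in> frontier (P h)"
  shows "z \<in> P h" and "\<exists>i<N. z \<bullet> v i = h i"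
proof -
  show z: "z \<in> P h" using assms closed_P by (simp add: frontier_def)
  show "\<exists>i<N. z \<bullet> v i = h i"
  proof (rule ccontr)
    assume "\<not> ?thesis"
    then have "z \<bullet> v j < h j" if "j < N" for j using z that by (force simp: mem_P order_less_le)
    then show False using interior_P[of z h] assms by (simp add: frontier_def)
  qed
qed

text \<open>At a point on a single facet every direction of the half-space d . v i \<le> 0 leads
  into the polytope for a short time, and \<open>v i\<close> is the only unit vector with
  nonpositive product against all of them.\<close>

lemma outer_normal_facet:
  assumes i: "i < N" and z: "z \<in> P h" "z \<bullet> v i = h i" and one: "\<And>j. j < N \<Longrightarrow> j \<noteq> i \<Longrightarrow> z \<bullet> v j \<noteq> h j"
  shows "outer_normal (P h) z w \<longleftrightarrow> w = v i"
proof
  assume "w = v i"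
  then show "outer_normal (P h) z w"
    using i z norm_v[OF i] by (auto simp: outer_normal_def mem_P inner_diff_left)
next
  assume w: "outer_normal (P h) z w"
  have strict: "z \<bullet> v j < h j" if "j < N" "j \<noteq> i" for j
    using z(1) one that by (force simp: mem_P order_less_le)
  have ii: "v i \<bullet> v i = 1" using norm_v[OF i] by (simp add: dot_square_norm)
  have dir: "d \<bullet> w \<le> 0" if d: "d \<bullet> v i \<le> 0" for d
  proof -
    have "\<exists>e>0. \<forall>j\<in>{..<N}. (z + e *\<^sub>R d) \<bullet> v j \<le> h j"
    proof -
      have "\<forall>\<^sub>F e in at_right (0::real). (z + e *\<^sub>R d) \<bullet> v j \<le> h j" if j: "j \<in> {..<N}" for j
      proof (cases "j = i")
        case True
        have "\<forall>\<^sub>F e in at_right (0::real). e > 0" by (simp add: eventually_at_right_less)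
        then show ?thesis
          by eventually_elim (use True d z in \<open>simp add: inner_add_left mult_nonneg_nonpos\<close>)
      next
        case False
        have "((\<lambda>e. (z + e *\<^sub>R d) \<bullet> v j) \<longlongrightarrow> (z + 0 *\<^sub>R d) \<bullet> v j) (at_right 0)"
          by (intro tendsto_intros)
        then have "\<forall>\<^sub>F e in at_right (0::real). (z + e *\<^sub>R d) \<bullet> v j < h j"
          using strict False j by (intro order_tendstoD(2)) auto
        then show ?thesis by eventually_elim simp
      qed
      then have "\<forall>\<^sub>F e in at_right (0::real). \<forall>j\<in>{..<N}. (z + e *\<^sub>R d) \<bullet> v j \<le> h j"
        by (intro eventually_ball_finite) auto
      moreover have "\<forall>\<^sub>F e in at_right (0::real). e > 0" by (simp add: eventually_at_right_less)
      ultimately have "\<forall>\<^sub>F e in at_right (0::real). e > 0 \<and> (\<forall>j\<in>{..<N}. (z + e *\<^sub>R d) \<bullet> v j \<le> h j)"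
        by eventually_elim simp
      from eventually_happens'[OF trivial_limit_at_right_real this] show ?thesis by blast
    qed
    then obtain e where e: "e > 0" "\<forall>j\<in>{..<N}. (z + e *\<^sub>R d) \<bullet> v j \<le> h j" by blast
    then have "z + e *\<^sub>R d \<in> P h" by (auto simp: mem_P)
    then have "(z + e *\<^sub>R d - z) \<bullet> w \<le> 0" using w by (auto simp: outer_normal_def)
    then show ?thesis using e(1) by (simp add: mult_le_0_iff)
  qed
  \<comment> \<open>Testing with the tangential part of \<open>w\<close> shows that \<open>w\<close>
    is a multiple of \<open>v i\<close>; testing with \<open>- v i\<close> fixes the sign.\<close>
  define d where "d = w - (w \<bullet> v i) *\<^sub>R v i"
  have dv: "d \<bullet> v i = 0" by (simp add: d_def inner_diff_left ii)
  have "d \<bullet> d = d \<bullet> w" by (simp add: d_def[of] inner_diff_right) (simp add: dv inner_diff_right d_def[symmetric])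
  also have "\<dots> \<le> 0" by (rule dir) (simp add: dv)
  finally have "d \<bullet> d = 0" using inner_ge_zero[of d] by linarith
  then have "d = 0" by simp
  then have wv: "w = (w \<bullet> v i) *\<^sub>R v i" by (simp add: d_def)
  have "norm w = 1" using w by (simp add: outer_normal_def)
  then have "\<bar>w \<bullet> v i\<bar> = 1" using arg_cong[OF wv, of norm] norm_v[OF i] by simp
  moreover have "(- v i) \<bullet> w \<le> 0" by (rule dir) (simp add: ii)
  then have "w \<bullet> v i \<ge> 0" by (simp add: inner_commute)
  ultimately have "w \<bullet> v i = 1" by simp
  then show "w = v i" using wv by simp
qed

text \<open>Directions with zero radial function drop out by themselves because
  \<open>0 powr s = 0\<close>, so the integral may run over the whole sphere.\<close>

lemma Vtilde_P:
  assumes z: "z \<in> P h"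
  shows "Vtilde s (P h) z = ennreal (1 / real DIM('a)) * (\<integral>\<^sup>+ u. ennreal (exit_time h u z powr s) \<partial>sph)"
proof -
  have "(\<integral>\<^sup>+ u \<in> {u \<in> sphere 0 1. radial_fun (P h) z u > 0}. ennreal (radial_fun (P h) z u powr s)
          \<partial>hausdorff_measure (real DIM('a) - 1))
      = (\<integral>\<^sup>+ u. ennreal (exit_time h u z powr s) * indicator (sphere 0 1) u \<partial>hmeas)"
    unfolding hmeas_def
  proof (rule nn_integral_cong)
    fix u
    show "ennreal (radial_fun (P h) z u powr s) * indicator {u \<in> sphere 0 1. radial_fun (P h) z u > 0} u
        = ennreal (exit_time h u z powr s) * indicator (sphere 0 1) u"
    proof (cases "norm u = 1")
      case True
      then have "u \<noteq> 0" by auto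
      then show ?thesis using True radial_fun_P[OF z, of u] exit_time_nonneg[OF z, of u]
        by (cases "exit_time h u z = 0") (auto simp: indicator_def)
    qed (simp add: indicator_def)
  qed
  also have "\<dots> = (\<integral>\<^sup>+ u. ennreal (exit_time h u z powr s) \<partial>sph)"
    by (rule nn_integral_sph[symmetric]) measurable
  finally show ?thesis by (simp add: Vtilde_def)
qed

text \<open>From a facet every chord leaves in exactly one of the two directions \<open>u\<close> and \<open>- u\<close>.\<close>
lemma Vtilde_facet:
  assumes i: "i < N" and z: "z \<in> P h" "z \<bullet> v i = h i"
  shows "Vtilde s (P h) z = ennreal (1 / (2 * real DIM('a))) * (\<integral>\<^sup>+ u. ennreal (chord h u z powr s) \<partial>sph)"
proof -
  let ?I = "\<integral>\<^sup>+ u. ennreal (exit_time h u z powr s) \<partial>sph"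
  have aux: "exit_time h (- u) z = 0" if "u \<bullet> v i < 0" for u
  proof -
    have "exit_time h (- u) z \<le> crossing h (- u) z i"
      using i that by (intro exit_time_le) (simp add: up_def)
    moreover have "0 \<le> exit_time h (- u) z" using that by (intro exit_time_nonneg[OF z(1)]) auto
    ultimately show ?thesis using z(2) by (simp add: crossing_def)
  qed
  have "(\<integral>\<^sup>+ u. ennreal (chord h u z powr s) \<partial>sph)
      = (\<integral>\<^sup>+ u. ennreal (exit_time h u z powr s) + ennreal (exit_time h (- u) z powr s) \<partial>sph)"
  proof (rule nn_integral_cong_AE)
    show "AE u in sph. ennreal (chord h u z powr s) = ennreal (exit_time h u z powr s) + ennreal (exit_time h (- u) z powr s)"
      using AE_sph_inner_neq_0[OF norm_v[OF i]]
    proof eventually_elim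
      fix u assume "u \<bullet> v i \<noteq> 0"
      then have "exit_time h (- u) z = 0 \<or> exit_time h u z = 0"
        using aux[of u] aux[of "- u"] by (cases "u \<bullet> v i < 0") auto
      then show "ennreal (chord h u z powr s) = ennreal (exit_time h u z powr s) + ennreal (exit_time h (- u) z powr s)"
        by (auto simp: chord_def)
    qed
  qed
  also have "\<dots> = ?I + (\<integral>\<^sup>+ u. ennreal (exit_time h (- u) z powr s) \<partial>sph)"
    by (rule nn_integral_add) measurable
  also have "(\<integral>\<^sup>+ u. ennreal (exit_time h (- u) z powr s) \<partial>sph) = ?I"
    by (rule nn_integral_sph_uminus) measurable
  finally have eq: "(\<integral>\<^sup>+ u. ennreal (chord h u z powr s) \<partial>sph) = ?I + ?I" .
  have "ennreal (1 / (2 * real DIM('a))) * (\<integral>\<^sup>+ u. ennreal (chord h u z powr s) \<partial>sph)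
      = ennreal (1 / (2 * real DIM('a))) * (ennreal 2 * ?I)" by (simp only: eq ennreal_numeral mult_2)
  also have "\<dots> = (ennreal (1 / (2 * real DIM('a))) * ennreal 2) * ?I" by (simp only: mult.assoc)
  also have "ennreal (1 / (2 * real DIM('a))) * ennreal 2 = ennreal (1 / real DIM('a))"
    by (subst ennreal_mult[symmetric]) auto
  finally show ?thesis unfolding Vtilde_P[OF z(1)] ..
qed

text \<open>Exchanging the integrals over facet and directions makes \<open>power_flux\<close> the
  inner integral. The factor 2n collects the 1/n of \<open>Vtilde\<close> and the halving by
  antipodal directions.\<close>

lemma nn_integral_facet_Vtilde:
  assumes i: "i < N" and q: "q > 0"
  shows "(\<integral>\<^sup>+ z. Vtilde (q - 1) (P h) z * indicator {z \<in> P h. z \<bullet> v i = h i} z \<partial>hmeas)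
     = ennreal (total_flux q h i / (2 * real DIM('a)))"
proof -
  interpret H: sigma_finite_measure "hyp (v i) (h i)" by (rule sigma_finite_hyp[OF dim norm_v[OF i]])
  interpret S: finite_measure "sph :: 'a measure" by (rule finite_measure_sph[OF dim])
  interpret PP: pair_sigma_finite "hyp (v i) (h i)" "sph :: 'a measure" ..
  let ?c = "ennreal (1 / (2 * real DIM('a)))"
  let ?k = "\<lambda>z. ?c * (\<integral>\<^sup>+ u. ennreal (chord h u z powr (q - 1)) * indicator (P h) z \<partial>sph)"
  have [measurable]: "?k \<in> borel_measurable borel" by measurable
  have "(\<integral>\<^sup>+ z. Vtilde (q - 1) (P h) z * indicator {z \<in> P h. z \<bullet> v i = h i} z \<partial>hmeas)
     = (\<integral>\<^sup>+ z. ?k z * indicator {z. z \<bullet> v i = h i} z \<partial>hmeas)"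
    by (intro nn_integral_cong) (auto simp: indicator_def Vtilde_facet[OF i])
  also have "\<dots> = (\<integral>\<^sup>+ z. ?k z \<partial>hyp (v i) (h i))"
    by (rule nn_integral_hyp[symmetric]) measurable
  also have "\<dots> = ?c * (\<integral>\<^sup>+ z. (\<integral>\<^sup>+ u. ennreal (chord h u z powr (q - 1)) * indicator (P h) z \<partial>sph) \<partial>hyp (v i) (h i))"
    by (rule nn_integral_cmult) measurable
  also have "(\<integral>\<^sup>+ z. (\<integral>\<^sup>+ u. ennreal (chord h u z powr (q - 1)) * indicator (P h) z \<partial>sph) \<partial>hyp (v i) (h i))
     = (\<integral>\<^sup>+ u. power_flux q h u i \<partial>sph)"
    unfolding power_flux_def facet_flux_def by (rule PP.Fubini'[symmetric]) measurable
  also have "\<dots> = ennreal (total_flux q h i)" by (rule nn_integral_power_flux[OF i q])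
  finally show ?thesis by (simp add: ennreal_mult'[symmetric])
qed

end

section \<open>The chord measure of a polytope\<close>

lemma support_fun_lipschitz_aux:
  fixes K :: "'a::euclidean_space set"
  assumes "K \<noteq> {}" and K: "K \<subseteq> cball 0 R"
  shows "support_fun K v \<le> support_fun K w + R * norm (v - w)"
  unfolding support_fun_def
proof (rule cSUP_least[OF assms(1)])
  fix x assume x: "x \<in> K"
  then have "norm x \<le> R" using K by auto
  have bdd: "bdd_above ((\<lambda>x. x \<bullet> w) ` K)"
  proof (rule bdd_aboveI2)
    fix y assume "y \<in> K"
    then have "norm y \<le> R" using K by auto
    then show "y \<bullet> w \<le> R * norm w"
      using norm_cauchy_schwarz[of y w] mult_right_mono[of "norm y" R "norm w"] by simp
  qed
  have "x \<bullet> v = x \<bullet> w + x \<bullet> (v - w)" by (simp add: inner_diff_right)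
  also have "x \<bullet> w \<le> (SUP x\<in>K. x \<bullet> w)" by (rule cSUP_upper[OF x bdd])
  also have "x \<bullet> (v - w) \<le> R * norm (v - w)"
    using norm_cauchy_schwarz[of x "v - w"] mult_right_mono[OF \<open>norm x \<le> R\<close>, of "norm (v - w)"] by simp
  finally show "x \<bullet> v \<le> (SUP x\<in>K. x \<bullet> w) + R * norm (v - w)" by simp
qed

lemma continuous_on_support_fun:
  fixes K :: "'a::euclidean_space set"
  assumes "K \<noteq> {}" and K: "K \<subseteq> cball 0 R" and "R \<ge> 0"
  shows "continuous_on UNIV (support_fun K)"
proof -
  have "R-lipschitz_on UNIV (support_fun K)"
  proof (rule lipschitz_onI)
    fix v w
    show "dist (support_fun K v) (support_fun K w) \<le> R * dist v w"
      using support_fun_lipschitz_aux[OF assms(1) K, of v w] support_fun_lipschitz_aux[OF assms(1) K, of w v]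
      by (simp add: dist_real_def dist_norm abs_le_iff norm_minus_commute)
  qed fact
  then show ?thesis by (rule lipschitz_on_continuous_on)
qed

context facet_normals begin

lemma inj_v: "i < N \<Longrightarrow> j < N \<Longrightarrow> v i = v j \<Longrightarrow> i = j"
  using not_parallel[of i j 1] by auto

lemma support_fun_facet:
  assumes i: "i < N" and z: "z \<in> P h" "z \<bullet> v i = h i"
  shows "support_fun (P h) (v i) = h i"
  unfolding support_fun_def
  by (rule cSup_eq_maximum) (use assms in \<open>auto simp: mem_P intro!: image_eqI[of _ _ z]\<close>)

text \<open>The constant is the product of the normalisation 2q / omega_n of \<open>Fq\<close> and
  the factor 1 / (2n) from \<open>nn_integral_facet_Vtilde\<close>.\<close>

definition facet_mass :: "real \<Rightarrow> (nat \<Rightarrow> real) \<Rightarrow> nat \<Rightarrow> real" where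
  "facet_mass q h i = q / (real DIM('a) * unit_ball_vol (real DIM('a))) * total_flux q h i"

lemma facet_mass_nonneg: "q > 0 \<Longrightarrow> 0 \<le> facet_mass q h i"
  by (simp add: facet_mass_def total_flux_nonneg)

lemma indicator_normal_preimage:
  assumes one: "\<forall>i<N. \<forall>j<N. i \<noteq> j \<longrightarrow> \<not> (z \<bullet> v i = h i \<and> z \<bullet> v j = h j)"
  shows "indicator (normal_preimage (P h) \<eta>) z
    = (\<Sum>i<N. indicator \<eta> (v i) * indicator {z \<in> P h. z \<bullet> v i = h i} z :: ennreal)"
proof (cases "\<exists>i<N. z \<in> P h \<and> z \<bullet> v i = h i")
  case True
  then obtain i where i: "i < N" "z \<in> P h" "z \<bullet> v i = h i" by blast
  have one': "z \<bullet> v j \<noteq> h j" if "j < N" "j \<noteq> i" for j using one i that by blast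
  have "z \<in> normal_preimage (P h) \<eta> \<longleftrightarrow> v i \<in> \<eta>"
    using facet_subset_frontier[OF i] outer_normal_facet[OF i one'] by (auto simp: normal_preimage_def)
  moreover have "(\<Sum>j<N. indicator \<eta> (v j) * indicator {z \<in> P h. z \<bullet> v j = h j} z :: ennreal)
      = (\<Sum>j\<in>{i}. indicator \<eta> (v j) * indicator {z \<in> P h. z \<bullet> v j = h j} z)"
    using i(1) one' by (intro sum.mono_neutral_right) (auto simp: indicator_def)
  ultimately show ?thesis using i by (simp add: indicator_def)
next
  case False
  then have "z \<notin> normal_preimage (P h) \<eta>"
    using frontier_P_facet[of z h] by (auto simp: normal_preimage_def)
  moreover have "indicator {z \<in> P h. z \<bullet> v i = h i} z = (0::ennreal)" if "i < N" for i
    using False that by (auto simp: indicator_def)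
  ultimately show ?thesis by simp
qed

text \<open>Up to the null set of ridges the boundary splits into facets with one normal each, so
  F_q of the polytope is a discrete measure.\<close>

lemma Fq_P:
  assumes q: "q > 0"
  shows "Fq q (P h) \<eta> = (\<Sum>i<N. ennreal (facet_mass q h i) * indicator \<eta> (v i))"
proof -
  let ?F = "\<lambda>i. {z \<in> P h. z \<bullet> v i = h i}"
  have meas: "(\<lambda>z. Vtilde (q - 1) (P h) z * indicator (?F i) z) \<in> borel_measurable borel" if i: "i < N" for i
  proof -
    interpret S: finite_measure "sph :: 'a measure" by (rule finite_measure_sph[OF dim])
    have "(\<lambda>z. Vtilde (q - 1) (P h) z * indicator (?F i) z)
        = (\<lambda>z. ennreal (1 / (2 * real DIM('a))) * (\<integral>\<^sup>+ u. ennreal (chord h u z powr (q - 1)) \<partial>sph) * indicator (?F i) z)"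
      by (auto simp: fun_eq_iff indicator_def Vtilde_facet[OF i])
    also have "\<dots> \<in> borel_measurable borel" by measurable
    finally show ?thesis .
  qed
  have "(\<integral>\<^sup>+ z \<in> normal_preimage (P h) \<eta>. Vtilde (q - 1) (P h) z \<partial>hausdorff_measure (real DIM('a) - 1))
     = (\<integral>\<^sup>+ z. (\<Sum>i<N. indicator \<eta> (v i) * (Vtilde (q - 1) (P h) z * indicator (?F i) z)) \<partial>hmeas)"
    unfolding hmeas_def[symmetric]
  proof (rule nn_integral_cong_AE)
    show "AE z in hmeas. Vtilde (q - 1) (P h) z * indicator (normal_preimage (P h) \<eta>) z
        = (\<Sum>i<N. indicator \<eta> (v i) * (Vtilde (q - 1) (P h) z * indicator (?F i) z))"
      using AE_one_facet[of h]
    proof eventually_elim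
      case (elim z)
      show ?case
        unfolding indicator_normal_preimage[OF elim] sum_distrib_left
        by (intro sum.cong refl) (simp only: mult_ac)
    qed
  qed
  also have "\<dots> = (\<Sum>i<N. \<integral>\<^sup>+ z. indicator \<eta> (v i) * (Vtilde (q - 1) (P h) z * indicator (?F i) z) \<partial>hmeas)"
    using meas by (intro nn_integral_sum) (auto intro!: borel_measurable_times)
  also have "\<dots> = (\<Sum>i<N. indicator \<eta> (v i) * ennreal (total_flux q h i / (2 * real DIM('a))))"
    using meas by (intro sum.cong refl) (simp add: nn_integral_cmult nn_integral_facet_Vtilde[OF _ q])
  finally have "Fq q (P h) \<eta> = (\<Sum>i<N. (ennreal (2 * q / unit_ball_vol (real DIM('a)))
      * ennreal (total_flux q h i / (2 * real DIM('a)))) * indicator \<eta> (v i))"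
    unfolding Fq_def by (simp add: sum_distrib_left mult_ac)
  also have "\<dots> = (\<Sum>i<N. ennreal (facet_mass q h i) * indicator \<eta> (v i))"
  proof (intro sum.cong refl)
    fix i
    have "ennreal (2 * q / unit_ball_vol (real DIM('a))) * ennreal (total_flux q h i / (2 * real DIM('a)))
       = ennreal (2 * q / unit_ball_vol (real DIM('a)) * (total_flux q h i / (2 * real DIM('a))))"
      using q by (intro ennreal_mult[symmetric]) (auto simp: total_flux_nonneg)
    also have "2 * q / unit_ball_vol (real DIM('a)) * (total_flux q h i / (2 * real DIM('a))) = facet_mass q h i"
      by (simp add: facet_mass_def)
    finally show "ennreal (2 * q / unit_ball_vol (real DIM('a))) * ennreal (total_flux q h i / (2 * real DIM('a))) * indicator \<eta> (v i)
        = ennreal (facet_mass q h i) * indicator \<eta> (v i)" by simp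
  qed
  finally show ?thesis .
qed

lemma space_Fq_measure [simp]: "space (Fq_measure q K) = sphere (0::'a) 1"
  and sets_Fq_measure [simp]: "sets (Fq_measure q K) = sets (restrict_space borel (sphere (0::'a) 1))"
proof -
  let ?R = "restrict_space (borel :: 'a measure) (sphere 0 1)"
  have "sets ?R \<subseteq> Pow (sphere 0 1)" using sets.space_closed[of ?R] by (simp add: space_restrict_space)
  then show "space (Fq_measure q K) = sphere 0 1" unfolding Fq_measure_def by (rule space_measure_of)
  have "sigma_sets (sphere 0 1) (sets ?R) = sets ?R"
    using sets.sigma_sets_eq[of ?R] by (simp add: space_restrict_space)
  then show "sets (Fq_measure q K) = sets ?R"
    unfolding Fq_measure_def using \<open>sets ?R \<subseteq> Pow (sphere 0 1)\<close> by (simp add: sets_measure_of)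
qed

text \<open>Countable additivity, on which \<open>measure_of\<close> insists, is read off from the
  discrete formula \<open>Fq_P\<close>.\<close>

lemma emeasure_Fq_measure:
  assumes q: "q > 0" and \<eta>: "\<eta> \<in> sets (restrict_space borel (sphere (0::'a) 1))"
  shows "emeasure (Fq_measure q (P h)) \<eta> = (\<Sum>i<N. ennreal (facet_mass q h i) * indicator \<eta> (v i))"
proof -
  let ?R = "restrict_space (borel :: 'a measure) (sphere 0 1)"
  have "emeasure (Fq_measure q (P h)) \<eta> = Fq q (P h) \<eta>"
    unfolding Fq_measure_def
  proof (rule emeasure_measure_of_sigma[OF _ _ _ \<eta>])
    show "sigma_algebra (sphere 0 1) (sets ?R)"
      using sets.sigma_algebra_axioms[of ?R] by (simp add: space_restrict_space)
    show "positive (sets ?R) (Fq q (P h))" by (simp add: positive_def Fq_P[OF q])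
    show "countably_additive (sets ?R) (Fq q (P h))"
      unfolding countably_additive_def
    proof (intro allI impI)
      fix A :: "nat \<Rightarrow> 'a set" assume "disjoint_family A"
      have "(\<Sum>n. Fq q (P h) (A n)) = (\<Sum>i<N. \<Sum>n. ennreal (facet_mass q h i) * indicator (A n) (v i))"
        unfolding Fq_P[OF q] by (rule suminf_sum) auto
      also have "\<dots> = Fq q (P h) (\<Union> (range A))"
        unfolding Fq_P[OF q] using suminf_indicator[OF \<open>disjoint_family A\<close>] by (simp add: ennreal_suminf_cmult)
      finally show "(\<Sum>n. Fq q (P h) (A n)) = Fq q (P h) (\<Union> (range A))" .
    qed
  qed
  then show ?thesis by (simp add: Fq_P[OF q])
qed

lemma P_nonempty: "(\<And>j. j < N \<Longrightarrow> 0 < h j) \<Longrightarrow> 0 \<in> P h"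
  by (auto simp: mem_P intro: less_imp_le)

lemma emeasure_Fpq_measure:
  assumes q: "q > 0" and h: "\<And>j. j < N \<Longrightarrow> 0 < h j"
    and \<eta>: "\<eta> \<in> sets (restrict_space borel (sphere (0::'a) 1))"
  shows "emeasure (Fpq_measure p q (P h)) \<eta>
    = (\<Sum>i<N. ennreal (support_fun (P h) (v i) powr (1 - p)) * ennreal (facet_mass q h i) * indicator \<eta> (v i))"
proof -
  let ?M = "Fq_measure q (P h)"
  let ?V = "v ` {..<N}"
  let ?f = "\<lambda>w. ennreal (support_fun (P h) w powr (1 - p))"
  obtain R where R: "R > 0" "P h \<subseteq> cball 0 R" using P_bounded by blast
  have "continuous_on UNIV (support_fun (P h))"
    using P_nonempty[of h] h R by (intro continuous_on_support_fun[where R=R]) auto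
  then have [measurable]: "support_fun (P h) \<in> borel_measurable borel"
    by (rule borel_measurable_continuous_onI)
  have "?f \<in> borel_measurable borel" by measurable
  then have "?f \<in> borel_measurable (restrict_space borel (sphere 0 1))"
    by (rule measurable_restrict_space1)
  then have f: "?f \<in> borel_measurable ?M"
    by (simp cong: measurable_cong_sets)
  have Vsph: "?V \<subseteq> sphere 0 1" using norm_v by auto
  have sing: "{w} \<in> sets ?M" if "w \<in> sphere 0 1" for w :: 'a
    using that by (auto simp: sets_restrict_space intro!: image_eqI[of _ _ "{w}"])
  have \<eta>': "\<eta> \<in> sets ?M" using \<eta> by simp
  have VM: "?V \<in> sets ?M"
    using Vsph by (auto simp: sets_restrict_space intro!: image_eqI[of _ _ ?V] borel_closed finite_imp_closed)
  \<comment> \<open>The measure lives on the finitely many normals, so the density integral becomes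
    a finite sum.\<close>
  have null: "AE w in ?M. w \<in> ?V"
  proof (rule AE_I)
    show "sphere 0 1 - ?V \<in> sets ?M" using VM sets.compl_sets[of ?V ?M] by simp
    then show "emeasure ?M (sphere 0 1 - ?V) = 0"
      by (subst emeasure_Fq_measure[OF q]) auto
  qed auto
  have "emeasure (Fpq_measure p q (P h)) \<eta> = (\<integral>\<^sup>+ w. ?f w * indicator \<eta> w \<partial>?M)"
    unfolding Fpq_measure_def by (rule emeasure_density[OF f \<eta>'])
  also have "\<dots> = (\<integral>\<^sup>+ w. (?f w * indicator \<eta> w) * indicator ?V w \<partial>?M)"
    using null by (intro nn_integral_cong_AE) (auto elim!: eventually_mono simp: indicator_def)
  also have "\<dots> = (\<Sum>w\<in>?V. (?f w * indicator \<eta> w) * emeasure ?M {w})"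
    using Vsph by (intro nn_integral_indicator_finite sing) auto
  also have "\<dots> = (\<Sum>i<N. (?f (v i) * indicator \<eta> (v i)) * emeasure ?M {v i})"
    by (rule sum.reindex_cong[of v]) (auto intro!: inj_onI dest: inj_v)
  also have "\<dots> = (\<Sum>i<N. ?f (v i) * ennreal (facet_mass q h i) * indicator \<eta> (v i))"
  proof (intro sum.cong refl)
    fix i assume i: "i \<in> {..<N}"
    have "emeasure ?M {v i} = (\<Sum>j<N. ennreal (facet_mass q h j) * indicator {v i} (v j))"
      using sing[of "v i"] norm_v i by (intro emeasure_Fq_measure[OF q]) auto
    also have "\<dots> = (\<Sum>j\<in>{i}. ennreal (facet_mass q h j) * indicator {v i} (v j))"
      using i by (intro sum.mono_neutral_right) (auto simp: indicator_def dest: inj_v)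
    finally show "?f (v i) * indicator \<eta> (v i) * emeasure ?M {v i} = ?f (v i) * ennreal (facet_mass q h i) * indicator \<eta> (v i)"
      by (simp add: mult_ac)
  qed
  finally show ?thesis .
qed

section \<open>Membership in the prescribed class of polytopes\<close>

lemma convex_P: "convex (P h)"
proof -
  have "P h = (\<Inter>j\<in>{..<N}. {x. v j \<bullet> x \<le> h j})" by (auto simp: mem_P inner_commute)
  then show ?thesis by (auto intro!: convex_INT convex_halfspace_le)
qed

lemma polytope_P: "polytope (P h)"
proof -
  have "P h = \<Inter> ((\<lambda>j. {x. v j \<bullet> x \<le> h j}) ` {..<N})" by (auto simp: mem_P inner_commute)
  then have "polyhedron (P h)"
    by (auto intro!: polyhedron_Inter polyhedron_halfspace_le)
  moreover obtain R where "R > 0" "P h \<subseteq> cball 0 R" using P_bounded by blast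
  then have "bounded (P h)" using bounded_cball bounded_subset by blast
  ultimately show ?thesis by (simp add: polytope_eq_bounded_polyhedron)
qed

lemma P_in_polytopes_with_normals:
  assumes h: "\<And>j. j < N \<Longrightarrow> 0 < h j"
  shows "P h \<in> polytopes_with_normals N v" and "0 \<in> interior (P h)"
proof -
  show int: "0 \<in> interior (P h)" using h by (intro interior_P) auto
  have "\<exists>i<N. facet_normal (P h) F (v i)" if F: "F facet_of P h" for F
  proof -
    have face: "F face_of P h" and ne: "F \<noteq> {}" and aff: "aff_dim F = aff_dim (P h) - 1"
      using F by (auto simp: facet_of_def)
    have "F \<noteq> P h" using aff by auto
    have sub: "F \<subseteq> P h" using face by (rule face_of_imp_subset)
    \<comment> \<open>A relative interior point of the facet lies on some hyperplane x . v i = h i,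
      and the face cut out by that hyperplane then contains all of \<open>F\<close>.\<close>
    obtain z where z: "z \<in> rel_interior F"
      using ne face_of_imp_convex[OF face] rel_interior_eq_empty by blast
    then have zF: "z \<in> F" using rel_interior_subset by blast
    then have "z \<notin> interior (P h)" using face_of_disjoint_interior[OF face \<open>F \<noteq> P h\<close>] by blast
    then have "z \<in> frontier (P h)" using zF sub closure_subset by (auto simp: frontier_def)
    then obtain i where i: "i < N" "z \<bullet> v i = h i" using frontier_P_facet(2) by blast
    let ?G = "P h \<inter> {x. v i \<bullet> x = h i}"
    have G: "?G face_of P h"
      using i by (intro face_of_Int_supporting_hyperplane_le[OF convex_P]) (auto simp: mem_P inner_commute)
    have "z \<in> ?G" using zF sub i by (auto simp: inner_commute)
    then have "?G \<inter> rel_interior F \<noteq> {}" using z by blast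
    then have "F \<subseteq> ?G" by (rule subset_of_face_of[OF G sub])
    moreover have "support_fun (P h) (v i) = h i"
      using i zF sub by (intro support_fun_facet[OF i(1)]) auto
    ultimately show ?thesis
      using i norm_v[OF i(1)] by (intro exI[of _ i]) (auto simp: facet_normal_def inner_commute)
  qed
  then show "P h \<in> polytopes_with_normals N v"
    using polytope_P int by (auto simp: polytopes_with_normals_def)
qed

text \<open>A priori \<open>h i\<close> only bounds the support function at \<open>v i\<close>.
  Since \<alpha> i is positive, the i-th flux cannot vanish, so the i-th hyperplane touches the
  polytope and \<open>h i\<close> is the support number.\<close>

lemma solution_of_balance:
  assumes q: "q > 0" and h: "\<And>j. j < N \<Longrightarrow> 0 < h j" and \<alpha>: "\<And>i. i < N \<Longrightarrow> 0 < \<alpha> i"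
    and eq: "\<And>i. i < N \<Longrightarrow> h i powr (1 - p) * facet_mass q h i = \<alpha> i"
  shows "\<exists>P \<in> polytopes_with_normals N v. 0 \<in> interior P \<and>
           (\<forall>\<eta> \<in> sets (restrict_space borel (sphere (0::'a) 1)).
              emeasure (Fpq_measure p q P) \<eta> = ennreal (\<Sum>i\<in>{i. i < N \<and> v i \<in> \<eta>}. \<alpha> i))"
proof (intro bexI[OF _ P_in_polytopes_with_normals(1)] conjI ballI)
  show "0 \<in> interior (P h)" by (rule P_in_polytopes_with_normals(2)[OF h])
  fix \<eta> assume \<eta>: "\<eta> \<in> sets (restrict_space borel (sphere (0::'a) 1))"
  have supp: "support_fun (P h) (v i) = h i" if i: "i < N" for i
  proof -
    have "total_flux q h i \<noteq> 0" using eq[OF i] \<alpha>[OF i] by (auto simp: facet_mass_def)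
    then obtain z where "z \<in> P h" "z \<bullet> v i = h i" using total_flux_missing_facet[OF i q, of h] by blast
    then show ?thesis by (rule support_fun_facet[OF i])
  qed
  have "emeasure (Fpq_measure p q (P h)) \<eta>
    = (\<Sum>i<N. ennreal (support_fun (P h) (v i) powr (1 - p)) * ennreal (facet_mass q h i) * indicator \<eta> (v i))"
    by (rule emeasure_Fpq_measure[OF q h \<eta>])
  also have "\<dots> = (\<Sum>i<N. ennreal (\<alpha> i) * indicator \<eta> (v i))"
  proof (intro sum.cong refl)
    fix i assume "i \<in> {..<N}"
    then have i: "i < N" by simp
    show "ennreal (support_fun (P h) (v i) powr (1 - p)) * ennreal (facet_mass q h i) * indicator \<eta> (v i)
       = ennreal (\<alpha> i) * indicator \<eta> (v i)"
      unfolding supp[OF i] eq[OF i, symmetric] using facet_mass_nonneg[OF q] by (simp add: ennreal_mult)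
  qed
  also have "\<dots> = (\<Sum>i\<in>{i. i < N \<and> v i \<in> \<eta>}. ennreal (\<alpha> i))"
    by (rule sum.mono_neutral_cong_right) (auto simp: indicator_def)
  also have "\<dots> = ennreal (\<Sum>i\<in>{i. i < N \<and> v i \<in> \<eta>}. \<alpha> i)"
    using \<alpha> by (intro sum_ennreal) (auto intro: less_imp_le)
  finally show "emeasure (Fpq_measure p q (P h)) \<eta> = ennreal (\<Sum>i\<in>{i. i < N \<and> v i \<in> \<eta>}. \<alpha> i)" .
qed (rule h)

end

section \<open>Brouwer's theorem in coordinates\<close>

text \<open>The n-dimensional cube inside the functions on the naturals, extended by 0, so that the
  product topology makes it compact.\<close>

definition unit_cube_nat :: "nat \<Rightarrow> (nat \<Rightarrow> real) set" where
  "unit_cube_nat n = {x. (\<forall>i<n. 0 \<le> x i \<and> x i \<le> 1) \<and> (\<forall>i\<ge>n. x i = 0)}"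

lemma compact_unit_cube_nat: "compact (unit_cube_nat n)"
proof -
  have "unit_cube_nat n = PiE UNIV (\<lambda>i. if i < n then {0..1} else {0})"
  proof (rule set_eqI)
    fix x :: "nat \<Rightarrow> real"
    have "x \<in> PiE UNIV (\<lambda>i. if i < n then {0..1} else {0}) \<longleftrightarrow> (\<forall>i. if i < n then 0 \<le> x i \<and> x i \<le> 1 else x i = 0)"
      by (auto simp: PiE_iff extensional_def split: if_splits)
    also have "\<dots> \<longleftrightarrow> x \<in> unit_cube_nat n"
      unfolding unit_cube_nat_def mem_Collect_eq by (metis not_less)
    finally show "x \<in> unit_cube_nat n \<longleftrightarrow> x \<in> PiE UNIV (\<lambda>i. if i < n then {0..1} else {0})" ..
  qed
  moreover have "compactin (product_topology (\<lambda>_. euclidean) UNIV) (PiE UNIV (\<lambda>i. if i < n then {0..1::real} else {0}))"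
    by (auto simp: compactin_PiE)
  ultimately show ?thesis by (simp add: euclidean_product_topology)
qed

lemma tendsto_nat_coordinate:
  fixes X :: "nat \<Rightarrow> nat \<Rightarrow> real"
  assumes "X \<longlonglongrightarrow> x"
  shows "(\<lambda>k. X k i) \<longlonglongrightarrow> x i"
proof -
  have "isCont (\<lambda>x::nat \<Rightarrow> real. x i) x"
  proof -
    have "continuous_on UNIV (\<lambda>x::nat \<Rightarrow> real. x i)" by (rule continuous_on_product_coordinates)
    then show ?thesis
      by (rule continuous_on_eq_continuous_at[OF open_UNIV, THEN iffD1, rule_format]) simp
  qed
  then show ?thesis using assms by (rule isCont_tendsto_compose)
qed

text \<open>The library version of Brouwer's theorem does not apply, as \<open>n\<close> is not the dimension of a type.
  As there, Kuhn's combinatorial lemma gives approximate fixed points.\<close>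
lemma brouwer_unit_cube_nat:
  assumes maps: "\<And>x. x \<in> unit_cube_nat n \<Longrightarrow> f x \<in> unit_cube_nat n"
    and cont: "\<And>X x i. (\<And>k. X k \<in> unit_cube_nat n) \<Longrightarrow> x \<in> unit_cube_nat n \<Longrightarrow>
       (\<And>i. i < n \<Longrightarrow> (\<lambda>k. X k i) \<longlonglongrightarrow> x i) \<Longrightarrow> i < n \<Longrightarrow> (\<lambda>k. f (X k) i) \<longlonglongrightarrow> f x i"
  shows "\<exists>x\<in>unit_cube_nat n. \<forall>i<n. f x i = x i"
proof -
  have "\<exists>l. (\<forall>x i. l x i \<le> (1::nat)) \<and>
             (\<forall>x i. x \<in> unit_cube_nat n \<and> i < n \<and> x i = 0 \<longrightarrow> l x i = 0) \<and>
             (\<forall>x i. x \<in> unit_cube_nat n \<and> i < n \<and> x i = 1 \<longrightarrow> l x i = 1) \<and>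
             (\<forall>x i. x \<in> unit_cube_nat n \<and> i < n \<and> l x i = 0 \<longrightarrow> x i \<le> f x i) \<and>
             (\<forall>x i. x \<in> unit_cube_nat n \<and> i < n \<and> l x i = 1 \<longrightarrow> f x i \<le> x i)"
    by (rule kuhn_labelling_lemma') (use maps in \<open>auto simp: unit_cube_nat_def\<close>)
  then obtain l where l [rule_format]: "\<forall>x i. l x i \<le> (1::nat)"
    "\<forall>x i. x \<in> unit_cube_nat n \<and> i < n \<and> x i = 0 \<longrightarrow> l x i = 0"
    "\<forall>x i. x \<in> unit_cube_nat n \<and> i < n \<and> x i = 1 \<longrightarrow> l x i = 1"
    "\<forall>x i. x \<in> unit_cube_nat n \<and> i < n \<and> l x i = 0 \<longrightarrow> x i \<le> f x i"
    "\<forall>x i. x \<in> unit_cube_nat n \<and> i < n \<and> l x i = 1 \<longrightarrow> f x i \<le> x i"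
    by (elim exE conjE) (rule that)
  define e where "e = (\<lambda>p (q::nat \<Rightarrow> nat) i. if i < n then real (q i) / real p else 0)"
  have e_in: "e p q \<in> unit_cube_nat n" if "0 < p" "\<And>i. i < n \<Longrightarrow> q i \<le> p" for p q
    using that by (auto simp: unit_cube_nat_def e_def)
  \<comment> \<open>The outcome of Kuhn's lemma: \<open>q\<close> is the corner of a grid cell of
    side 1 / p, and for each coordinate i the vertices \<open>y i\<close> and \<open>z i\<close> of
    that cell carry the i-th labels 0 and 1.\<close>
  define good where "good = (\<lambda>p q y z. (\<forall>i<n. q i < p) \<and>
     (\<forall>i<n. (\<forall>j<n. q j \<le> y i j \<and> y i j \<le> q j + 1) \<and> (\<forall>j<n. q j \<le> z i j \<and> z i j \<le> q j + (1::nat)) \<and>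
            l (e p (y i)) i = 0 \<and> l (e p (z i)) i = 1))"
  have "\<exists>q y z. good p q y z" if p: "0 < p" for p
  proof -
    obtain q where q: "\<forall>i<n. q i < p"
      "\<forall>i<n. \<exists>r s. (\<forall>j<n. q j \<le> r j \<and> r j \<le> q j + 1) \<and> (\<forall>j<n. q j \<le> s j \<and> s j \<le> q j + 1)
          \<and> l (e p r) i \<noteq> l (e p s) i"
    proof (rule kuhn_lemma[OF p, of n "\<lambda>x i. l (e p x) i"])
      show "\<forall>x. (\<forall>i<n. x i \<le> p) \<longrightarrow> (\<forall>i<n. l (e p x) i = 0 \<or> l (e p x) i = 1)"
        using l(1) by (metis le_eq_less_or_eq less_one)
      show "\<forall>x. (\<forall>i<n. x i \<le> p) \<longrightarrow> (\<forall>i<n. x i = 0 \<longrightarrow> l (e p x) i = 0)"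
      proof (intro allI impI)
        fix x i assume "\<forall>i<n. x i \<le> p" "i < n" "x i = 0"
        then show "l (e p x) i = 0"
          using e_in[OF p, of x] by (intro l(2) conjI) (auto simp: e_def)
      qed
      show "\<forall>x. (\<forall>i<n. x i \<le> p) \<longrightarrow> (\<forall>i<n. x i = p \<longrightarrow> l (e p x) i = 1)"
      proof (intro allI impI)
        fix x i assume "\<forall>i<n. x i \<le> p" "i < n" "x i = p"
        then show "l (e p x) i = 1"
          using e_in[OF p, of x] p by (intro l(3) conjI) (auto simp: e_def)
      qed
    qed blast
    define near where "near = (\<lambda>i y z. (\<forall>j<n. q j \<le> y j \<and> y j \<le> q j + 1) \<and> (\<forall>j<n. q j \<le> z j \<and> z j \<le> q j + 1)
        \<and> l (e p y) i = 0 \<and> l (e p z) i = 1)"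
    have "\<exists>y z. near i y z" if "i < n" for i
    proof -
      obtain r s where rs: "\<forall>j<n. q j \<le> r j \<and> r j \<le> q j + 1" "\<forall>j<n. q j \<le> s j \<and> s j \<le> q j + 1"
        "l (e p r) i \<noteq> l (e p s) i" using q(2) \<open>i < n\<close> by blast
      have "l (e p r) i = 0 \<or> l (e p r) i = 1" "l (e p s) i = 0 \<or> l (e p s) i = 1"
        using l(1)[of "e p r" i] l(1)[of "e p s" i] by linarith+
      then have "near i r s \<or> near i s r" using rs by (auto simp: near_def)
      then show ?thesis by blast
    qed
    then obtain y z where "\<And>i. i < n \<Longrightarrow> near i (y i) (z i)" by metis
    then have "\<forall>i<n. (\<forall>j<n. q j \<le> y i j \<and> y i j \<le> q j + 1) \<and> (\<forall>j<n. q j \<le> z i j \<and> z i j \<le> q j + 1)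
        \<and> l (e p (y i)) i = 0 \<and> l (e p (z i)) i = 1" unfolding near_def by blast
    then show ?thesis unfolding good_def using q(1) by blast
  qed
  then have "\<exists>q y z. good (Suc k) q y z" for k by blast
  then obtain Q Y Z where good: "\<And>k. good (Suc k) (Q k) (Y k) (Z k)" by metis
  \<comment> \<open>The corners of the cells; a limit point of them is the candidate for the fixed
    point.\<close>
  define X where "X = (\<lambda>k. e (Suc k) (Q k))"
  have XC: "X k \<in> unit_cube_nat n" for k
    unfolding X_def using good[of k] by (intro e_in) (auto simp: good_def less_imp_le)
  have "seq_compact (unit_cube_nat n)" by (rule compact_imp_seq_compact[OF compact_unit_cube_nat])
  then obtain x r where xr: "x \<in> unit_cube_nat n" "strict_mono r" "(X \<circ> r) \<longlonglongrightarrow> x"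
    using XC unfolding seq_compact_def by metis
  have Xi: "(\<lambda>k. X (r k) i) \<longlonglongrightarrow> x i" for i
    using tendsto_nat_coordinate[OF xr(3), of i] by (simp add: o_def)
  \<comment> \<open>Vertices of a cell differ from its corner in each coordinate by at most the side
    of the cell, which tends to 0.\<close>
  have close: "(\<lambda>k. e (Suc (r k)) (W (r k)) i) \<longlonglongrightarrow> x i"
    if W: "\<And>k j. j < n \<Longrightarrow> Q k j \<le> W k j \<and> W k j \<le> Q k j + 1" and i: "i < n" for W i
  proof (rule tendsto_sandwich[OF _ _ Xi[of i]])
    have "(\<lambda>k. X (r k) i + (1 / real (Suc k)) ) \<longlonglongrightarrow> x i + 0"
      by (intro tendsto_add Xi LIMSEQ_Suc[OF lim_1_over_n])
    then show "(\<lambda>k. X (r k) i + 1 / real (Suc k)) \<longlonglongrightarrow> x i" by simp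
    show "\<forall>\<^sub>F k in sequentially. X (r k) i \<le> e (Suc (r k)) (W (r k)) i"
      using W[OF i] i by (intro always_eventually) (auto simp: X_def e_def divide_right_mono)
    show "\<forall>\<^sub>F k in sequentially. e (Suc (r k)) (W (r k)) i \<le> X (r k) i + 1 / real (Suc k)"
    proof (intro always_eventually allI)
      fix k
      have "real (W (r k) i) \<le> real (Q (r k) i) + 1" using W[OF i, of "r k"] by linarith
      then have "real (W (r k) i) / real (Suc (r k)) \<le> real (Q (r k) i) / real (Suc (r k)) + 1 / real (Suc (r k))"
        by (simp add: add_divide_distrib[symmetric] divide_right_mono)
      moreover have "1 / real (Suc (r k)) \<le> 1 / real (Suc k)"
        using seq_suble[OF xr(2), of k] by (intro divide_left_mono) auto
      ultimately show "e (Suc (r k)) (W (r k)) i \<le> X (r k) i + 1 / real (Suc k)"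
        using i by (simp add: X_def e_def)
    qed
  qed
  \<comment> \<open>At label 0 the map does not decrease the i-th coordinate, at label 1 it does not
    increase it; both inequalities pass to the limit.\<close>
  have "f x i = x i" if i: "i < n" for i
  proof (rule antisym)
    have Yb: "Q k j \<le> Y k i j \<and> Y k i j \<le> Q k j + 1" "Q k j \<le> Z k i j \<and> Z k i j \<le> Q k j + 1" if "j < n" for k j
      using good[of k] i that by (auto simp: good_def)
    have in_cube: "e (Suc k) (W k) \<in> unit_cube_nat n" if "\<And>j. j < n \<Longrightarrow> W k j \<le> Q k j + 1" for W k
    proof (rule e_in)
      fix j assume j: "j < n"
      have "Q k j < Suc k" using good[of k] j by (auto simp: good_def)
      then show "W k j \<le> Suc k" using that[OF j] by linarith
    qed simp
    have YC: "e (Suc k) (Y k i) \<in> unit_cube_nat n" and ZC: "e (Suc k) (Z k i) \<in> unit_cube_nat n" for k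
      using in_cube[of "\<lambda>k. Y k i" k] in_cube[of "\<lambda>k. Z k i" k] Yb by auto
    have Ylim: "(\<lambda>k. e (Suc (r k)) (Y (r k) i) j) \<longlonglongrightarrow> x j" if "j < n" for j
      by (rule close[of "\<lambda>k. Y k i"]) (use Yb that in auto)
    have Zlim: "(\<lambda>k. e (Suc (r k)) (Z (r k) i) j) \<longlonglongrightarrow> x j" if "j < n" for j
      by (rule close[of "\<lambda>k. Z k i"]) (use Yb that in auto)
    have "e (Suc (r k)) (Y (r k) i) i \<le> f (e (Suc (r k)) (Y (r k) i)) i" for k
      using good[of "r k"] i by (intro l(4) conjI YC) (auto simp: good_def)
    then show "x i \<le> f x i"
      using cont[of "\<lambda>k. e (Suc (r k)) (Y (r k) i)" x i] YC xr(1) Ylim i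
      by (intro LIMSEQ_le[OF Ylim[OF i]]) auto
    have "f (e (Suc (r k)) (Z (r k) i)) i \<le> e (Suc (r k)) (Z (r k) i) i" for k
      using good[of "r k"] i by (intro l(5) conjI ZC) (auto simp: good_def)
    then show "f x i \<le> x i"
      using cont[of "\<lambda>k. e (Suc (r k)) (Z (r k) i)" x i] ZC xr(1) Zlim i
      by (intro LIMSEQ_le[OF _ Zlim[OF i]]) auto
  qed
  then show ?thesis using xr(1) by blast
qed

text \<open>The nearest-point map \<open>r\<close> retracts the cube onto \<open>S\<close>, so
  \<open>T\<close> after \<open>r\<close> has a fixed point in the cube. As a value of
  \<open>T\<close> it lies in \<open>S\<close>, where \<open>r\<close> is the identity.\<close>

theorem brouwer_nat_convex:
  fixes S :: "(nat \<Rightarrow> real) set"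
  assumes S: "compact S" "S \<noteq> {}" "S \<subseteq> unit_cube_nat n"
    and conv: "\<And>x y t. x \<in> S \<Longrightarrow> y \<in> S \<Longrightarrow> 0 \<le> t \<Longrightarrow> t \<le> 1 \<Longrightarrow> (\<lambda>i. x i + t * (y i - x i)) \<in> S"
    and maps: "\<And>x. x \<in> S \<Longrightarrow> T x \<in> S"
    and cont: "\<And>X x i. (\<And>k. X k \<in> S) \<Longrightarrow> x \<in> S \<Longrightarrow>
       (\<And>i. i < n \<Longrightarrow> (\<lambda>k. X k i) \<longlonglongrightarrow> x i) \<Longrightarrow> i < n \<Longrightarrow> (\<lambda>k. T (X k) i) \<longlonglongrightarrow> T x i"
  shows "\<exists>x\<in>S. T x = x"
proof -
  define D where "D = (\<lambda>x y::nat \<Rightarrow> real. \<Sum>i<n. (x i - y i)\<^sup>2)"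
  have "\<exists>y\<in>S. \<forall>z\<in>S. D x y \<le> D x z" for x
  proof (rule continuous_attains_inf[OF S(1,2)])
    show "continuous_on S (D x)"
      unfolding D_def by (intro continuous_intros continuous_on_subset[OF continuous_on_product_coordinates]) auto
  qed
  then obtain r where r: "\<And>x. r x \<in> S" "\<And>x z. z \<in> S \<Longrightarrow> D x (r x) \<le> D x z" by metis
  \<comment> \<open>The obtuse angle property of a nearest point: if it failed, moving from
    \<open>r x\<close> a little towards \<open>y\<close> would reduce the distance.\<close>
  have var: "(\<Sum>i<n. (x i - r x i) * (y i - r x i)) \<le> 0" if y: "y \<in> S" for x y
  proof (rule ccontr)
    assume neg: "\<not> ?thesis"
    define a where "a = (\<Sum>i<n. (x i - r x i) * (y i - r x i))"
    define b where "b = (\<Sum>i<n. (y i - r x i)\<^sup>2)"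
    have a: "a > 0" using neg by (simp add: a_def)
    have b: "b \<ge> 0" unfolding b_def by (intro sum_nonneg) auto
    \<comment> \<open>Small enough for the gain 2 t a to outweigh the loss t^2 b; the denominator b
      + 1 avoids division by zero.\<close>
    define t where "t = min 1 (a / (b + 1))"
    have t: "0 < t" "t \<le> 1" "t * b < 2 * a"
    proof -
      show "0 < t" "t \<le> 1" using a b by (auto simp: t_def)
      have "t * b \<le> (a / (b + 1)) * b" using b by (intro mult_right_mono) (auto simp: t_def)
      also have "\<dots> \<le> a" using a b by (simp add: field_simps)
      also have "a < 2 * a" using a by simp
      finally show "t * b < 2 * a" .
    qed
    have "D x (r x) \<le> D x (\<lambda>i. r x i + t * (y i - r x i))"
      by (intro r(2) conv r(1) y) (use t in auto)
    also have "\<dots> = D x (r x) - 2 * t * a + t\<^sup>2 * b"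
      unfolding D_def a_def b_def sum_distrib_left sum.distrib[symmetric] sum_subtractf[symmetric]
      by (intro sum.cong refl) (simp add: power2_eq_square algebra_simps)
    finally have "t * (2 * a) \<le> t * (t * b)" by (simp add: power2_eq_square algebra_simps)
    then show False using t by (simp add: mult_le_cancel_left)
  qed
  have nonexp: "D (r x) (r y) \<le> D x y" for x y
  proof -
    \<comment> \<open>The two obtuse angle inequalities added up; a square then turns their sum into
      the estimate that \<open>r\<close> does not expand distances.\<close>
    define A where "A = (\<Sum>i<n. (x i - r x i) * (r y i - r x i)) + (\<Sum>i<n. (y i - r y i) * (r x i - r y i))"
    have "A \<le> 0"
      unfolding A_def using var[OF r(1), of x y] var[OF r(1), of y x] by (rule add_nonpos_nonpos)
    moreover have "D (r x) (r y) - D x y \<le> 2 * A"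
      unfolding D_def A_def sum_distrib_left sum.distrib[symmetric] sum_subtractf[symmetric]
    proof (rule sum_mono)
      fix i
      have "0 \<le> ((r x i - r y i) - (x i - y i))\<^sup>2" by simp
      then show "(r x i - r y i)\<^sup>2 - (x i - y i)\<^sup>2
         \<le> 2 * ((x i - r x i) * (r y i - r x i) + (y i - r y i) * (r x i - r y i))"
        by (simp add: power2_eq_square algebra_simps)
    qed
    ultimately show ?thesis by linarith
  qed
  have r_lim: "(\<lambda>k. r (X k) i) \<longlonglongrightarrow> r x i"
    if X: "\<And>i. i < n \<Longrightarrow> (\<lambda>k. X k i) \<longlonglongrightarrow> x i" and i: "i < n" for X x i
  proof -
    have "(\<lambda>k. D (X k) x) \<longlonglongrightarrow> (\<Sum>i<n. (x i - x i)\<^sup>2)"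
      unfolding D_def using X by (intro tendsto_intros) auto
    then have D0: "(\<lambda>k. sqrt (D (X k) x)) \<longlonglongrightarrow> sqrt 0" by (intro tendsto_real_sqrt) simp
    have le: "norm (r (X k) i - r x i) \<le> sqrt (D (X k) x)" for k
    proof -
      have "(r (X k) i - r x i)\<^sup>2 \<le> D (r (X k)) (r x)"
        unfolding D_def using i by (intro member_le_sum[of i _ "\<lambda>i. (r (X k) i - r x i)\<^sup>2"]) auto
      also have "\<dots> \<le> D (X k) x" by (rule nonexp)
      finally show ?thesis by (simp add: real_le_rsqrt)
    qed
    have "\<forall>\<^sub>F k in sequentially. norm (r (X k) i - r x i) \<le> sqrt (D (X k) x)"
      by (intro always_eventually allI le)
    moreover have "(\<lambda>k. sqrt (D (X k) x)) \<longlonglongrightarrow> 0" using D0 by (simp only: real_sqrt_zero)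
    ultimately have "(\<lambda>k. r (X k) i - r x i) \<longlonglongrightarrow> 0" by (rule Lim_null_comparison)
    then show ?thesis by (rule LIM_zero_cancel)
  qed
  have "\<exists>x\<in>unit_cube_nat n. \<forall>i<n. T (r x) i = x i"
  proof (rule brouwer_unit_cube_nat)
    show "T (r x) \<in> unit_cube_nat n" for x using maps[OF r(1)] S(3) by blast
    fix X :: "nat \<Rightarrow> nat \<Rightarrow> real" and x :: "nat \<Rightarrow> real" and i
    assume X: "\<And>i. i < n \<Longrightarrow> (\<lambda>k. X k i) \<longlonglongrightarrow> x i" and i: "i < n"
    show "(\<lambda>k. T (r (X k)) i) \<longlonglongrightarrow> T (r x) i"
      by (rule cont) (use r(1) r_lim[OF X] i in auto)
  qed
  then obtain x where x: "x \<in> unit_cube_nat n" "\<forall>i<n. T (r x) i = x i" by blast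
  have "T (r x) \<in> S" by (rule maps[OF r(1)])
  then have "T (r x) \<in> unit_cube_nat n" using S(3) by blast
  then have Tx: "T (r x) = x" using x by (intro ext) (metis (mono_tags, lifting) mem_Collect_eq not_less unit_cube_nat_def)
  then have "x \<in> S" using \<open>T (r x) \<in> S\<close> by simp
  then have "D x (r x) \<le> D x x" by (rule r(2))
  then have "(\<Sum>i<n. (x i - r x i)\<^sup>2) \<le> 0" by (simp add: D_def)
  then have "(\<Sum>i<n. (x i - r x i)\<^sup>2) = 0" by (intro antisym sum_nonneg) auto
  then have "\<forall>i\<in>{..<n}. (x i - r x i)\<^sup>2 = 0" by (subst (asm) sum_nonneg_eq_0_iff) auto
  then have "r x i = x i" for i
    using r(1)[of x] S(3) x(1) by (cases "i < n") (auto simp: unit_cube_nat_def)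
  then have "r x = x" by (rule ext)
  then show ?thesis using Tx \<open>x \<in> S\<close> by auto
qed

section \<open>Existence\<close>

lemma positive_spanning_of_not_hemisphere:
  assumes "\<not> in_closed_hemisphere N v" and "u \<noteq> 0"
  shows "\<exists>j<N. u \<bullet> v j > 0"
proof -
  define w where "w = - (u /\<^sub>R norm u)"
  have "w \<in> sphere 0 1" using assms(2) by (simp add: w_def)
  then obtain j where j: "j < N" "v j \<bullet> w < 0"
    using assms(1) unfolding in_closed_hemisphere_def by (meson not_less)
  then have "(v j \<bullet> u) / norm u > 0" by (simp add: w_def divide_inverse_commute)
  then show ?thesis using j(1) assms(2) by (auto simp: zero_less_divide_iff inner_commute)
qed

text \<open>Fewer than n vectors leave a nonzero vector orthogonal to all of them.\<close>

lemma DIM_le_of_positive_spanning: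
  fixes v :: "nat \<Rightarrow> 'a::euclidean_space"
  assumes "\<And>u. u \<noteq> 0 \<Longrightarrow> \<exists>j<N. u \<bullet> v j > 0"
  shows "DIM('a) \<le> N"
proof (rule ccontr)
  assume "\<not> ?thesis"
  moreover have "dim (v ` {..<N}) \<le> card (v ` {..<N})" by (intro dim_le_card') simp
  moreover have "card (v ` {..<N}) \<le> N" using card_image_le[of "{..<N}" v] by simp
  ultimately have "dim (v ` {..<N}) < DIM('a)" by linarith
  then obtain x where x: "x \<noteq> 0" "\<And>y. y \<in> span (v ` {..<N}) \<Longrightarrow> orthogonal x y"
    using orthogonal_to_subspace_exists by blast
  obtain j where "j < N" "x \<bullet> v j > 0" using assms[OF x(1)] by blast
  moreover have "v j \<in> span (v ` {..<N})" using \<open>j < N\<close> by (auto intro: span_base)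
  ultimately show False using x(2)[of "v j"] by (simp add: orthogonal_def)
qed

lemma extend_index_set:
  assumes "J \<subseteq> {..<N}" "card J \<le> n" "n \<le> N"
  obtains I where "J \<subseteq> I" "I \<subseteq> {..<N}" "card I = n"
proof -
  have "\<exists>I. J \<subseteq> I \<and> I \<subseteq> {..<N} \<and> card I = n"
    using assms by (intro exists_subset_between) simp_all
  then show thesis by (elim exE conjE) (rule that)
qed

text \<open>The pair is extended to n indices, where general position gives linear
  independence.\<close>

lemma general_position_not_parallel:
  fixes v :: "nat \<Rightarrow> 'a::euclidean_space"
  assumes gp: "general_position N v" and dim: "2 \<le> DIM('a)" "DIM('a) \<le> N"
    and ij: "i < N" "j < N" "i \<noteq> j"
  shows "v j \<noteq> c *\<^sub>R v i"
proof
  assume eq: "v j = c *\<^sub>R v i"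
  obtain I where I: "{i, j} \<subseteq> I" "I \<subseteq> {..<N}" "card I = DIM('a)"
    by (rule extend_index_set[of "{i, j}" N "DIM('a)"]) (use ij dim in auto)
  then have inj: "inj_on v I" and ind: "independent (v ` I)" using gp by (auto simp: general_position_def)
  have "v i \<noteq> v j" using inj I(1) ij(3) by (auto dest: inj_onD)
  then have "v i \<in> v ` I - {v j}" using I(1) by auto
  then have "v j \<in> span (v ` I - {v j})" unfolding eq by (intro span_scale span_base)
  moreover have "v j \<in> v ` I" using I(1) by auto
  ultimately show False using ind by (auto simp: dependent_def)
qed

text \<open>The positive support of a linear relation contains a basis and is linearly dependent, so it
  positively spans the space.\<close>
lemma relation_positive_direction:
  fixes v :: "nat \<Rightarrow> 'a::euclidean_space"
  assumes gp: "general_position N v" and dim: "DIM('a) \<le> N"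
    and w: "\<And>i. i < N \<Longrightarrow> 0 \<le> w i" "(\<Sum>i<N. w i) = 1" "(\<Sum>i<N. w i *\<^sub>R v i) = 0" and "u \<noteq> 0"
  shows "\<exists>j<N. 0 < w j * (u \<bullet> v j)"
proof (rule ccontr)
  assume neg: "\<not> ?thesis"
  have le: "w j * (u \<bullet> v j) \<le> 0" if "j < N" for j using neg that by (meson not_less)
  have "(\<Sum>j<N. w j * (u \<bullet> v j)) = u \<bullet> (\<Sum>i<N. w i *\<^sub>R v i)" by (simp add: inner_sum_right)
  \<comment> \<open>The relation makes these terms of one sign sum to 0, so each of them
    vanishes.\<close>
  then have "(\<Sum>j<N. - (w j * (u \<bullet> v j))) = 0" using w(3) by (simp add: sum_negf)
  then have "\<forall>j\<in>{..<N}. - (w j * (u \<bullet> v j)) = 0"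
    by (subst (asm) sum_nonneg_eq_0_iff) (use le in auto)
  then have zero: "w j * (u \<bullet> v j) = 0" if "j < N" for j using that by auto
  define J where "J = {j. j < N \<and> 0 < w j}"
  have J: "J \<subseteq> {..<N}" "finite J" by (auto simp: J_def)
  have uJ: "u \<bullet> v j = 0" if "j \<in> J" for j using zero[of j] that by (auto simp: J_def)
  have wJ: "w j = 0" if "j < N" "j \<notin> J" for j using w(1)[of j] that by (auto simp: J_def)
  show False
  \<comment> \<open>With at least n positive coefficients the vectors span the space and
    \<open>u\<close> is orthogonal to all of it. With fewer, they are independent, so all
    coefficients vanish, against the sum 1.\<close>
  proof (cases "DIM('a) \<le> card J")
    case True
    then obtain I where I: "I \<subseteq> J" "card I = DIM('a)" using J(2) obtain_subset_with_card_n by metis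
    then have inj: "inj_on v I" and ind: "independent (v ` I)"
      using gp J(1) by (auto simp: general_position_def)
    have "card (v ` I) = DIM('a)" using inj I by (simp add: card_image)
    moreover have "finite (v ` I)" using I(1) J(2) finite_subset by blast
    ultimately have "UNIV \<subseteq> span (v ` I)"
      using ind card_eq_dim[of "v ` I" UNIV] by (simp add: dim_UNIV)
    then have "span (v ` I) = UNIV" by blast
    moreover have "orthogonal u y" if "y \<in> span (v ` I)" for y
      by (rule orthogonal_to_span[OF that]) (use uJ I in \<open>auto simp: orthogonal_def\<close>)
    ultimately have "orthogonal u u" by blast
    then show False using \<open>u \<noteq> 0\<close> by (simp add: orthogonal_def)
  next
    case False
    then have "card J \<le> DIM('a)" by simp
    then obtain I where I: "J \<subseteq> I" "I \<subseteq> {..<N}" "card I = DIM('a)"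
      using extend_index_set[OF J(1) _ dim] by metis
    then have inj: "inj_on v I" and ind: "independent (v ` I)" using gp by (auto simp: general_position_def)
    have finI: "finite I" using I(2) finite_subset by blast
    have "(\<Sum>x\<in>v ` I. w (inv_into I v x) *\<^sub>R x) = (\<Sum>i\<in>I. w i *\<^sub>R v i)"
      using inj by (simp add: sum.reindex)
    also have "\<dots> = (\<Sum>i<N. w i *\<^sub>R v i)"
      using I wJ by (intro sum.mono_neutral_left) auto
    finally have rel: "(\<Sum>x\<in>v ` I. w (inv_into I v x) *\<^sub>R x) = 0" using w(3) by simp
    have "w i = 0" if "i < N" for i
    proof (cases "i \<in> I")
      case True
      then have "w (inv_into I v (v i)) = 0"
        using finI by (intro independentD[OF ind _ _ rel]) auto
      then show ?thesis using inj True by simp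
    next
      case False
      then show ?thesis using wJ[OF that] I(1) by blast
    qed
    then have "(\<Sum>i<N. w i) = 0" by simp
    then show False using w(2) by simp
  qed
qed

context facet_normals begin

text \<open>A point of the ball outside the hull could be separated from it, which gives a direction
  in which no normal reaches the bound of \<open>inner_lower_bound\<close>.\<close>

lemma ball_subset_convex_hull:
  obtains c where "c > 0" "cball 0 c \<subseteq> convex hull (v ` {..<N})"
proof -
  obtain c where c: "c > 0" "\<And>x. \<exists>j<N. c * norm x \<le> x \<bullet> v j" using inner_lower_bound by blast
  let ?K = "convex hull (v ` {..<N})"
  have "cball 0 c \<subseteq> ?K"
  proof
    fix y :: 'a assume y: "y \<in> cball 0 c"
    show "y \<in> ?K"
    proof (rule ccontr)
      assume "y \<notin> ?K"
      moreover have "closed ?K" by (intro compact_imp_closed finite_imp_compact_convex_hull) simp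
      ultimately obtain a b where ab: "a \<bullet> y < b" "\<And>x. x \<in> ?K \<Longrightarrow> b < a \<bullet> x"
        using separating_hyperplane_closed_point[of ?K y] convex_convex_hull by blast
      obtain j where j: "j < N" "c * norm (- a) \<le> - a \<bullet> v j" using c(2) by blast
      have "v j \<in> ?K" using j(1) by (intro hull_inc) auto
      then have "b < a \<bullet> v j" by (rule ab(2))
      then have "c * norm a < - (a \<bullet> y)" using j ab(1) by simp
      also have "\<dots> \<le> norm a * norm y" using Cauchy_Schwarz_ineq2[of a y] by linarith
      also have "\<dots> \<le> norm a * c" using y by (intro mult_left_mono) auto
      finally show False by (simp add: mult.commute)
    qed
  qed
  with c(1) show thesis by (rule that)
qed

text \<open>Since the hull contains a ball, -c times each normal is a nonnegative combination of
  normals. Adding c times that normal and summing over all of them gives a relation with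
  coefficients at least \<open>c\<close>, which is then normalised.\<close>

lemma positive_relation:
  obtains w where "\<And>i. i < N \<Longrightarrow> 0 < w i" "(\<Sum>i<N. w i) = 1" "(\<Sum>i<N. w i *\<^sub>R v i) = 0"
proof -
  obtain c where c: "c > 0" "cball 0 c \<subseteq> convex hull (v ` {..<N})" using ball_subset_convex_hull by blast
  have inj: "inj_on v {..<N}" by (auto intro!: inj_onI dest: inj_v)
  have "\<exists>\<mu>. (\<forall>j<N. 0 \<le> \<mu> j) \<and> (\<Sum>j<N. \<mu> j *\<^sub>R v j) = - c *\<^sub>R v i" if i: "i < N" for i
  proof -
    have "- c *\<^sub>R v i \<in> convex hull (v ` {..<N})" using c norm_v[OF i] by (intro subsetD[OF c(2)]) simp
    then obtain \<mu> where \<mu>: "\<And>x. x \<in> v ` {..<N} \<Longrightarrow> 0 \<le> \<mu> x" "(\<Sum>x\<in>v ` {..<N}. \<mu> x *\<^sub>R x) = - c *\<^sub>R v i"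
      by (subst (asm) convex_hull_finite) auto
    then show ?thesis using inj by (intro exI[of _ "\<lambda>j. \<mu> (v j)"]) (simp add: sum.reindex)
  qed
  then obtain \<mu> where \<mu>: "\<And>i j. i < N \<Longrightarrow> j < N \<Longrightarrow> 0 \<le> \<mu> i j"
    "\<And>i. i < N \<Longrightarrow> (\<Sum>j<N. \<mu> i j *\<^sub>R v j) = - c *\<^sub>R v i" by metis
  define W where "W = (\<lambda>j. c + (\<Sum>i<N. \<mu> i j))"
  have W: "W j > 0" if "j < N" for j
    unfolding W_def using c(1) \<mu>(1) that by (intro add_pos_nonneg sum_nonneg) auto
  have "(\<Sum>j<N. W j *\<^sub>R v j) = (\<Sum>j<N. c *\<^sub>R v j) + (\<Sum>i<N. \<Sum>j<N. \<mu> i j *\<^sub>R v j)"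
    by (subst sum.swap) (simp add: W_def scaleR_add_left scaleR_sum_left sum.distrib)
  also have "\<dots> = 0" by (simp add: \<mu>(2) sum_negf)
  finally have W0: "(\<Sum>j<N. W j *\<^sub>R v j) = 0" .
  obtain b :: 'a where "b \<noteq> 0" using nonzero_Basis nonempty_Basis by blast
  then obtain k where "k < N" using positive_spanning by blast
  then have tot: "(\<Sum>j<N. W j) > 0" using W by (intro sum_pos) auto
  show thesis
  proof
    show "0 < W i / (\<Sum>j<N. W j)" if "i < N" for i using W[OF that] tot by simp
    show "(\<Sum>i<N. W i / (\<Sum>j<N. W j)) = 1" using tot by (simp add: sum_divide_distrib[symmetric])
    have "(\<Sum>i<N. (W i / (\<Sum>j<N. W j)) *\<^sub>R v i) = (1 / (\<Sum>j<N. W j)) *\<^sub>R (\<Sum>j<N. W j *\<^sub>R v j)"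
      unfolding scaleR_sum_right by (intro sum.cong refl) simp
    then show "(\<Sum>i<N. (W i / (\<Sum>j<N. W j)) *\<^sub>R v i) = 0" using W0 by simp
  qed
qed

section \<open>The compact convex set of normalised relations\<close>

definition relations :: "real \<Rightarrow> (nat \<Rightarrow> real) set" where
  "relations \<epsilon> = {w \<in> unit_cube_nat N. (\<forall>i<N. \<epsilon> \<le> w i) \<and> (\<Sum>i<N. w i) = 1 \<and> (\<Sum>i<N. w i *\<^sub>R v i) = 0}"

lemma compact_relations: "compact (relations \<epsilon>)"
proof -
  have "relations \<epsilon> = unit_cube_nat N \<inter> ((\<Inter>i\<in>{..<N}. {w. \<epsilon> \<le> w i}) \<inter> {w. (\<Sum>i<N. w i) = 1} \<inter> {w. (\<Sum>i<N. w i *\<^sub>R v i) = 0})"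
    by (auto simp: relations_def)
  moreover have "closed ((\<Inter>i\<in>{..<N}. {w. \<epsilon> \<le> w i}) \<inter> {w. (\<Sum>i<N. w i) = 1} \<inter> {w::nat \<Rightarrow> real. (\<Sum>i<N. w i *\<^sub>R v i) = 0})"
    by (intro closed_Int closed_INT ballI closed_Collect_le closed_Collect_eq continuous_intros
        continuous_on_product_coordinates)
  ultimately show ?thesis by (simp add: compact_Int_closed[OF compact_unit_cube_nat])
qed

lemma relations_mem:
  assumes "0 \<le> \<epsilon>" "\<And>i. i < N \<Longrightarrow> \<epsilon> \<le> w i" "\<And>i. N \<le> i \<Longrightarrow> w i = 0" "(\<Sum>i<N. w i) = 1" "(\<Sum>i<N. w i *\<^sub>R v i) = 0"
  shows "w \<in> relations \<epsilon>"
proof -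
  have "w i \<le> 1" if "i < N" for i
  proof -
    have "w i \<le> (\<Sum>i<N. w i)" using that assms(1,2) by (intro member_le_sum) (auto intro: order_trans)
    then show ?thesis using assms(4) by simp
  qed
  then show ?thesis using assms by (auto simp: relations_def unit_cube_nat_def intro: order_trans)
qed

lemma relations_convex:
  assumes "x \<in> relations \<epsilon>" "y \<in> relations \<epsilon>" "0 \<le> t" "t \<le> 1" "0 \<le> \<epsilon>"
  shows "(\<lambda>i. x i + t * (y i - x i)) \<in> relations \<epsilon>"
proof (rule relations_mem)
  fix i
  show "\<epsilon> \<le> x i + t * (y i - x i)" if "i < N"
  proof -
    have "(1 - t) * \<epsilon> + t * \<epsilon> \<le> (1 - t) * x i + t * y i"
      using assms that by (intro add_mono mult_left_mono) (auto simp: relations_def)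
    then show ?thesis by (simp add: algebra_simps)
  qed
  show "x i + t * (y i - x i) = 0" if "N \<le> i"
    using assms that by (simp add: relations_def unit_cube_nat_def)
next
  have "(\<Sum>i<N. x i + t * (y i - x i)) = (\<Sum>i<N. x i) + t * ((\<Sum>i<N. y i) - (\<Sum>i<N. x i))"
    by (simp add: sum.distrib sum_subtractf sum_distrib_left[symmetric])
  then show "(\<Sum>i<N. x i + t * (y i - x i)) = 1" using assms by (simp add: relations_def)
  have "(\<Sum>i<N. (x i + t * (y i - x i)) *\<^sub>R v i)
      = (\<Sum>i<N. x i *\<^sub>R v i) + t *\<^sub>R ((\<Sum>i<N. y i *\<^sub>R v i) - (\<Sum>i<N. x i *\<^sub>R v i))"
    unfolding sum_subtractf[symmetric] scaleR_sum_right sum.distrib[symmetric]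
    by (intro sum.cong refl) (simp add: scaleR_add_left scaleR_diff_left scaleR_diff_right right_diff_distrib)
  then show "(\<Sum>i<N. (x i + t * (y i - x i)) *\<^sub>R v i) = 0" using assms by (simp add: relations_def)
qed fact

text \<open>By \<open>relation_positive_direction\<close> the sum of the positive parts is positive
  on a compact set; one of its N terms is at least the N-th part of the minimum. The resulting
  \<open>c\<close> bounds all polytopes P(w) at once.\<close>

lemma relations_direction_bound:
  assumes gp: "general_position N v" and dimN: "DIM('a) \<le> N"
  obtains c where "c > 0" "\<And>w u. w \<in> relations 0 \<Longrightarrow> norm u = 1 \<Longrightarrow> \<exists>j<N. c \<le> w j * (u \<bullet> v j)"
proof -
  have N0: "N > 0" using dimN DIM_positive[where 'a='a] by linarith
  define m where "m = (\<lambda>p::(nat \<Rightarrow> real) \<times> 'a. \<Sum>j<N. max 0 (fst p j * (snd p \<bullet> v j)))"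
  have m_pos: "m (w, u) > 0" if "w \<in> relations 0" "norm u = 1" for w u
  proof -
    have "u \<noteq> 0" using that by auto
    then obtain j where "j < N" "0 < w j * (u \<bullet> v j)"
      using relation_positive_direction[OF gp dimN, of w u] \<open>w \<in> relations 0\<close> by (auto simp: relations_def)
    then show ?thesis unfolding m_def by (intro sum_pos2[of _ j]) auto
  qed
  have coord: "continuous_on A (\<lambda>p::(nat \<Rightarrow> real) \<times> 'a. fst p j)" for A j
    by (rule continuous_on_compose2[OF continuous_on_product_coordinates[of j] continuous_on_fst[OF continuous_on_id]]) auto
  have cont: "continuous_on (relations 0 \<times> sphere 0 1) m"
    unfolding m_def by (intro continuous_intros coord)
  have comp: "compact (relations 0 \<times> sphere (0::'a) 1)" by (intro compact_Times compact_relations compact_sphere)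
  obtain w where w: "\<And>i. i < N \<Longrightarrow> 0 < w i" "(\<Sum>i<N. w i) = 1" "(\<Sum>i<N. w i *\<^sub>R v i) = 0"
    using positive_relation by blast
  have "(\<lambda>i. if i < N then w i else 0) \<in> relations 0"
    using w by (intro relations_mem) (auto intro: less_imp_le)
  moreover have "sphere (0::'a) 1 \<noteq> {}" by simp
  ultimately have "relations 0 \<times> sphere (0::'a) 1 \<noteq> {}" by blast
  from continuous_attains_inf[OF comp this cont] obtain p where
    p: "p \<in> relations 0 \<times> sphere 0 1" "\<And>p'. p' \<in> relations 0 \<times> sphere 0 1 \<Longrightarrow> m p \<le> m p'" by blast
  have mp: "m p > 0" using m_pos[of "fst p" "snd p"] p(1) by (cases p) auto
  show thesis
  proof (rule that[of "m p / N"])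
    show "m p / N > 0" using mp N0 by simp
    fix w u assume wu: "w \<in> relations 0" "norm (u::'a) = 1"
    show "\<exists>j<N. m p / N \<le> w j * (u \<bullet> v j)"
    proof (rule ccontr)
      assume "\<not> ?thesis"
      then have "max 0 (w j * (u \<bullet> v j)) < m p / N" if "j < N" for j
        using that mp N0 by (auto simp: not_le)
      then have "m (w, u) < (\<Sum>j<N. m p / N)"
        unfolding m_def using N0 by (intro sum_strict_mono) auto
      also have "\<dots> = m p" using N0 by simp
      finally show False using p(2)[of "(w, u)"] wu by auto
    qed
  qed
qed

text \<open>Here \<Lambda> is the sum of all facet fluxes at the fixed point;
  \<open>existence\<close> removes it by a dilation.\<close>

lemma fixed_direction:
  assumes gp: "general_position N v" and dimN: "DIM('a) \<le> N"
    and p: "0 \<le> p" "p < 1" and q: "q > 0" and \<alpha>: "\<And>i. i < N \<Longrightarrow> 0 < \<alpha> i"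
  obtains h \<Lambda> where "\<And>i. i < N \<Longrightarrow> 0 < h i" "\<Lambda> > 0"
    "\<And>i. i < N \<Longrightarrow> h i powr (1 - p) * total_flux q h i = \<Lambda> * \<alpha> i"
proof -
  have N0: "N > 0" using dimN DIM_positive[where 'a='a] by linarith
  obtain c where c: "c > 0" "\<And>w u. w \<in> relations 0 \<Longrightarrow> norm u = 1 \<Longrightarrow> \<exists>j<N. c \<le> w j * (u \<bullet> v j)"
    using relations_direction_bound[OF gp dimN] by blast
  define a where "a = 1 / (1 - p)"
  have a: "a > 0" using p by (simp add: a_def)
  define H where "H = (\<lambda>w i. (\<alpha> i / w i) powr a)"
  \<comment> \<open>For nonzero x in P(w) some facet j satisfies c |x| \<le> w_j (x . v_j) and w_j
    \<ge> c. Its support number is then at most (alpha_j / c)^a, and |x| is bounded by this number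
    divided by c.\<close>
  define R where "R = (\<Sum>j<N. (\<alpha> j / c) powr a) / c"
  have R0: "R \<ge> 0" unfolding R_def using c(1) by (intro divide_nonneg_pos sum_nonneg) auto
  \<comment> \<open>Calibrated so that w_i \<le> \<epsilon> gives h_i \<ge> R + 1, which puts the
    i-th hyperplane outside the ball of radius \<open>R\<close>.\<close>
  define \<epsilon> where "\<epsilon> = Min (\<alpha> ` {..<N}) / (R + 1) powr (1 - p)"
  have \<epsilon>: "\<epsilon> > 0"
  proof -
    have "Min (\<alpha> ` {..<N}) > 0" using \<alpha> N0 by (subst Min_gr_iff) auto
    then show ?thesis using R0 by (simp add: \<epsilon>_def)
  qed
  have \<epsilon>_le: "(R + 1) powr (1 - p) \<le> \<alpha> i / \<epsilon>" if "i < N" for i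
  proof -
    have "Min (\<alpha> ` {..<N}) \<le> \<alpha> i" using that by simp
    then have "\<epsilon> * (R + 1) powr (1 - p) \<le> \<alpha> i" using R0 by (simp add: \<epsilon>_def)
    then show ?thesis using \<epsilon> by (simp add: field_simps)
  qed
  obtain w0 where w0: "\<And>i. i < N \<Longrightarrow> 0 < w0 i" "(\<Sum>i<N. w0 i) = 1" "(\<Sum>i<N. w0 i *\<^sub>R v i) = 0"
    using positive_relation by blast
  \<comment> \<open>At most the minimum of \<open>w0\<close> to keep the domain nonempty, and at
    most \<epsilon> / 2 to leave room for one step.\<close>
  define \<epsilon>' where "\<epsilon>' = min (\<epsilon> / 2) (Min (w0 ` {..<N}))"
  have \<epsilon>': "\<epsilon>' > 0" "\<epsilon>' \<le> \<epsilon> / 2" "\<And>i. i < N \<Longrightarrow> \<epsilon>' \<le> w0 i"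
  proof -
    have "Min (w0 ` {..<N}) > 0" using w0(1) N0 by (subst Min_gr_iff) auto
    then show "\<epsilon>' > 0" using \<epsilon> by (simp add: \<epsilon>'_def)
    show "\<epsilon>' \<le> \<epsilon> / 2" by (simp add: \<epsilon>'_def)
    show "\<epsilon>' \<le> w0 i" if "i < N" for i
    proof -
      have "Min (w0 ` {..<N}) \<le> w0 i" using that by simp
      then show ?thesis unfolding \<epsilon>'_def by linarith
    qed
  qed
  let ?S = "relations \<epsilon>'"
  have Spos: "0 < w i" if "w \<in> ?S" "i < N" for w i
    using that \<epsilon>'(1) by (force simp: relations_def)
  have Sle: "w i \<le> 1" if "w \<in> ?S" "i < N" for w i
    using that by (simp add: relations_def unit_cube_nat_def)
  have S0: "w \<in> relations 0" if "w \<in> ?S" for w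
    using that \<epsilon>'(1) by (auto simp: relations_def intro: order_trans less_imp_le)
  have Hpos: "0 < H w i" if "w \<in> ?S" "i < N" for w i
    using Spos[OF that] \<alpha>[OF that(2)] by (simp add: H_def)
  have bound: "norm x \<le> R" if w: "w \<in> ?S" and x: "x \<in> P (H w)" for w x
  proof (cases "x = 0")
    case False
    define u where "u = x /\<^sub>R norm x"
    have "norm u = 1" using False by (simp add: u_def)
    then obtain j where j: "j < N" "c \<le> w j * (u \<bullet> v j)" using c(2)[OF S0[OF w]] by blast
    have wj: "0 < w j" "w j \<le> 1" using Spos[OF w j(1)] Sle[OF w j(1)] by auto
    have "u \<bullet> v j \<le> 1" using norm_cauchy_schwarz[of u "v j"] norm_v[OF j(1)] \<open>norm u = 1\<close> by simp
    then have "w j * (u \<bullet> v j) \<le> w j" using wj by (simp add: mult_left_le)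
    then have cw: "c \<le> w j" using j(2) by linarith
    have "norm x * c \<le> norm x * (w j * (u \<bullet> v j))" using j(2) by (intro mult_left_mono) auto
    also have "\<dots> = w j * (x \<bullet> v j)" using False by (simp add: u_def)
    also have "\<dots> \<le> w j * H w j" using x j(1) wj by (intro mult_left_mono) (auto simp: mem_P)
    also have "\<dots> \<le> H w j" using wj Hpos[OF w j(1)] by (simp add: mult_left_le_one_le)
    also have "\<dots> \<le> (\<alpha> j / c) powr a"
      unfolding H_def using cw c(1) \<alpha>[OF j(1)] a wj
      by (intro powr_mono2 divide_left_mono) (auto intro: less_imp_le divide_nonneg_pos)
    also have "\<dots> \<le> (\<Sum>j<N. (\<alpha> j / c) powr a)" using j(1) by (intro member_le_sum) auto
    finally show ?thesis using c(1) by (simp add: R_def field_simps)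
  qed (use R0 in simp)
  have small: "total_flux q (H w) i = 0" if w: "w \<in> ?S" and i: "i < N" and "w i \<le> \<epsilon>" for w i
  proof (rule total_flux_missing_facet[OF i q])
    fix z assume z: "z \<in> P (H w)"
    have "\<alpha> i / \<epsilon> \<le> \<alpha> i / w i"
      using \<open>w i \<le> \<epsilon>\<close> Spos[OF w i] \<alpha>[OF i] \<epsilon> by (intro divide_left_mono) auto
    then have "(R + 1) powr (1 - p) \<le> \<alpha> i / w i" using \<epsilon>_le[OF i] by linarith
    then have "((R + 1) powr (1 - p)) powr a \<le> H w i"
      unfolding H_def using a by (intro powr_mono2) auto
    moreover have "((R + 1) powr (1 - p)) powr a = R + 1" using R0 p by (simp add: powr_powr a_def)
    ultimately have "R < H w i" by linarith
    moreover have "z \<bullet> v i \<le> R"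
      using norm_cauchy_schwarz[of z "v i"] norm_v[OF i] bound[OF w z] by simp
    ultimately show "z \<bullet> v i \<noteq> H w i" by linarith
  qed
  define \<Lambda> where "\<Lambda> = (\<lambda>w. \<Sum>i<N. total_flux q (H w) i)"
  have \<Lambda>: "\<Lambda> w > 0" if w: "w \<in> ?S" for w
  proof -
    have "\<exists>i<N. total_flux q (H w) i > 0" by (rule total_flux_pos[OF Hpos[OF w] q])
    then obtain i where "i < N" "total_flux q (H w) i > 0" by blast
    then show ?thesis unfolding \<Lambda>_def by (intro sum_pos2[of _ i]) (auto simp: total_flux_nonneg)
  qed
  \<comment> \<open>A component above \<epsilon> decreases by at most t, as \<tau> is at most 1, and
    therefore stays above \<epsilon> / 2.\<close>
  define t where "t = \<epsilon> / 2"
  define \<tau> where "\<tau> = (\<lambda>w i. if i < N then total_flux q (H w) i / \<Lambda> w else 0)"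
  define F where "F = (\<lambda>w i. w i + t * (w i - \<tau> w i))"
  have \<tau>1: "\<tau> w i \<le> 1" if w: "w \<in> ?S" for w i
  proof -
    have "total_flux q (H w) i \<le> \<Lambda> w" if "i < N"
      unfolding \<Lambda>_def using that by (intro member_le_sum) (auto simp: total_flux_nonneg)
    then show ?thesis using \<Lambda>[OF w] by (simp add: \<tau>_def)
  qed
  have "\<exists>w\<in>?S. F w = w"
  proof (rule brouwer_nat_convex[OF compact_relations])
    have "(\<lambda>i. if i < N then w0 i else 0) \<in> ?S"
      using w0 \<epsilon>' by (intro relations_mem) (auto intro: less_imp_le)
    then show "?S \<noteq> {}" by blast
    show "?S \<subseteq> unit_cube_nat N" by (auto simp: relations_def)
    show "(\<lambda>i. x i + s * (y i - x i)) \<in> ?S" if "x \<in> ?S" "y \<in> ?S" "0 \<le> s" "s \<le> 1" for x y s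
      using that \<epsilon>'(1) by (intro relations_convex) auto
    show "F w \<in> ?S" if w: "w \<in> ?S" for w
    proof (rule relations_mem)
      show "0 \<le> \<epsilon>'" using \<epsilon>' by simp
      fix i
      show "F w i = 0" if "N \<le> i" using w that by (simp add: F_def \<tau>_def relations_def unit_cube_nat_def)
      show "\<epsilon>' \<le> F w i" if i: "i < N"
      proof (cases "w i \<le> \<epsilon>")
        case True
        \<comment> \<open>The step then multiplies the component by 1 + t.\<close>
        then have "\<tau> w i = 0" using small[OF w i] by (simp add: \<tau>_def)
        moreover have "0 \<le> t * w i" using \<epsilon> Spos[OF w i] by (simp add: t_def)
        moreover have "\<epsilon>' \<le> w i" using w i by (simp add: relations_def)
        ultimately show ?thesis by (simp add: F_def)
      next
        case False
        have "t * \<tau> w i \<le> t" using \<tau>1[OF w, of i] \<epsilon> by (simp add: t_def)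
        moreover have "0 \<le> t * w i" using \<epsilon> Spos[OF w i] by (simp add: t_def)
        ultimately show ?thesis using False \<epsilon>'(2) by (simp add: F_def t_def right_diff_distrib)
      qed
    next
      have \<tau>sum: "(\<Sum>i<N. \<tau> w i) = 1"
      proof -
        have "(\<Sum>i<N. \<tau> w i) = \<Lambda> w / \<Lambda> w" by (simp add: \<tau>_def \<Lambda>_def sum_divide_distrib[symmetric])
        then show ?thesis using \<Lambda>[OF w] by simp
      qed
      have \<tau>v: "(\<Sum>i<N. \<tau> w i *\<^sub>R v i) = 0"
      proof -
        have "(\<Sum>i<N. \<tau> w i *\<^sub>R v i) = (1 / \<Lambda> w) *\<^sub>R (\<Sum>i<N. total_flux q (H w) i *\<^sub>R v i)"
          unfolding scaleR_sum_right by (intro sum.cong refl) (simp add: \<tau>_def)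
        then show ?thesis by (simp add: total_flux_balance[OF q])
      qed
      have "(\<Sum>i<N. F w i) = (\<Sum>i<N. w i) + t * ((\<Sum>i<N. w i) - (\<Sum>i<N. \<tau> w i))"
        by (simp add: F_def sum.distrib sum_subtractf sum_distrib_left[symmetric])
      then show "(\<Sum>i<N. F w i) = 1" using w \<tau>sum by (simp add: relations_def)
      have "(\<Sum>i<N. F w i *\<^sub>R v i) = (\<Sum>i<N. w i *\<^sub>R v i) + t *\<^sub>R ((\<Sum>i<N. w i *\<^sub>R v i) - (\<Sum>i<N. \<tau> w i *\<^sub>R v i))"
        unfolding F_def sum_subtractf[symmetric] scaleR_sum_right sum.distrib[symmetric]
        by (intro sum.cong refl) (simp add: scaleR_add_left scaleR_diff_left scaleR_diff_right right_diff_distrib)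
      then show "(\<Sum>i<N. F w i *\<^sub>R v i) = 0" using w \<tau>v by (simp add: relations_def)
    qed
    fix X :: "nat \<Rightarrow> nat \<Rightarrow> real" and w i
    assume X: "\<And>k. X k \<in> ?S" "w \<in> ?S" "\<And>i. i < N \<Longrightarrow> (\<lambda>k. X k i) \<longlonglongrightarrow> w i" and i: "i < N"
    have Hlim: "(\<lambda>k. H (X k) j) \<longlonglongrightarrow> H w j" if "j < N" for j
      unfolding H_def using X(3)[OF that] Spos[OF X(2) that] \<alpha>[OF that]
      by (intro tendsto_powr tendsto_divide tendsto_const) auto
    have Flim: "(\<lambda>k. total_flux q (H (X k)) j) \<longlonglongrightarrow> total_flux q (H w) j" if "j < N" for j
      by (rule total_flux_tendsto[OF that q Hlim])
    have "(\<lambda>k. \<Lambda> (X k)) \<longlonglongrightarrow> \<Lambda> w" unfolding \<Lambda>_def using Flim by (intro tendsto_sum) auto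
    then show "(\<lambda>k. F (X k) i) \<longlonglongrightarrow> F w i"
      unfolding F_def \<tau>_def using i X(3)[OF i] Flim[OF i] \<Lambda>[OF X(2)]
      by (auto intro!: tendsto_intros)
  qed
  then obtain w where w: "w \<in> ?S" "F w = w" by blast
  show thesis
  proof
    show "0 < H w i" if "i < N" for i by (rule Hpos[OF w(1) that])
    show "0 < \<Lambda> w" by (rule \<Lambda>[OF w(1)])
    fix i assume i: "i < N"
    have "t * (w i - \<tau> w i) = 0" using fun_cong[OF w(2), of i] by (simp add: F_def)
    then have "\<tau> w i = w i" using \<epsilon> by (simp add: t_def)
    then have fl: "total_flux q (H w) i = w i * \<Lambda> w" using i \<Lambda>[OF w(1)] by (simp add: \<tau>_def field_simps)
    have "H w i powr (1 - p) = \<alpha> i / w i"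
      unfolding H_def using p Spos[OF w(1) i] \<alpha>[OF i] by (simp add: powr_powr a_def)
    then show "H w i powr (1 - p) * total_flux q (H w) i = \<Lambda> w * \<alpha> i"
      using Spos[OF w(1) i] by (simp add: fl)
  qed
qed

lemma existence:
  assumes gp: "general_position N v" and dimN: "DIM('a) \<le> N"
    and p: "0 \<le> p" "p < 1" and q: "q > 0" and \<alpha>: "\<And>i. i < N \<Longrightarrow> 0 < \<alpha> i"
  shows "\<exists>P \<in> polytopes_with_normals N v. 0 \<in> interior P \<and>
           (\<forall>\<eta> \<in> sets (restrict_space borel (sphere (0::'a) 1)).
              emeasure (Fpq_measure p q P) \<eta> = ennreal (\<Sum>i\<in>{i. i < N \<and> v i \<in> \<eta>}. \<alpha> i))"
proof -
  obtain h \<Lambda> where h: "\<And>i. i < N \<Longrightarrow> 0 < h i" and \<Lambda>: "\<Lambda> > 0"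
    and eq: "\<And>i. i < N \<Longrightarrow> h i powr (1 - p) * total_flux q h i = \<Lambda> * \<alpha> i"
    using fixed_direction[OF gp dimN p q, of \<alpha>] \<alpha> by metis
  define b where "b = q / (real DIM('a) * unit_ball_vol (real DIM('a)))"
  have b: "b > 0" using q by (simp add: b_def)
  \<comment> \<open>The homogeneity degree of the i-th equation: n + q - 2 from the flux and 1 - p
    from the support number. It is positive, so a dilation by a suitable \<open>s\<close> normalises
    the factor b \<Lambda> to 1.\<close>
  define e where "e = real DIM('a) + q - 2 + (1 - p)"
  have e: "e > 0" using dim p q by (simp add: e_def)
  define s where "s = (1 / (b * \<Lambda>)) powr (1 / e)"
  have s: "s > 0" using b \<Lambda> by (simp add: s_def)
  have "s powr e = 1 / (b * \<Lambda>)" using b \<Lambda> e by (simp add: s_def powr_powr)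
  then have se: "b * \<Lambda> * s powr e = 1" using b \<Lambda> by simp
  show ?thesis
  proof (rule solution_of_balance[OF q _ \<alpha>, where h="\<lambda>j. s * h j"])
    show "0 < s * h j" if "j < N" for j using s h[OF that] by simp
    fix i assume i: "i < N"
    have "(s * h i) powr (1 - p) * facet_mass q (\<lambda>j. s * h j) i
       = (s powr (1 - p) * h i powr (1 - p)) * (b * (s powr (real DIM('a) + q - 2) * total_flux q h i))"
      unfolding facet_mass_def total_flux_scale[OF i q s] b_def using s h[OF i] by (simp add: powr_mult)
    also have "\<dots> = b * (s powr (real DIM('a) + q - 2) * s powr (1 - p)) * (h i powr (1 - p) * total_flux q h i)"
      by (simp only: mult_ac)
    also have "\<dots> = b * s powr e * (\<Lambda> * \<alpha> i)" by (simp only: eq[OF i] e_def powr_add)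
    also have "\<dots> = (b * \<Lambda> * s powr e) * \<alpha> i" by (simp only: mult_ac)
    finally show "(s * h i) powr (1 - p) * facet_mass q (\<lambda>j. s * h j) i = \<alpha> i" by (simp add: se)
  qed
qed

end

theorem theorem4p5:
  fixes p q :: real and N :: nat and v :: "nat \<Rightarrow> 'a::euclidean_space"
    and \<alpha> :: "nat \<Rightarrow> real"
  assumes "DIM('a) \<ge> 2"
    and "0 \<le> p" and "p < 1" and "q > 0"
    and "\<forall>i<N. \<alpha> i > 0"
    and "\<forall>i<N. v i \<in> sphere 0 1"
    and "\<not> in_closed_hemisphere N v"
    and "general_position N v"
  shows "\<exists>P \<in> polytopes_with_normals N v. 0 \<in> interior P \<and>
           (\<forall>\<eta> \<in> sets (restrict_space borel (sphere (0::'a) 1)).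
              emeasure (Fpq_measure p q P) \<eta> = ennreal (\<Sum>i\<in>{i. i < N \<and> v i \<in> \<eta>}. \<alpha> i))"
proof -
  have span: "\<And>u. u \<noteq> 0 \<Longrightarrow> \<exists>j<N. u \<bullet> v j > 0"
    by (rule positive_spanning_of_not_hemisphere[OF assms(7)])
  then have dimN: "DIM('a) \<le> N" by (rule DIM_le_of_positive_spanning)
  obtain \<kappa> where \<kappa>: "\<kappa> > 0" "\<And>(v::'a) (g::'a \<Rightarrow> ennreal). norm v = 1 \<Longrightarrow> g \<in> borel_measurable borel \<Longrightarrow>
     (\<integral>\<^sup>+ x. g x \<partial>lborel) = ennreal \<kappa> * (\<integral>\<^sup>+ t. (\<integral>\<^sup>+ y. g (y + t *\<^sub>R v) \<partial>hyp v 0) \<partial>lborel)"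
    using nn_integral_lborel_slices[OF assms(1)] by metis
  interpret facet_normals \<kappa> "TYPE('a)" N v
    by unfold_locales
       (use assms(1,6) \<kappa> span general_position_not_parallel[OF assms(8,1) dimN] in auto)
  show ?thesis
    by (rule existence[OF assms(8) dimN assms(2-4)]) (use assms(5) in auto)
qed

end
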